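(* The Signed Domination problem is fixed-parameter tractable when parameterized by the twin cover number of the input graph.
   Context: All graphs are finite, simple and undirected. For a graph $G=(V,E)$ and $u\in V$, $N[u]=\{u\}\cup\{v:(u,v)\in E\}$ is the closed neighbourhood. A signed dominating function of $G$ is a function $f:V\to\{-1,1\}$ such that $\sum_{v\in N[u]}f(v)\ge 1$ for every $u\in V$; its weight is $\sum_{u\in V}f(u)$. Signed Domination: the input is a pair $(G,k)$, where $G$ is a graph and $k$ is an integer; the question is whether $G$ has a signed dominating function of weight at most $k$. An edge $(u,v)$ of $G=(V,E)$ is a twin edge if $N[u]=N[v]$. The twin cover number of $G$ is the minimum cardinality of a set $T\subseteq V$ such that every edge of $G$ is either a twin edge or incident to a vertex of $T$. A problem is fixed-parameter tractable (FPT) with respect to a parameter $p$ if it can be solved by an algorithm running in time $g(p)\cdot n^{O(1)}$, where $g$ is a computable function and $n$ is the input size. *)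

theory Defs
  imports "Graph_Theory.Pair_Digraph" "HOL-Library.Log_Nat" "HOL-Library.FuncSet"
begin

section \<open>Signed domination and twin covers\<close>

text \<open>
  A finite simple undirected graph is a \<open>pair_graph\<close>: finite, loop-free, and with a symmetric set of
  arcs, so that an undirected edge is represented by its two orientations.
\<close>

definition closed_nbhd :: "'a pair_pre_digraph \<Rightarrow> 'a \<Rightarrow> 'a set" where
  "closed_nbhd G u = insert u {v. (u, v) \<in> parcs G}"

definition signed_dominating :: "'a pair_pre_digraph \<Rightarrow> ('a \<Rightarrow> int) \<Rightarrow> bool" where
  "signed_dominating G f \<longleftrightarrow>
     f \<in> pverts G \<rightarrow> {-1, 1} \<and> (\<forall>u\<in>pverts G. (\<Sum>v\<in>closed_nbhd G u. f v) \<ge> 1)"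

definition weight :: "'a pair_pre_digraph \<Rightarrow> ('a \<Rightarrow> int) \<Rightarrow> int" where
  "weight G f = (\<Sum>u\<in>pverts G. f u)"

definition twin_edge :: "'a pair_pre_digraph \<Rightarrow> 'a \<Rightarrow> 'a \<Rightarrow> bool" where
  "twin_edge G u v \<longleftrightarrow> (u, v) \<in> parcs G \<and> closed_nbhd G u = closed_nbhd G v"

definition twin_cover :: "'a pair_pre_digraph \<Rightarrow> 'a set \<Rightarrow> bool" where
  "twin_cover G T \<longleftrightarrow>
     T \<subseteq> pverts G \<and> (\<forall>(u, v)\<in>parcs G. twin_edge G u v \<or> u \<in> T \<or> v \<in> T)"

definition twin_cover_number :: "'a pair_pre_digraph \<Rightarrow> nat" where
  "twin_cover_number G = (LEAST c. \<exists>T. twin_cover G T \<and> card T = c)"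


section \<open>Random access machines\<close>

text \<open>
  The model of computation is the RAM with the uniform cost measure: finitely many registers are
  mentioned by a program, the memory is unbounded and addressed indirectly through registers, and
  both hold natural numbers. The arithmetic instructions are addition, truncated subtraction and
  halving. There is no multiplication, so a number's length grows by at most one bit per step, and
  hence uniform-cost time is polynomially related to the running time of Turing machines. Control
  flow is structured; a branch or loop test is "register is nonzero".
\<close>

datatype program =
    Const nat nat          \<comment> \<open>\<open>r := c\<close>\<close>
  | Add nat nat nat        \<comment> \<open>\<open>r := a + b\<close>\<close>
  | Sub nat nat nat        \<comment> \<open>\<open>r := a - b\<close>\<close>
  | Half nat nat           \<comment> \<open>\<open>r := a div 2\<close>\<close>
  | Load nat nat           \<comment> \<open>\<open>r := memory[a]\<close>\<close>
  | Store nat nat          \<comment> \<open>\<open>memory[a] := b\<close>\<close>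
  | Skip
  | Seq program program
  | Ifnz nat program program
  | Whilenz nat program

text \<open>A state consists of the register contents and the memory contents.\<close>

type_synonym state = "(nat \<Rightarrow> nat) \<times> (nat \<Rightarrow> nat)"

text \<open>\<open>exec P s t s'\<close>: started in \<open>s\<close>, the program \<open>P\<close> halts in \<open>s'\<close> after exactly \<open>t\<close> steps.\<close>

inductive exec :: "program \<Rightarrow> state \<Rightarrow> nat \<Rightarrow> state \<Rightarrow> bool" where
  Const: "exec (Const r c) (R, M) 1 (R(r := c), M)"
| Add: "exec (Add r a b) (R, M) 1 (R(r := R a + R b), M)"
| Sub: "exec (Sub r a b) (R, M) 1 (R(r := R a - R b), M)"
| Half: "exec (Half r a) (R, M) 1 (R(r := R a div 2), M)"
| Load: "exec (Load r a) (R, M) 1 (R(r := M (R a)), M)"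
| Store: "exec (Store a b) (R, M) 1 (R, M(R a := R b))"
| Skip: "exec Skip s 1 s"
| Seq: "exec P s t s' \<Longrightarrow> exec Q s' t' s'' \<Longrightarrow> exec (Seq P Q) s (t + t') s''"
| Ifnz_nonzero: "fst s r \<noteq> 0 \<Longrightarrow> exec P s t s' \<Longrightarrow> exec (Ifnz r P Q) s (Suc t) s'"
| Ifnz_zero: "fst s r = 0 \<Longrightarrow> exec Q s t s' \<Longrightarrow> exec (Ifnz r P Q) s (Suc t) s'"
| Whilenz_stop: "fst s r = 0 \<Longrightarrow> exec (Whilenz r P) s 1 s"
| Whilenz_step: "fst s r \<noteq> 0 \<Longrightarrow> exec P s t s' \<Longrightarrow> exec (Whilenz r P) s' t' s''
    \<Longrightarrow> exec (Whilenz r P) s (Suc (t + t')) s''"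

inductive_cases exec_elims:
  "exec (Const r c) s t s'" "exec (Add r a b) s t s'" "exec (Sub r a b) s t s'"
  "exec (Half r a) s t s'" "exec (Load r a) s t s'" "exec (Store a b) s t s'" "exec Skip s t s'"
  "exec (Seq P Q) s t s'" "exec (Ifnz r P Q) s t s'"

inductive_cases exec_Whilenz_elim: "exec (Whilenz r P) s t s'"

lemma exec_deterministic:
  assumes "exec P s t s'" "exec P s u s''"
  shows "u = t \<and> s'' = s'"
  using assms
proof (induction arbitrary: u s'' rule: exec.induct)
  case (Seq P s t s' Q t' s2)
  from Seq.prems show ?case
    by (rule exec_elims(8)) (metis Seq.IH)
next
  case (Ifnz_nonzero s r P t s' Q)
  from Ifnz_nonzero.prems show ?case
    by (rule exec_elims(9)) (use Ifnz_nonzero.IH Ifnz_nonzero.hyps(1) in fastforce)+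
next
  case (Ifnz_zero s r Q t s' P)
  from Ifnz_zero.prems show ?case
    by (rule exec_elims(9)) (use Ifnz_zero.IH Ifnz_zero.hyps(1) in fastforce)+
next
  case (Whilenz_stop s r P)
  from Whilenz_stop.prems show ?case
    by (rule exec_Whilenz_elim) (simp_all add: Whilenz_stop.hyps)
next
  case (Whilenz_step s r P t s' t' s2)
  from Whilenz_step.prems show ?case
    by (rule exec_Whilenz_elim) (metis Whilenz_step.IH Whilenz_step.hyps(1))+
qed (erule exec_elims; simp)+

text \<open>
  A word is given as bits in the memory cells \<open>0, 1, \<dots>\<close>, with its length in register \<open>0\<close>. A number
  is given in register \<open>0\<close>. All other registers and cells are \<open>0\<close>. The result is in register \<open>0\<close>.
\<close>

definition word_input :: "bool list \<Rightarrow> state" where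
  "word_input w = ((\<lambda>_. 0)(0 := length w), \<lambda>i. if i < length w \<and> w ! i then 1 else 0)"

definition number_input :: "nat \<Rightarrow> state" where
  "number_input n = ((\<lambda>_. 0)(0 := n), \<lambda>_. 0)"

definition result :: "state \<Rightarrow> nat" where
  "result s = fst s 0"

definition computable :: "(nat \<Rightarrow> nat) \<Rightarrow> bool" where
  "computable g \<longleftrightarrow> (\<exists>P. \<forall>n. \<exists>t s. exec P (number_input n) t s \<and> result s = g n)"


section \<open>Fixed-parameter tractability\<close>

text \<open>
  A problem is given by a set \<open>I\<close> of instances, their encoding \<open>enc\<close> as words, and the set \<open>Y\<close> of
  yes-instances; \<open>p\<close> is the parameter, which is not part of the input.
\<close>

definition fpt :: "'i set \<Rightarrow> ('i \<Rightarrow> bool list) \<Rightarrow> 'i set \<Rightarrow> ('i \<Rightarrow> nat) \<Rightarrow> bool" where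
  "fpt I enc Y p \<longleftrightarrow>
     (\<exists>P g c. computable g \<and>
        (\<forall>x\<in>I. \<exists>t s. exec P (word_input (enc x)) t s \<and>
           t \<le> g (p x) * length (enc x) ^ c \<and>
           (result s \<noteq> 0 \<longleftrightarrow> x \<in> Y)))"


section \<open>The signed domination problem\<close>

text \<open>As inputs, graphs have the vertices \<open>0, \<dots>, n - 1\<close>.\<close>

definition instances :: "(nat pair_pre_digraph \<times> int) set" where
  "instances = {(G, k). pair_graph G \<and> (\<exists>n. pverts G = {..<n})}"

text \<open>
  The number of vertices in unary, terminated by a zero bit; the adjacency matrix, row by row; the
  sign bit of \<open>k\<close>; and the binary digits of \<open>\<bar>k\<bar>\<close>, least significant first.
\<close>

definition encode_graph :: "nat pair_pre_digraph \<Rightarrow> bool list" where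
  "encode_graph G = (let n = card (pverts G) in
     replicate n True @ [False] @ map (\<lambda>e. e \<in> parcs G) (List.product [0..<n] [0..<n]))"

definition encode_int :: "int \<Rightarrow> bool list" where
  "encode_int k = (k < 0) # map (bit \<bar>k\<bar>) [0..<floorlog 2 (nat \<bar>k\<bar>)]"

definition encode :: "nat pair_pre_digraph \<times> int \<Rightarrow> bool list" where
  "encode = (\<lambda>(G, k). encode_graph G @ encode_int k)"

definition signed_domination :: "(nat pair_pre_digraph \<times> int) set" where
  "signed_domination =
     {(G, k) \<in> instances. \<exists>f. signed_dominating G f \<and> weight G f \<le> k}"

end

(*
  Let T be a twin cover with m vertices. Outside T the graph is a disjoint union of cliques of twins,
  and the cliques split into at most 2^m classes according to their neighbourhoods in T. Fix the values
  of the function on T. The constraint of a clique only bounds its own sum from below, so a function is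
  described by its class sums, subject to m linear constraints. If f is not optimal and f' is better,
  then the differences of the class sums, together with slacks for the m constraints, form a zero-sum
  family of vectors with entries -1, 0, 1. It splits into zero-sum blocks of size at most 2^2^m (one
  coordinate at a time: order the blocks so that the prefix sums stay bounded, and use the pigeonhole
  principle), and one of the blocks is an improvement of f on its own. Hence local search over
  boundedly many flips per class finds the optimum, starting from the value 1 outside T. The flips can
  be chosen greedily within a class: as long as the sum of a class exceeds the desired one, some
  clique of the class has a larger sum than in f', so that one of its vertices can be lowered.

  A twin cover of at most twice the minimum size is given by the ends of a maximal matching in the graph
  of the edges that are not twin edges.

  The algorithm is written in a small language with bounded loops only, whose programs denote total
  functions, and is compiled to the random access machine.
*)

theory Submission
  imports Defs "HOL-Library.Nat_Bijection"
begin

section \<open>A language with bounded loops and its compilation\<close>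

text \<open>The better function \<open>f'\<close> is unknown to the machine, so the local step is
  split into numbers and choices. Only how many vertices of each class are raised or lowered has to
  be guessed; any eligible vertices will do, because the constraints outside T stay valid after
  every single flip, and those in T depend on the class sums alone and are checked at the end. All
  the numbers are guessed together, as the binary digits of one loop counter. With S = 2^m there are
  2 S rounds of at most 2^S flips, and 2 S * 2^S <= 2^(4 S), so 2^2^(4 S) counter values suffice.
  This is wasteful, but repeated doubling computes it without multiplication, and it is at least as
  large as every other bound that depends on m. Wrong guesses are harmless, since a candidate is
  kept only if it is dominating and has fewer ones. The values 0 and 1 in place of -1 and 1 keep the
  arithmetic within the natural numbers. For the running time, every loop bound is at most X, the
  product of a function of the parameter and the input length; a polynomial in X then has the
  required product form.\<close>

text \<open>
  \<open>SumUpto x r e\<close> is the sum of the values of \<open>e\<close> for \<open>x = 0, \<dots>, r - 1\<close>, and \<open>For x r c\<close> runs \<open>c\<close>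
  for these \<open>x\<close>, where the value of \<open>r\<close> is read once, on entry. So every program terminates, and its
  meaning is a total function. The bound is a register rather than an expression because this makes
  the running time a polynomial in the largest bound, whenever no bound is written by the program.
\<close>

datatype exp =
    Num nat
  | Var nat
  | Arr nat exp
  | Plus exp exp
  | Minus exp exp
  | Halve exp
  | Cond exp exp exp
  | SumUpto nat nat exp

type_synonym store = "(nat \<Rightarrow> nat) \<times> (nat \<Rightarrow> nat \<Rightarrow> nat)"

primrec eval :: "exp \<Rightarrow> (nat \<Rightarrow> nat) \<Rightarrow> (nat \<Rightarrow> nat \<Rightarrow> nat) \<Rightarrow> nat" where
  "eval (Num c) V A = c"
| "eval (Var x) V A = V x"
| "eval (Arr k e) V A = A k (eval e V A)"
| "eval (Plus a b) V A = eval a V A + eval b V A"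
| "eval (Minus a b) V A = eval a V A - eval b V A"
| "eval (Halve a) V A = eval a V A div 2"
| "eval (Cond e a b) V A = (if eval e V A \<noteq> 0 then eval a V A else eval b V A)"
| "eval (SumUpto x r e) V A = (\<Sum>i<V r. eval e (V(x := i)) A)"

primrec vars :: "exp \<Rightarrow> nat set" where
  "vars (Num c) = {}"
| "vars (Var x) = {x}"
| "vars (Arr k e) = vars e"
| "vars (Plus a b) = vars a \<union> vars b"
| "vars (Minus a b) = vars a \<union> vars b"
| "vars (Halve a) = vars a"
| "vars (Cond e a b) = vars e \<union> vars a \<union> vars b"
| "vars (SumUpto x r e) = {x, r} \<union> vars e"

primrec arrays :: "exp \<Rightarrow> nat set" where
  "arrays (Num c) = {}"
| "arrays (Var x) = {}"
| "arrays (Arr k e) = insert k (arrays e)"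
| "arrays (Plus a b) = arrays a \<union> arrays b"
| "arrays (Minus a b) = arrays a \<union> arrays b"
| "arrays (Halve a) = arrays a"
| "arrays (Cond e a b) = arrays e \<union> arrays a \<union> arrays b"
| "arrays (SumUpto x r e) = arrays e"

primrec bounds :: "exp \<Rightarrow> nat set" where
  "bounds (Num c) = {}"
| "bounds (Var x) = {}"
| "bounds (Arr k e) = bounds e"
| "bounds (Plus a b) = bounds a \<union> bounds b"
| "bounds (Minus a b) = bounds a \<union> bounds b"
| "bounds (Halve a) = bounds a"
| "bounds (Cond e a b) = bounds e \<union> bounds a \<union> bounds b"
| "bounds (SumUpto x r e) = insert r (bounds e)"

primrec indices :: "exp \<Rightarrow> nat set" where
  "indices (Num c) = {}"
| "indices (Var x) = {}"
| "indices (Arr k e) = indices e"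
| "indices (Plus a b) = indices a \<union> indices b"
| "indices (Minus a b) = indices a \<union> indices b"
| "indices (Halve a) = indices a"
| "indices (Cond e a b) = indices e \<union> indices a \<union> indices b"
| "indices (SumUpto x r e) = insert x (indices e)"

text \<open>An upper bound on the cost, valid as soon as \<open>X\<close> bounds the values of all
  registers in \<open>bounds e\<close>. A conditional is charged for both branches, which keeps the
  bound a polynomial in \<open>X\<close>.\<close>

primrec eval_time :: "exp \<Rightarrow> nat \<Rightarrow> nat" where
  "eval_time (Num c) X = 1"
| "eval_time (Var x) X = 2"
| "eval_time (Arr k e) X = eval_time e X + 5"
| "eval_time (Plus a b) X = eval_time a X + eval_time b X + 1"
| "eval_time (Minus a b) X = eval_time a X + eval_time b X + 1"
| "eval_time (Halve a) X = eval_time a X + 1"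
| "eval_time (Cond e a b) X = eval_time e X + eval_time a X + eval_time b X + 1"
| "eval_time (SumUpto x r e) X = X * (eval_time e X + 7) + 9"

text \<open>
  The registers from \<open>d\<close> on are scratch space, and the value is left in register \<open>d\<close>. Cell \<open>i\<close> of array
  \<open>k < 4\<close> is memory cell \<open>4 * i + k\<close>.
\<close>

primrec compile_exp :: "exp \<Rightarrow> nat \<Rightarrow> program" where
  "compile_exp (Num c) d = Const d c"
| "compile_exp (Var x) d = Seq (Const d 0) (Add d x d)"
| "compile_exp (Arr k e) d =
     Seq (compile_exp e d) (Seq (Add d d d) (Seq (Add d d d)
       (Seq (Const (d + 1) k) (Seq (Add d d (d + 1)) (Load d d)))))"
| "compile_exp (Plus a b) d = Seq (compile_exp a d) (Seq (compile_exp b (d + 1)) (Add d d (d + 1)))"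
| "compile_exp (Minus a b) d = Seq (compile_exp a d) (Seq (compile_exp b (d + 1)) (Sub d d (d + 1)))"
| "compile_exp (Halve a) d = Seq (compile_exp a d) (Half d d)"
| "compile_exp (Cond e a b) d = Seq (compile_exp e d) (Ifnz d (compile_exp a d) (compile_exp b d))"
| "compile_exp (SumUpto x r e) d =
     Seq (Seq (Const (d + 1) 0) (Add (d + 1) x (d + 1)))
    (Seq (Seq (Const (d + 2) 0) (Add (d + 2) r (d + 2)))
    (Seq (Const d 0) (Seq (Const (d + 3) 0)
    (Seq (Whilenz (d + 2)
       (Seq (Seq (Const x 0) (Add x (d + 3) x))
       (Seq (compile_exp e (d + 4))
       (Seq (Add d d (d + 4))
       (Seq (Const (d + 4) 1)
       (Seq (Add (d + 3) (d + 3) (d + 4)) (Sub (d + 2) (d + 2) (d + 4))))))))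
    (Seq (Const x 0) (Add x (d + 1) x))))))"

definition runs :: "program \<Rightarrow> state \<Rightarrow> nat \<Rightarrow> state \<Rightarrow> bool" where
  "runs P s T s' \<longleftrightarrow> (\<exists>t\<le>T. exec P s t s')"

lemma runs_mono: "runs P s T s' \<Longrightarrow> T \<le> U \<Longrightarrow> runs P s U s'"
  unfolding runs_def by (meson le_trans)

lemma runs_Seq: "runs P s T s' \<Longrightarrow> runs Q s' U s'' \<Longrightarrow> runs (Seq P Q) s (T + U) s''"
  unfolding runs_def by (meson add_mono exec.Seq)

lemma runs_basic:
  "runs (Const r c) (R, M) 1 (R(r := c), M)"
  "runs (Add r a b) (R, M) 1 (R(r := R a + R b), M)"
  "runs (Sub r a b) (R, M) 1 (R(r := R a - R b), M)"
  "runs (Half r a) (R, M) 1 (R(r := R a div 2), M)"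
  "runs (Load r a) (R, M) 1 (R(r := M (R a)), M)"
  "runs (Store a b) (R, M) 1 (R, M(R a := R b))"
  "runs Skip s 1 s"
  unfolding runs_def by (blast intro: exec.intros)+

lemma runs_Ifnz:
  "R r \<noteq> 0 \<Longrightarrow> runs P (R, M) T s' \<Longrightarrow> runs (Ifnz r P Q) (R, M) (T + 1) s'"
  "R r = 0 \<Longrightarrow> runs Q (R, M) T s' \<Longrightarrow> runs (Ifnz r P Q) (R, M) (T + 1) s'"
  unfolding runs_def by (fastforce intro: exec.intros)+

text \<open>The test register counts down from \<open>N\<close>, so \<open>N\<close> is the number
  of rounds. Each round costs one extra step for its test, and the final test costs one
  more.\<close>

lemma runs_Whilenz:
  assumes "Inv 0 s" "fst s r = N"
    and step: "\<And>i s. i < N \<Longrightarrow> Inv i s \<Longrightarrow> fst s r = N - i \<Longrightarrow>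
      \<exists>s'. runs P s T s' \<and> Inv (Suc i) s' \<and> fst s' r = N - Suc i"
  shows "\<exists>s'. runs (Whilenz r P) s (N * (T + 1) + 1) s' \<and> Inv N s'"
proof -
  have "\<exists>s'. runs (Whilenz r P) s ((N - i) * (T + 1) + 1) s' \<and> Inv N s'"
    if "i \<le> N" "Inv i s" "fst s r = N - i" for i s
    using that
  proof (induction "N - i" arbitrary: i s)
    case 0
    then have "runs (Whilenz r P) s 1 s" "i = N"
      unfolding runs_def by (auto simp flip: One_nat_def intro: exec.Whilenz_stop)
    with 0 show ?case by (intro exI[of _ s] conjI) (auto simp del: split_paired_Ex)
  next
    case (Suc k)
    then have i: "i < N" by simp
    from step[OF i Suc.prems(2,3)] obtain s1 where
      s1: "runs P s T s1" "Inv (Suc i) s1" "fst s1 r = N - Suc i" by blast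
    have "k = N - Suc i" "Suc i \<le> N" using Suc.hyps(2) i by auto
    from Suc.hyps(1)[OF this s1(2,3)] obtain s2 where
      s2: "runs (Whilenz r P) s1 ((N - Suc i) * (T + 1) + 1) s2" "Inv N s2" by blast
    from s1(1) obtain t where t: "t \<le> T" "exec P s t s1" unfolding runs_def by blast
    from s2(1) obtain u where u: "u \<le> (N - Suc i) * (T + 1) + 1" "exec (Whilenz r P) s1 u s2"
      unfolding runs_def by blast
    have "exec (Whilenz r P) s (Suc (t + u)) s2"
      using exec.Whilenz_step[OF _ t(2) u(2)] Suc.prems(3) i by simp
    moreover have "N - i = Suc (N - Suc i)" using i by simp
    then have "Suc (t + u) \<le> (N - i) * (T + 1) + 1" using t(1) u(1) by simp
    ultimately show ?case using s2(2) unfolding runs_def by blast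
  qed
  from this[of 0 s] assms(1,2) show ?thesis by simp
qed

lemma eval_cong:
  assumes "\<And>x. x \<in> vars e \<Longrightarrow> V x = V' x" "\<And>k. k \<in> arrays e \<Longrightarrow> A k = A' k"
  shows "eval e V A = eval e V' A'"
  using assms
proof (induction e arbitrary: V V')
  case (SumUpto x r e)
  have "eval e (V(x := i)) A = eval e (V'(x := i)) A'" for i
    by (rule SumUpto.IH) (use SumUpto.prems in auto)
  moreover have "V r = V' r" using SumUpto.prems by auto
  ultimately show ?case by simp
next
  case (Plus a b)
  have "eval a V A = eval a V' A'" "eval b V A = eval b V' A'"
    by (rule Plus.IH; use Plus.prems in auto)+
  then show ?case by simp
next
  case (Minus a b)
  have "eval a V A = eval a V' A'" "eval b V A = eval b V' A'"
    by (rule Minus.IH; use Minus.prems in auto)+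
  then show ?case by simp
next
  case (Cond e a b)
  have "eval e V A = eval e V' A'" "eval a V A = eval a V' A'" "eval b V A = eval b V' A'"
    by (rule Cond.IH; use Cond.prems in auto)+
  then show ?case by simp
next
  case (Arr k e)
  have "eval e V A = eval e V' A'" by (rule Arr.IH) (use Arr.prems in auto)
  then show ?case using Arr.prems by simp
next
  case (Halve a)
  have "eval a V A = eval a V' A'" by (rule Halve.IH) (use Halve.prems in auto)
  then show ?case by simp
qed auto

definition unpack :: "(nat \<Rightarrow> nat) \<Rightarrow> nat \<Rightarrow> nat \<Rightarrow> nat" where
  "unpack M k i = M (4 * i + k)"

text \<open>Since no index is also a bound, entering a sum does not change the bounds inside it, and
  \<open>R r \<le> X\<close> persists through nested sums. The registers from \<open>d\<close> on
  stay free for scratch values.\<close>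

definition admissible :: "nat \<Rightarrow> (nat \<Rightarrow> nat) \<Rightarrow> nat \<Rightarrow> exp \<Rightarrow> bool" where
  "admissible d R X e \<longleftrightarrow>
     vars e \<subseteq> {..<d} \<and> indices e \<inter> bounds e = {} \<and> (\<forall>r\<in>bounds e. R r \<le> X)"

text \<open>The frame condition is what lets a left operand wait in register \<open>d\<close> while
  the right one is computed at \<open>d + 1\<close>.\<close>

definition computes :: "program \<Rightarrow> nat \<Rightarrow> (nat \<Rightarrow> nat) \<Rightarrow> (nat \<Rightarrow> nat) \<Rightarrow> nat \<Rightarrow> nat \<Rightarrow> bool" where
  "computes P d R M T v \<longleftrightarrow>
     (\<exists>R'. runs P (R, M) T (R', M) \<and> R' d = v \<and> (\<forall>r<d. R' r = R r))"

lemma computesI: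
  "runs P (R, M) T (R', M) \<Longrightarrow> R' d = v \<Longrightarrow> (\<And>r. r < d \<Longrightarrow> R' r = R r) \<Longrightarrow> computes P d R M T v"
  unfolding computes_def by blast

lemma computesE:
  assumes "computes P d R M T v"
  obtains R' where "runs P (R, M) T (R', M)" "R' d = v" "\<And>r. r < d \<Longrightarrow> R' r = R r"
  using assms unfolding computes_def by blast

lemma bounds_subset_vars: "bounds e \<subseteq> vars e"
  by (induction e) auto

lemma admissible_cong:
  assumes "admissible d R X e" "d \<le> d'" "\<And>r. r < d \<Longrightarrow> R' r = R r"
  shows "admissible d' R' X e"
proof -
  have "R' r \<le> X" if "r \<in> bounds e" for r
  proof -
    have "r < d" using that assms(1) bounds_subset_vars[of e] unfolding admissible_def by auto
    then show ?thesis using assms(1,3) that unfolding admissible_def by auto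
  qed
  then show ?thesis using assms(1,2) unfolding admissible_def by auto
qed

lemma admissible_eval_cong:
  assumes "admissible d R X e" "\<And>r. r < d \<Longrightarrow> R' r = R r"
  shows "eval e R' A = eval e R A"
  by (rule eval_cong) (use assms in \<open>auto simp: admissible_def\<close>)

lemma compile_exp_correct:
  assumes "admissible d R X e"
  shows "computes (compile_exp e d) d R M (eval_time e X) (eval e R (unpack M))"
  using assms
proof (induction e arbitrary: d R)
  case (Num c)
  show ?case by (rule computesI[of _ _ _ _ "R(d := c)"]) (simp_all add: runs_basic(1)[simplified])
next
  case (Var x)
  have "runs (Seq (Const d 0) (Add d x d)) (R, M) (1 + 1) (R(d := R x), M)"
    using runs_Seq[OF runs_basic(1)[of d 0 R M] runs_basic(2)[of d x d "R(d := 0)" M]] Var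
    by (simp add: admissible_def)
  then show ?case by (intro computesI[of _ _ _ _ "R(d := R x)"]) (simp_all add: numeral_2_eq_2)
next
  case (Arr k e)
  have "admissible d R X e" using Arr.prems unfolding admissible_def by auto
  from computesE[OF Arr.IH[OF this]] obtain R1 where
    R1: "runs (compile_exp e d) (R, M) (eval_time e X) (R1, M)"
      "R1 d = eval e R (unpack M)" "\<And>r. r < d \<Longrightarrow> R1 r = R r" by blast
  let ?R2 = "R1(d := R1 d + R1 d)" let ?R3 = "?R2(d := ?R2 d + ?R2 d)"
  let ?R4 = "?R3(d + 1 := k)" let ?R5 = "?R4(d := ?R4 d + ?R4 (d + 1))"
  let ?R6 = "?R5(d := M (?R5 d))"
  have "runs (compile_exp (Arr k e) d) (R, M) (eval_time e X + (1 + (1 + (1 + (1 + 1))))) (?R6, M)"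
    unfolding compile_exp.simps
    by (intro runs_Seq[OF R1(1)] runs_Seq[OF runs_basic(2)] runs_Seq[OF runs_basic(1)] runs_basic(5))
  then have "runs (compile_exp (Arr k e) d) (R, M) (eval_time (Arr k e) X) (?R6, M)"
    by (rule runs_mono) simp
  moreover have "?R6 d = eval (Arr k e) R (unpack M)"
  proof -
    have "?R5 d = 4 * eval e R (unpack M) + k" using R1(2) by simp
    then show ?thesis by (simp add: unpack_def)
  qed
  moreover have "?R6 r = R r" if "r < d" for r using R1(3) that by simp
  ultimately show ?case by (rule computesI)
next
  case (Plus a b)
  have adm: "admissible d R X a" "admissible d R X b" using Plus.prems unfolding admissible_def by auto
  from computesE[OF Plus.IH(1)[OF adm(1)]] obtain R1 where
    R1: "runs (compile_exp a d) (R, M) (eval_time a X) (R1, M)"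
      "R1 d = eval a R (unpack M)" "\<And>r. r < d \<Longrightarrow> R1 r = R r" by blast
  have "admissible (d + 1) R1 X b" using admissible_cong[OF adm(2)] R1(3) by simp
  from computesE[OF Plus.IH(2)[OF this]] obtain R2 where
    R2: "runs (compile_exp b (d + 1)) (R1, M) (eval_time b X) (R2, M)"
      "R2 (d + 1) = eval b R1 (unpack M)" "\<And>r. r < d + 1 \<Longrightarrow> R2 r = R1 r" by blast
  note e = admissible_eval_cong[OF adm(2) R1(3)]
  let ?R3 = "R2(d := R2 d + R2 (d + 1))"
  have "runs (compile_exp (Plus a b) d) (R, M) (eval_time a X + (eval_time b X + 1)) (?R3, M)"
    unfolding compile_exp.simps by (intro runs_Seq[OF R1(1)] runs_Seq[OF R2(1)] runs_basic)
  then have "runs (compile_exp (Plus a b) d) (R, M) (eval_time (Plus a b) X) (?R3, M)"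
    by (rule runs_mono) simp
  then show ?case by (rule computesI) (use R1 R2 e in auto)
next
  case (Minus a b)
  have adm: "admissible d R X a" "admissible d R X b" using Minus.prems unfolding admissible_def by auto
  from computesE[OF Minus.IH(1)[OF adm(1)]] obtain R1 where
    R1: "runs (compile_exp a d) (R, M) (eval_time a X) (R1, M)"
      "R1 d = eval a R (unpack M)" "\<And>r. r < d \<Longrightarrow> R1 r = R r" by blast
  have "admissible (d + 1) R1 X b" using admissible_cong[OF adm(2)] R1(3) by simp
  from computesE[OF Minus.IH(2)[OF this]] obtain R2 where
    R2: "runs (compile_exp b (d + 1)) (R1, M) (eval_time b X) (R2, M)"
      "R2 (d + 1) = eval b R1 (unpack M)" "\<And>r. r < d + 1 \<Longrightarrow> R2 r = R1 r" by blast
  note e = admissible_eval_cong[OF adm(2) R1(3)]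
  let ?R3 = "R2(d := R2 d - R2 (d + 1))"
  have "runs (compile_exp (Minus a b) d) (R, M) (eval_time a X + (eval_time b X + 1)) (?R3, M)"
    unfolding compile_exp.simps by (intro runs_Seq[OF R1(1)] runs_Seq[OF R2(1)] runs_basic)
  then have "runs (compile_exp (Minus a b) d) (R, M) (eval_time (Minus a b) X) (?R3, M)"
    by (rule runs_mono) simp
  then show ?case by (rule computesI) (use R1 R2 e in auto)
next
  case (Halve a)
  have "admissible d R X a" using Halve.prems unfolding admissible_def by auto
  from computesE[OF Halve.IH[OF this]] obtain R1 where
    R1: "runs (compile_exp a d) (R, M) (eval_time a X) (R1, M)"
      "R1 d = eval a R (unpack M)" "\<And>r. r < d \<Longrightarrow> R1 r = R r" by blast
  have "runs (compile_exp (Halve a) d) (R, M) (eval_time (Halve a) X) (R1(d := R1 d div 2), M)"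
    unfolding compile_exp.simps eval_time.simps by (intro runs_Seq[OF R1(1)] runs_basic)
  then show ?case by (rule computesI) (use R1 in auto)
next
  case (Cond e a b)
  have adm: "admissible d R X e" "admissible d R X a" "admissible d R X b"
    using Cond.prems unfolding admissible_def by auto
  from computesE[OF Cond.IH(1)[OF adm(1)]] obtain R1 where
    R1: "runs (compile_exp e d) (R, M) (eval_time e X) (R1, M)"
      "R1 d = eval e R (unpack M)" "\<And>r. r < d \<Longrightarrow> R1 r = R r" by blast
  show ?case
  proof (cases "R1 d = 0")
    case False
    from computesE[OF Cond.IH(2)[OF admissible_cong[OF adm(2) order_refl R1(3)]]] obtain R2 where
      R2: "runs (compile_exp a d) (R1, M) (eval_time a X) (R2, M)"
        "R2 d = eval a R1 (unpack M)" "\<And>r. r < d \<Longrightarrow> R2 r = R1 r" by blast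
    have "runs (compile_exp (Cond e a b) d) (R, M) (eval_time e X + (eval_time a X + 1)) (R2, M)"
      unfolding compile_exp.simps by (intro runs_Seq[OF R1(1)] runs_Ifnz(1) R2(1) False)
    then have "runs (compile_exp (Cond e a b) d) (R, M) (eval_time (Cond e a b) X) (R2, M)"
      by (rule runs_mono) simp
    then show ?thesis
      by (rule computesI) (use R1 R2 False admissible_eval_cong[OF adm(2) R1(3)] in auto)
  next
    case True
    from computesE[OF Cond.IH(3)[OF admissible_cong[OF adm(3) order_refl R1(3)]]] obtain R2 where
      R2: "runs (compile_exp b d) (R1, M) (eval_time b X) (R2, M)"
        "R2 d = eval b R1 (unpack M)" "\<And>r. r < d \<Longrightarrow> R2 r = R1 r" by blast
    have "runs (compile_exp (Cond e a b) d) (R, M) (eval_time e X + (eval_time b X + 1)) (R2, M)"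
      unfolding compile_exp.simps by (intro runs_Seq[OF R1(1)] runs_Ifnz(2) R2(1) True)
    then have "runs (compile_exp (Cond e a b) d) (R, M) (eval_time (Cond e a b) X) (R2, M)"
      by (rule runs_mono) simp
    then show ?thesis
      by (rule computesI) (use R1 R2 True admissible_eval_cong[OF adm(3) R1(3)] in auto)
  qed
next
  case (SumUpto x r e)
  have x: "x < d" and r: "r < d" and e: "vars e \<subseteq> {..<d}" and Rr: "R r \<le> X"
    using SumUpto.prems unfolding admissible_def by auto
  have adm: "admissible d (R(x := i)) X e" for i
    using SumUpto.prems unfolding admissible_def by auto
  let ?R1 = "R(d + 1 := R x)" let ?R2 = "?R1(d + 2 := R r)"
  let ?R3 = "?R2(d := 0)" let ?R4 = "?R3(d + 3 := 0)"
  have 1: "runs (Seq (Const (d + 1) 0) (Add (d + 1) x (d + 1))) (R, M) (1 + 1) (?R1, M)"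
    using runs_Seq[OF runs_basic(1)[of "d + 1" 0 R M] runs_basic(2)[of "d + 1" x "d + 1"]] x
    by simp
  have 2: "runs (Seq (Const (d + 2) 0) (Add (d + 2) r (d + 2))) (?R1, M) (1 + 1) (?R2, M)"
    using runs_Seq[OF runs_basic(1)[of "d + 2" 0 ?R1 M] runs_basic(2)[of "d + 2" r "d + 2"]] r
    by simp
  define body where "body = Seq (Seq (Const x 0) (Add x (d + 3) x))
       (Seq (compile_exp e (d + 4))
       (Seq (Add d d (d + 4))
       (Seq (Const (d + 4) 1)
       (Seq (Add (d + 3) (d + 3) (d + 4)) (Sub (d + 2) (d + 2) (d + 4))))))"
  \<comment> \<open>Register \<open>d\<close> accumulates, \<open>d + 1\<close> keeps the old value
    of \<open>x\<close>, \<open>d + 2\<close> counts down for the test and \<open>d + 3\<close>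
    counts up. As \<open>x\<close> is overwritten in every round, the frame omits it until it is
    restored.\<close>
  define Inv where "Inv i s \<longleftrightarrow> snd s = M \<and> fst s d = (\<Sum>j<i. eval e (R(x := j)) (unpack M)) \<and>
    fst s (d + 3) = i \<and> fst s (d + 1) = R x \<and> (\<forall>y<d. y \<noteq> x \<longrightarrow> fst s y = R y)" for i and s :: state
  have "\<exists>s'. runs (Whilenz (d + 2) body) (?R4, M) (R r * ((1 + 1 + (eval_time e X + (1 + (1 + (1 + 1)))))
     + 1) + 1) s' \<and> Inv (R r) s'"
  proof (rule runs_Whilenz)
    show "Inv 0 (?R4, M)" unfolding Inv_def by simp
    show "fst (?R4, M) (d + 2) = R r" by simp
    fix i s assume i: "i < R r" and inv: "Inv i s" and s: "fst s (d + 2) = R r - i"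
    obtain Q where Q: "s = (Q, M)" using inv unfolding Inv_def by (metis prod.collapse)
    let ?Q1 = "Q(x := i)"
    have 1: "runs (Seq (Const x 0) (Add x (d + 3) x)) (Q, M) (1 + 1) (?Q1, M)"
      using runs_Seq[OF runs_basic(1)[of x 0 Q M] runs_basic(2)[of x "d + 3" x]] x inv
      unfolding Inv_def Q by simp
    have Q1: "?Q1 y = (R(x := i)) y" if "y < d" for y
      using inv that unfolding Inv_def Q by auto
    from computesE[OF SumUpto.IH[OF admissible_cong[OF adm _ Q1]]] obtain Q2 where
      Q2: "runs (compile_exp e (d + 4)) (?Q1, M) (eval_time e X) (Q2, M)"
        "Q2 (d + 4) = eval e ?Q1 (unpack M)" "\<And>r. r < d + 4 \<Longrightarrow> Q2 r = ?Q1 r"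
      by (metis le_add1)
    have Q2': "Q2 (d + 4) = eval e (R(x := i)) (unpack M)"
      unfolding Q2(2) by (rule admissible_eval_cong[OF adm Q1])
    let ?Q3 = "Q2(d := Q2 d + Q2 (d + 4))" let ?Q4 = "?Q3(d + 4 := 1)"
    let ?Q5 = "?Q4(d + 3 := ?Q4 (d + 3) + ?Q4 (d + 4))"
    let ?Q6 = "?Q5(d + 2 := ?Q5 (d + 2) - ?Q5 (d + 4))"
    have "runs body s (1 + 1 + (eval_time e X + (1 + (1 + (1 + 1))))) (?Q6, M)"
      unfolding body_def Q
      by (intro runs_Seq[OF 1] runs_Seq[OF Q2(1)] runs_Seq[OF runs_basic(2)]
           runs_Seq[OF runs_basic(1)] runs_basic)
    moreover have "Inv (Suc i) (?Q6, M)"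
      using inv Q2(3) Q2' x unfolding Inv_def Q by simp
    moreover have "fst (?Q6, M) (d + 2) = R r - Suc i"
      using s Q2(3) x unfolding Q by simp
    ultimately show "\<exists>s'. runs body s (1 + 1 + (eval_time e X + (1 + (1 + (1 + 1))))) s' \<and>
      Inv (Suc i) s' \<and> fst s' (d + 2) = R r - Suc i" by blast
  qed
  then obtain s where s: "runs (Whilenz (d + 2) body) (?R4, M)
      (R r * ((1 + 1 + (eval_time e X + (1 + (1 + (1 + 1))))) + 1) + 1) s" "Inv (R r) s"
    by blast
  then obtain S where sS: "s = (S, M)" unfolding Inv_def by (metis prod.collapse)
  note S = s[unfolded sS]
  have 3: "runs (Seq (Const x 0) (Add x (d + 1) x)) (S, M) (1 + 1) (S(x := R x), M)"
    using runs_Seq[OF runs_basic(1)[of x 0 S M] runs_basic(2)[of x "d + 1" x]] x S(2)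
    unfolding Inv_def by simp
  have "runs (compile_exp (SumUpto x r e) d) (R, M) (1 + 1 + (1 + 1 + (1 + (1 +
     ((R r * ((1 + 1 + (eval_time e X + (1 + (1 + (1 + 1))))) + 1) + 1) + (1 + 1))))))
     (S(x := R x), M)"
    unfolding compile_exp.simps body_def[symmetric]
    by (intro runs_Seq[OF 1] runs_Seq[OF 2] runs_Seq[OF runs_basic(1)] runs_Seq[OF S(1)] 3)
  moreover have "R r * (eval_time e X + 7) \<le> X * (eval_time e X + 7)"
    using Rr by (intro mult_right_mono) auto
  ultimately have "runs (compile_exp (SumUpto x r e) d) (R, M) (eval_time (SumUpto x r e) X)
     (S(x := R x), M)"
    by (elim runs_mono) (simp add: algebra_simps)
  then show ?case by (rule computesI) (use S(2) x in \<open>auto simp: Inv_def\<close>)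
qed

section \<open>Commands and the correctness of their compilation\<close>

datatype com =
    Nop
  | Assign nat exp
  | Write nat exp exp
  | Comp com com (infixr ";;" 60)
  | Branch exp com com
  | For nat nat com

primrec run :: "com \<Rightarrow> store \<Rightarrow> store" where
  "run Nop s = s"
| "run (Assign x e) s = ((fst s)(x := eval e (fst s) (snd s)), snd s)"
| "run (Write k a e) s =
     (fst s, (snd s)(k := (snd s k)(eval a (fst s) (snd s) := eval e (fst s) (snd s))))"
| "run (c ;; c') s = run c' (run c s)"
| "run (Branch e c c') s = (if eval e (fst s) (snd s) \<noteq> 0 then run c s else run c' s)"
| "run (For x r c) s = fold (\<lambda>i s. run c ((fst s)(x := i), snd s)) [0..<fst s r] s"

primrec writes :: "com \<Rightarrow> nat set" where
  "writes Nop = {}"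
| "writes (Assign x e) = {x}"
| "writes (Write k a e) = {}"
| "writes (c ;; c') = writes c \<union> writes c'"
| "writes (Branch e c c') = writes c \<union> writes c'"
| "writes (For x r c) = insert x (writes c)"

primrec array_writes :: "com \<Rightarrow> nat set" where
  "array_writes Nop = {}"
| "array_writes (Assign x e) = {}"
| "array_writes (Write k a e) = {k}"
| "array_writes (c ;; c') = array_writes c \<union> array_writes c'"
| "array_writes (Branch e c c') = array_writes c \<union> array_writes c'"
| "array_writes (For x r c) = array_writes c"

primrec for_bounds :: "com \<Rightarrow> nat set" where
  "for_bounds Nop = {}"
| "for_bounds (Assign x e) = bounds e"
| "for_bounds (Write k a e) = bounds a \<union> bounds e"
| "for_bounds (c ;; c') = for_bounds c \<union> for_bounds c'"
| "for_bounds (Branch e c c') = bounds e \<union> for_bounds c \<union> for_bounds c'"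
| "for_bounds (For x r c) = insert r (for_bounds c)"

primrec well_formed :: "nat \<Rightarrow> com \<Rightarrow> bool" where
  "well_formed d Nop \<longleftrightarrow> True"
| "well_formed d (Assign x e) \<longleftrightarrow> x < d \<and> vars e \<subseteq> {..<d} \<and> arrays e \<subseteq> {..<4} \<and> indices e \<inter> bounds e = {}"
| "well_formed d (Write k a e) \<longleftrightarrow> k < 4 \<and>
     vars a \<subseteq> {..<d} \<and> arrays a \<subseteq> {..<4} \<and> indices a \<inter> bounds a = {} \<and>
     vars e \<subseteq> {..<d} \<and> arrays e \<subseteq> {..<4} \<and> indices e \<inter> bounds e = {}"
| "well_formed d (c ;; c') \<longleftrightarrow> well_formed d c \<and> well_formed d c'"
| "well_formed d (Branch e c c') \<longleftrightarrow> well_formed d c \<and> well_formed d c' \<and>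
     vars e \<subseteq> {..<d} \<and> arrays e \<subseteq> {..<4} \<and> indices e \<inter> bounds e = {}"
| "well_formed d (For x r c) \<longleftrightarrow> x < d \<and> r < d \<and> well_formed d c"

primrec run_time :: "com \<Rightarrow> nat \<Rightarrow> nat" where
  "run_time Nop X = 1"
| "run_time (Assign x e) X = eval_time e X + 2"
| "run_time (Write k a e) X = eval_time a X + eval_time e X + 5"
| "run_time (c ;; c') X = run_time c X + run_time c' X"
| "run_time (Branch e c c') X = eval_time e X + run_time c X + run_time c' X + 1"
| "run_time (For x r c) X = X * (run_time c X + 6) + 4"

primrec compile :: "com \<Rightarrow> nat \<Rightarrow> program" where
  "compile Nop d = Skip"
| "compile (Assign x e) d = Seq (compile_exp e d) (Seq (Const x 0) (Add x d x))"
| "compile (Write k a e) d = Seq (compile_exp a d) (Seq (compile_exp e (d + 1))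
    (Seq (Add d d d) (Seq (Add d d d) (Seq (Const (d + 2) k) (Seq (Add d d (d + 2)) (Store d (d + 1)))))))"
| "compile (c ;; c') d = Seq (compile c d) (compile c' d)"
| "compile (Branch e c c') d = Seq (compile_exp e d) (Ifnz d (compile c d) (compile c' d))"
| "compile (For x r c) d =
     Seq (Seq (Const d 0) (Add d r d))
    (Seq (Const (d + 1) 0)
    (Whilenz d
       (Seq (Seq (Const x 0) (Add x (d + 1) x))
       (Seq (compile c (d + 2))
       (Seq (Const (d + 2) 1)
       (Seq (Add (d + 1) (d + 1) (d + 2)) (Sub d d (d + 2))))))))"

lemma run_For_induct:
  assumes "P 0 s"
    and "\<And>i s'. i < fst s r \<Longrightarrow> P i s' \<Longrightarrow> P (Suc i) (run c ((fst s')(x := i), snd s'))"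
  shows "P (fst s r) (run (For x r c) s)"
proof -
  have "P n (fold (\<lambda>i s. run c ((fst s)(x := i), snd s)) [0..<n] s)" if "n \<le> fst s r" for n
    using that by (induction n) (use assms in auto)
  then show ?thesis by simp
qed

lemma run_frame: "y \<notin> writes c \<Longrightarrow> fst (run c s) y = fst s y"
proof (induction c arbitrary: s)
  case (For x r c)
  show ?case
    by (rule run_For_induct[of "\<lambda>_ t. fst t y = fst s y"]) (use For in auto)
qed auto

lemma run_array_frame: "k \<notin> array_writes c \<Longrightarrow> snd (run c s) k = snd s k"
proof (induction c arbitrary: s)
  case (For x r c)
  show ?case
    by (rule run_For_induct[of "\<lambda>_ t. snd t k = snd s k"]) (use For in auto)
qed auto

definition represents :: "nat \<Rightarrow> state \<Rightarrow> store \<Rightarrow> bool" where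
  "represents d \<sigma> s \<longleftrightarrow> (\<forall>x<d. fst \<sigma> x = fst s x) \<and> (\<forall>k<4. unpack (snd \<sigma>) k = snd s k)"

lemma represents_admissible:
  assumes "represents d (R, M) s" "admissible d (fst s) X e" "arrays e \<subseteq> {..<4}"
  shows "admissible d R X e" "eval e R (unpack M) = eval e (fst s) (snd s)"
proof -
  show "admissible d R X e"
    by (rule admissible_cong[OF assms(2) order_refl]) (use assms(1) in \<open>simp add: represents_def\<close>)
  show "eval e R (unpack M) = eval e (fst s) (snd s)"
    by (rule eval_cong) (use assms in \<open>auto simp: represents_def admissible_def\<close>)
qed

lemma compile_exp_represents:
  assumes "represents d (R, M) s" "admissible d (fst s) X e" "arrays e \<subseteq> {..<4}"
  obtains R' where "runs (compile_exp e d) (R, M) (eval_time e X) (R', M)"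
    "R' d = eval e (fst s) (snd s)" "represents d (R', M) s" "\<And>r. r < d \<Longrightarrow> R' r = R r"
proof -
  note adm = represents_admissible[OF assms]
  from computesE[OF compile_exp_correct[OF adm(1), of M, unfolded adm(2)]] obtain R' where
    R': "runs (compile_exp e d) (R, M) (eval_time e X) (R', M)"
      "R' d = eval e (fst s) (snd s)" "\<And>r. r < d \<Longrightarrow> R' r = R r" by blast
  moreover have "represents d (R', M) s"
    using assms(1) R'(3) unfolding represents_def by auto
  ultimately show ?thesis using that by blast
qed

lemma well_formed_mono: "well_formed d c \<Longrightarrow> d \<le> d' \<Longrightarrow> well_formed d' c"
  by (induction c) fastforce+

lemma for_bounds_less: "well_formed d c \<Longrightarrow> r \<in> for_bounds c \<Longrightarrow> r < d"
  by (induction c) (use bounds_subset_vars in fastforce)+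

lemma unpack_update:
  assumes "k < 4" "k' < 4"
  shows "unpack (M(4 * i + k := v)) k' = (if k' = k then (unpack M k)(i := v) else unpack M k')"
proof
  fix j
  have "4 * j + k' = 4 * i + k \<longleftrightarrow> j = i \<and> k' = k" using assms by presburger
  then show "unpack (M(4 * i + k := v)) k' j = (if k' = k then (unpack M k)(i := v) else unpack M k') j"
    unfolding unpack_def by auto
qed

lemma writes_less: "well_formed d c \<Longrightarrow> y \<in> writes c \<Longrightarrow> y < d"
  by (induction c) auto

text \<open>Needed for loops: their body is compiled with scratch registers from
  \<open>d + 2\<close> on, and the store to which the induction hypothesis applies agrees with the
  true one only below \<open>d\<close>.\<close>

lemma run_cong:
  assumes "well_formed d c" "\<forall>y<d. fst s y = fst t y" "snd s = snd t"
  shows "(\<forall>y<d. fst (run c s) y = fst (run c t) y) \<and> snd (run c s) = snd (run c t)"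
proof -
  have eval: "eval e (fst s) A = eval e (fst t) A"
    if "vars e \<subseteq> {..<d}" "\<forall>y<d. fst s y = fst t y" for e A and s t :: store
    by (rule eval_cong) (use that in auto)
  show ?thesis using assms
  proof (induction c arbitrary: s t)
    case (Assign x e)
    then show ?case using eval[of e s t] by auto
  next
    case (Write k a e)
    then show ?case using eval[of e s t] eval[of a s t] by auto
  next
    case (Branch e c c')
    then show ?case using eval[of e s t] by auto
  next
    case (For x r c)
    define st where "st n s = fold (\<lambda>i s. run c ((fst s)(x := i), snd s)) [0..<n] s" for n s
    have st_Suc: "st (Suc n) s = run c ((fst (st n s))(x := n), snd (st n s))" for n s
      unfolding st_def by simp
    have "(\<forall>y<d. fst (st n s) y = fst (st n t) y) \<and> snd (st n s) = snd (st n t)" for n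
    proof (induction n)
      case (Suc n)
      have "well_formed d c" using For.prems(1) by simp
      from For.IH[OF this, of "((fst (st n s))(x := n), snd (st n s))"
          "((fst (st n t))(x := n), snd (st n t))"] Suc
      show ?case unfolding st_Suc by simp
    qed (use For.prems in \<open>simp add: st_def\<close>)
    moreover have "run (For x r c) s = st (fst s r) s" "run (For x r c) t = st (fst s r) t"
      using For.prems by (simp_all add: st_def)
    ultimately show ?case by simp
  qed auto
qed

text \<open>No register that bounds a loop or a sum is ever written, so the bound \<open>X\<close>
  on the initial values remains in force in every round.\<close>

lemma compile_correct:
  assumes "well_formed d c" "writes c \<inter> for_bounds c = {}"
    and "\<And>r. r \<in> for_bounds c \<Longrightarrow> fst s r \<le> X"
    and "represents d \<sigma> s"
  shows "\<exists>\<sigma>'. runs (compile c d) \<sigma> (run_time c X) \<sigma>' \<and> represents d \<sigma>' (run c s)"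
  using assms
proof (induction c arbitrary: d s \<sigma>)
  case Nop
  then show ?case using runs_basic(7)[of \<sigma>] by (intro exI[of _ \<sigma>]) simp
next
  case (Assign x e)
  obtain R M where \<sigma>: "\<sigma> = (R, M)" by force
  have x: "x < d" using Assign by simp
  have "represents d (R, M) s" "admissible d (fst s) X e" "arrays e \<subseteq> {..<4}"
    using Assign.prems unfolding \<sigma> admissible_def by auto
  from compile_exp_represents[OF this] obtain R1 where
    R1: "runs (compile_exp e d) (R, M) (eval_time e X) (R1, M)"
     "R1 d = eval e (fst s) (snd s)" "represents d (R1, M) s" by blast
  have "runs (Seq (Const x 0) (Add x d x)) (R1, M) (1 + 1) (R1(x := R1 d), M)"
    using runs_Seq[OF runs_basic(1)[of x 0 R1 M] runs_basic(2)[of x d x]] x by simp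
  from runs_Seq[OF R1(1) this]
  have "runs (compile (Assign x e) d) \<sigma> (run_time (Assign x e) X) (R1(x := R1 d), M)"
    unfolding \<sigma> by (simp add: numeral_2_eq_2)
  moreover have "represents d (R1(x := R1 d), M) (run (Assign x e) s)"
    using R1 unfolding represents_def by auto
  ultimately show ?case by blast
next
  case (Write k a e)
  obtain R M where \<sigma>: "\<sigma> = (R, M)" by force
  have "represents d (R, M) s" "admissible d (fst s) X a" "arrays a \<subseteq> {..<4}"
    using Write.prems unfolding \<sigma> admissible_def by auto
  from compile_exp_represents[OF this] obtain R1 where
    R1: "runs (compile_exp a d) (R, M) (eval_time a X) (R1, M)"
     "R1 d = eval a (fst s) (snd s)" "represents d (R1, M) s" by blast
  \<comment> \<open>The computed address is treated as a variable of the store, so that the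
    evaluation of \<open>e\<close> at \<open>d + 1\<close> preserves it.\<close>
  let ?s = "((fst s)(d := R1 d), snd s)"
  have adm: "admissible d (fst s) X e" "arrays e \<subseteq> {..<4}"
    using Write.prems unfolding \<sigma> admissible_def by auto
  have "represents (d + 1) (R1, M) ?s" "admissible (d + 1) (fst ?s) X e"
    using R1(3) by (auto simp: represents_def less_Suc_eq intro: admissible_cong[OF adm(1)])
  from compile_exp_represents[OF this adm(2)] obtain R2 where
    "runs (compile_exp e (d + 1)) (R1, M) (eval_time e X) (R2, M)"
    "R2 (d + 1) = eval e (fst ?s) (snd s)" "represents (d + 1) (R2, M) ?s" by auto
  moreover have "eval e (fst ?s) (snd s) = eval e (fst s) (snd s)"
    by (rule admissible_eval_cong[OF adm(1)]) simp
  ultimately have R2: "runs (compile_exp e (d + 1)) (R1, M) (eval_time e X) (R2, M)"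
    "R2 (d + 1) = eval e (fst s) (snd s)" "\<forall>x<d. R2 x = fst s x" "R2 d = R1 d"
    unfolding represents_def by auto
  let ?R3 = "R2(d := R2 d + R2 d)" let ?R4 = "?R3(d := ?R3 d + ?R3 d)"
  let ?R5 = "?R4(d + 2 := k)" let ?R6 = "?R5(d := ?R5 d + ?R5 (d + 2))"
  have "runs (compile (Write k a e) d) \<sigma> (eval_time a X + (eval_time e X + (1 + (1 + (1 + (1 + 1))))))
     (?R6, M(?R6 d := ?R6 (d + 1)))"
    unfolding compile.simps \<sigma>
    by (intro runs_Seq[OF R1(1)] runs_Seq[OF R2(1)] runs_Seq[OF runs_basic(2)]
        runs_Seq[OF runs_basic(1)] runs_basic)
  then have "runs (compile (Write k a e) d) \<sigma> (run_time (Write k a e) X)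
     (?R6, M(?R6 d := ?R6 (d + 1)))" by (rule runs_mono) simp
  moreover have "represents d (?R6, M(?R6 d := ?R6 (d + 1))) (run (Write k a e) s)"
  proof -
    have 1: "?R6 d = 4 * eval a (fst s) (snd s) + k" "?R6 (d + 1) = eval e (fst s) (snd s)"
      using R2 R1 by (auto simp: algebra_simps)
    show ?thesis unfolding represents_def fst_conv snd_conv 1
      using R1(3) R2 Write.prems(1) by (auto simp: unpack_update represents_def)
  qed
  ultimately show ?case by blast
next
  case (Comp c c')
  obtain \<sigma>1 where 1: "runs (compile c d) \<sigma> (run_time c X) \<sigma>1" "represents d \<sigma>1 (run c s)"
    using Comp.IH(1)[of d s \<sigma>] Comp.prems by auto
  have "\<exists>\<sigma>'. runs (compile c' d) \<sigma>1 (run_time c' X) \<sigma>' \<and> represents d \<sigma>' (run c' (run c s))"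
  proof (rule Comp.IH(2))
    fix r assume r: "r \<in> for_bounds c'"
    then have "r \<notin> writes c" using Comp.prems(2) by auto
    then show "fst (run c s) r \<le> X" using Comp.prems(3)[of r] r by (simp add: run_frame)
  qed (use Comp.prems 1 in auto)
  then show ?case using runs_Seq[OF 1(1)] by (fastforce simp del: split_paired_Ex)
next
  case (Branch e c c')
  obtain R M where \<sigma>: "\<sigma> = (R, M)" by force
  have "represents d (R, M) s" "admissible d (fst s) X e" "arrays e \<subseteq> {..<4}"
    using Branch.prems unfolding \<sigma> admissible_def by auto
  from compile_exp_represents[OF this] obtain R1 where
    R1: "runs (compile_exp e d) (R, M) (eval_time e X) (R1, M)"
     "R1 d = eval e (fst s) (snd s)" "represents d (R1, M) s" by blast
  show ?case
  proof (cases "R1 d = 0")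
    case False
    obtain \<sigma>1 where 1: "runs (compile c d) (R1, M) (run_time c X) \<sigma>1" "represents d \<sigma>1 (run c s)"
      using Branch.IH(1)[of d s "(R1, M)"] Branch.prems R1(3) by auto
    have "runs (compile (Branch e c c') d) \<sigma> (eval_time e X + (run_time c X + 1)) \<sigma>1"
      unfolding compile.simps \<sigma> by (intro runs_Seq[OF R1(1)] runs_Ifnz(1) 1 False)
    then have "runs (compile (Branch e c c') d) \<sigma> (run_time (Branch e c c') X) \<sigma>1"
      by (rule runs_mono) simp
    then show ?thesis using 1 False R1 by (auto simp del: split_paired_Ex)
  next
    case True
    obtain \<sigma>1 where 1: "runs (compile c' d) (R1, M) (run_time c' X) \<sigma>1" "represents d \<sigma>1 (run c' s)"
      using Branch.IH(2)[of d s "(R1, M)"] Branch.prems R1(3) by auto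
    have "runs (compile (Branch e c c') d) \<sigma> (eval_time e X + (run_time c' X + 1)) \<sigma>1"
      unfolding compile.simps \<sigma> by (intro runs_Seq[OF R1(1)] runs_Ifnz(2) 1 True)
    then have "runs (compile (Branch e c c') d) \<sigma> (run_time (Branch e c c') X) \<sigma>1"
      by (rule runs_mono) simp
    then show ?thesis using 1 True R1 by (auto simp del: split_paired_Ex)
  qed
next
  case (For x r c)
  obtain R M where \<sigma>: "\<sigma> = (R, M)" by force
  have x: "x < d" and r: "r < d" and wf: "well_formed d c" using For.prems(1) by auto
  have Rr: "R r = fst s r" using For.prems(4) r unfolding \<sigma> represents_def by simp
  let ?R1 = "R(d := R r)" let ?R2 = "?R1(d + 1 := 0)"
  define st where "st n = fold (\<lambda>i s. run c ((fst s)(x := i), snd s)) [0..<n] s" for n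
  have st_Suc: "st (Suc i) = run c ((fst (st i))(x := i), snd (st i))" for i
    unfolding st_def by simp
  have frame: "y \<notin> writes (For x r c) \<Longrightarrow> fst (st n) y = fst s y" for y n
    by (induction n) (simp add: st_def, simp add: st_Suc run_frame)
  have 1: "runs (Seq (Const d 0) (Add d r d)) (R, M) (1 + 1) (?R1, M)"
    using runs_Seq[OF runs_basic(1)[of d 0 R M] runs_basic(2)[of d r d]] r by simp
  define body where "body = Seq (Seq (Const x 0) (Add x (d + 1) x))
       (Seq (compile c (d + 2))
       (Seq (Const (d + 2) 1)
       (Seq (Add (d + 1) (d + 1) (d + 2)) (Sub d d (d + 2)))))"
  define Inv where "Inv i \<sigma> \<longleftrightarrow> represents d \<sigma> (st i) \<and> fst \<sigma> (d + 1) = i" for i \<sigma>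
  have "\<exists>\<sigma>'. runs (Whilenz d body) (?R2, M) (R r * ((1 + 1 + (run_time c X + (1 + (1 + 1))))
     + 1) + 1) \<sigma>' \<and> Inv (R r) \<sigma>'"
  proof (rule runs_Whilenz)
    show "Inv 0 (?R2, M)" using For.prems(4) unfolding Inv_def \<sigma> represents_def st_def by auto
    show "fst (?R2, M) d = R r" by simp
    fix i \<rho> assume i: "i < R r" and inv: "Inv i \<rho>" and \<rho>d: "fst \<rho> d = R r - i"
    obtain Q N where \<rho>: "\<rho> = (Q, N)" by force
    let ?Q1 = "Q(x := i)"
    let ?s1 = "((fst (st i))(x := i, d := R r - i, d + 1 := i), snd (st i))"
    have 1: "runs (Seq (Const x 0) (Add x (d + 1) x)) (Q, N) (1 + 1) (?Q1, N)"
      using runs_Seq[OF runs_basic(1)[of x 0 Q N] runs_basic(2)[of x "d + 1" x]] x inv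
      unfolding Inv_def \<rho> by simp
    let ?V = "(fst (st i))(x := i)"
    \<comment> \<open>The registers from \<open>d\<close> on are copied from the machine, so that
      the counters in \<open>d\<close> and \<open>d + 1\<close> count as variables, which
      \<open>c\<close> does not write.\<close>
    let ?t = "(\<lambda>y. if y < d then ?V y else ?Q1 y, snd (st i))"
    have "\<exists>\<rho>'. runs (compile c (d + 2)) (?Q1, N) (run_time c X) \<rho>' \<and>
       represents (d + 2) \<rho>' (run c ?t)"
    proof (rule For.IH)
      show "well_formed (d + 2) c" using wf well_formed_mono by simp
      show "writes c \<inter> for_bounds c = {}" using For.prems(2) by auto
      show "fst ?t y \<le> X" if "y \<in> for_bounds c" for y
      proof -
        have "y \<notin> writes (For x r c)" using that For.prems(2) by auto
        moreover from this have "y \<noteq> x" by auto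
        moreover have "fst s y \<le> X" using that For.prems(3) by simp
        ultimately show ?thesis using for_bounds_less[OF wf that] frame[of y i] by simp
      qed
      show "represents (d + 2) (?Q1, N) ?t"
        using inv unfolding Inv_def \<rho> represents_def by auto
    qed
    then obtain Q2 N2 where Q2: "runs (compile c (d + 2)) (?Q1, N) (run_time c X) (Q2, N2)"
      "represents (d + 2) (Q2, N2) (run c ?t)" by auto
    have agree: "\<forall>y<d. fst (run c ?t) y = fst (st (Suc i)) y" "snd (run c ?t) = snd (st (Suc i))"
      using run_cong[OF wf, of ?t "(?V, snd (st i))"] unfolding st_Suc by auto
    have "y \<notin> writes c" if "y \<ge> d" for y using writes_less[OF wf, of y] that by auto
    then have high: "\<forall>y\<ge>d. fst (run c ?t) y = ?Q1 y" by (simp add: run_frame)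
    let ?Q3 = "Q2(d + 2 := 1)"
    let ?Q4 = "?Q3(d + 1 := ?Q3 (d + 1) + ?Q3 (d + 2))"
    let ?Q5 = "?Q4(d := ?Q4 d - ?Q4 (d + 2))"
    have "runs body \<rho> (1 + 1 + (run_time c X + (1 + (1 + 1)))) (?Q5, N2)"
      unfolding body_def \<rho>
      by (intro runs_Seq[OF 1] runs_Seq[OF Q2(1)] runs_Seq[OF runs_basic(2)]
           runs_Seq[OF runs_basic(1)] runs_basic)
    moreover have "Q2 (d + 1) = i" "Q2 d = R r - i"
      using Q2(2) high x inv \<rho>d unfolding represents_def Inv_def \<rho> by auto
    then have "Inv (Suc i) (?Q5, N2)" "fst (?Q5, N2) d = R r - Suc i"
      using Q2(2) agree unfolding represents_def Inv_def by auto
    ultimately show "\<exists>\<rho>'. runs body \<rho> (1 + 1 + (run_time c X + (1 + (1 + 1)))) \<rho>' \<and>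
      Inv (Suc i) \<rho>' \<and> fst \<rho>' d = R r - Suc i" by blast
  qed
  then obtain \<rho> where \<rho>: "runs (Whilenz d body) (?R2, M) (R r * ((1 + 1 + (run_time c X + (1 + (1 + 1))))
     + 1) + 1) \<rho>" "Inv (R r) \<rho>" by blast
  have "runs (compile (For x r c) d) \<sigma> (1 + 1 + (1 + (R r * ((1 + 1 + (run_time c X + (1 + (1 + 1))))
     + 1) + 1))) \<rho>"
    unfolding compile.simps body_def[symmetric] \<sigma>
    by (intro runs_Seq[OF 1] runs_Seq[OF runs_basic(1)] \<rho>(1))
  moreover have "R r * (run_time c X + 6) \<le> X * (run_time c X + 6)"
    using For.prems(3) Rr by (intro mult_right_mono) auto
  ultimately have "runs (compile (For x r c) d) \<sigma> (run_time (For x r c) X) \<rho>"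
    by (elim runs_mono) (simp add: algebra_simps)
  moreover have "run (For x r c) s = st (R r)" using Rr unfolding st_def by simp
  ultimately show ?case using \<rho>(2) unfolding Inv_def by (intro exI[of _ \<rho>]) simp
qed

section \<open>Zero-sum partitions and local improvements\<close>

text \<open>Greedy choice: a nonnegative element is added while the sum is at most 0, a negative one
  while it is positive. The remaining elements sum to \<open>- s\<close>, so the wanted sign occurs
  among them. The interval is half-open in order to contain only \<open>2 * L\<close>
  integers.\<close>

lemma bounded_order:
  fixes w :: "'a \<Rightarrow> int"
  assumes "finite X" "\<And>x. x \<in> X \<Longrightarrow> \<bar>w x\<bar> \<le> L" "- L < s" "s \<le> L" "s + sum w X = 0"
  shows "\<exists>xs. distinct xs \<and> set xs = X \<and>
    (\<forall>i\<le>length xs. - L < s + sum_list (map w (take i xs)) \<and> s + sum_list (map w (take i xs)) \<le> L)"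
  using assms
proof (induction "card X" arbitrary: X s)
  case 0
  then show ?case by (intro exI[of _ "[]"]) auto
next
  case (Suc k)
  have "\<exists>x\<in>X. - L < s + w x \<and> s + w x \<le> L"
  proof (cases "s \<le> 0")
    case True
    have "\<exists>x\<in>X. w x \<ge> 0"
    proof (rule ccontr)
      assume "\<not> ?thesis"
      then have "sum w X < (\<Sum>x\<in>X. 0)" using Suc.hyps(2) Suc.prems(1)
        by (intro sum_strict_mono) (auto simp: not_le)
      then show False using True Suc.prems(5) by simp
    qed
    then obtain x where "x \<in> X" "w x \<ge> 0" by blast
    then show ?thesis using True Suc.prems(2)[of x] Suc.prems(3) by (intro bexI[of _ x]) auto
  next
    case False
    have "\<exists>x\<in>X. w x < 0"
    proof (rule ccontr)
      assume "\<not> ?thesis"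
      then have "sum w X \<ge> 0" by (intro sum_nonneg) (auto simp: not_less)
      then show False using False Suc.prems(5) by simp
    qed
    then obtain x where "x \<in> X" "w x < 0" by blast
    then show ?thesis using False Suc.prems(2)[of x] Suc.prems(4) by (intro bexI[of _ x]) auto
  qed
  then obtain x where x: "x \<in> X" "- L < s + w x" "s + w x \<le> L" by blast
  have "\<exists>xs. distinct xs \<and> set xs = X - {x} \<and> (\<forall>i\<le>length xs.
      - L < s + w x + sum_list (map w (take i xs)) \<and> s + w x + sum_list (map w (take i xs)) \<le> L)"
  proof (rule Suc.hyps(1))
    show "s + w x + sum w (X - {x}) = 0"
      using Suc.prems(1,5) x(1) by (simp add: sum_diff1)
  qed (use Suc.hyps(2) Suc.prems x in auto)
  then obtain xs where xs: "distinct xs" "set xs = X - {x}" "\<And>i. i \<le> length xs \<Longrightarrow>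
      - L < s + w x + sum_list (map w (take i xs)) \<and> s + w x + sum_list (map w (take i xs)) \<le> L"
    by blast
  have "- L < s + sum_list (map w (take i (x # xs))) \<and> s + sum_list (map w (take i (x # xs))) \<le> L"
    if "i \<le> length (x # xs)" for i
    using xs(3)[of "i - 1"] that Suc.prems(3,4) by (cases i) (auto simp: algebra_simps)
  then show ?case using xs x(1) by (intro exI[of _ "x # xs"]) auto
qed

lemma small_zero_sum_subset:
  fixes w :: "'a \<Rightarrow> int" and L :: nat
  assumes "finite X" "X \<noteq> {}" "\<And>x. x \<in> X \<Longrightarrow> \<bar>w x\<bar> \<le> int L" "L > 0" "sum w X = 0"
  shows "\<exists>Y\<subseteq>X. Y \<noteq> {} \<and> card Y \<le> 2 * L \<and> sum w Y = 0"
proof (cases "card X \<le> 2 * L")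
  case True
  then show ?thesis using assms by (intro exI[of _ X]) auto
next
  case False
  obtain xs where xs: "distinct xs" "set xs = X" "\<And>i. i \<le> length xs \<Longrightarrow>
      - int L < sum_list (map w (take i xs)) \<and> sum_list (map w (take i xs)) \<le> int L"
    using bounded_order[of X w "int L" 0] assms by auto
  define P where "P i = sum_list (map w (take i xs))" for i
  have len: "2 * L < length xs" using False xs(1,2) distinct_card by fastforce
  \<comment> \<open>There are \<open>2 * L + 1\<close> prefix sums but only \<open>2 * L\<close>
    possible values; the elements between two equal prefix sums form the required subset.\<close>
  have "P ` {0..2 * L} \<subseteq> {- int L + 1..int L}"
  proof
    fix p assume "p \<in> P ` {0..2 * L}"
    then obtain i where "i \<le> 2 * L" "p = P i" by auto
    then show "p \<in> {- int L + 1..int L}" using xs(3)[of i] len by (simp add: P_def)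
  qed
  then have "card (P ` {0..2 * L}) \<le> card {- int L + 1..int L}"
    by (intro card_mono) auto
  then have "\<not> inj_on P {0..2 * L}" by (intro pigeonhole) simp
  then obtain i j where "i \<in> {0..2 * L}" "j \<in> {0..2 * L}" "P i = P j" "i \<noteq> j"
    unfolding inj_on_def by blast
  then obtain i j where ij: "i < j" "j \<le> 2 * L" "P i = P j"
    by (metis atLeastAtMost_iff linorder_neqE_nat)
  define ys where "ys = take (j - i) (drop i xs)"
  have "take j xs = take i xs @ ys"
    unfolding ys_def using ij(1) by (metis add_diff_inverse_nat less_imp_le_nat not_less take_add)
  then have "sum_list (map w ys) = 0" using ij(3) unfolding P_def by simp
  moreover have "distinct ys" unfolding ys_def using xs(1) by simp
  ultimately have "sum w (set ys) = 0" by (simp add: sum_list_distinct_conv_sum_set)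
  moreover have "length ys = j - i" unfolding ys_def using ij len by simp
  moreover have "set ys \<subseteq> X" unfolding ys_def using xs(2) by (meson in_set_dropD in_set_takeD subsetI)
  ultimately show ?thesis using ij(1,2) \<open>distinct ys\<close>
    by (intro exI[of _ "set ys"]) (auto simp: distinct_card)
qed

lemma zero_sum_partition:
  fixes w :: "'a \<Rightarrow> int" and L :: nat
  assumes "finite X" "\<And>x. x \<in> X \<Longrightarrow> \<bar>w x\<bar> \<le> int L" "L > 0" "sum w X = 0"
  shows "\<exists>g :: 'a \<Rightarrow> nat. \<forall>b. card {x \<in> X. g x = b} \<le> 2 * L \<and> sum w {x \<in> X. g x = b} = 0"
  using assms
proof (induction "card X" arbitrary: X rule: less_induct)
  case less
  show ?case
  proof (cases "X = {}")
    case True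
    then show ?thesis by simp
  next
    case False
    then obtain Y where Y: "Y \<subseteq> X" "Y \<noteq> {}" "card Y \<le> 2 * L" "sum w Y = 0"
      using small_zero_sum_subset[of X w L] less.prems by blast
    have "\<exists>g :: 'a \<Rightarrow> nat. \<forall>b. card {x \<in> X - Y. g x = b} \<le> 2 * L \<and> sum w {x \<in> X - Y. g x = b} = 0"
    proof (rule less.hyps)
      show "card (X - Y) < card X"
        using Y(1,2) less.prems(1) by (intro psubset_card_mono) auto
      show "sum w (X - Y) = 0" using less.prems(1,4) Y by (simp add: sum_diff)
    qed (use less.prems in auto)
    then obtain g :: "'a \<Rightarrow> nat" where
      g: "\<And>b. card {x \<in> X - Y. g x = b} \<le> 2 * L \<and> sum w {x \<in> X - Y. g x = b} = 0" by blast
    define h where "h x = (if x \<in> Y then 0 else Suc (g x))" for x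
    have "{x \<in> X. h x = b} = (case b of 0 \<Rightarrow> Y | Suc b \<Rightarrow> {x \<in> X - Y. g x = b})" for b
      using Y(1) unfolding h_def by (auto split: nat.split)
    then show ?thesis using g Y by (intro exI[of _ h]) (auto split: nat.split)
  qed
qed

text \<open>
  Repairing one more coordinate merges blocks of size at most \<open>L\<close> into blocks of size at most
  \<open>2 * L * L\<close>; started at \<open>L = 1\<close>, this gives \<open>2 * L = 2 ^ 2 ^ m\<close> after \<open>m\<close> coordinates.
\<close>

lemma zero_sum_vector_partition:
  fixes w :: "'a \<Rightarrow> 't \<Rightarrow> int"
  assumes "finite T" "finite X" "\<And>x t. x \<in> X \<Longrightarrow> t \<in> T \<Longrightarrow> \<bar>w x t\<bar> \<le> 1"
    and "\<And>t. t \<in> T \<Longrightarrow> (\<Sum>x\<in>X. w x t) = 0"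
  shows "\<exists>g :: 'a \<Rightarrow> nat. \<forall>b. 2 * card {x \<in> X. g x = b} \<le> 2 ^ 2 ^ card T \<and>
     (\<forall>t\<in>T. (\<Sum>x | x \<in> X \<and> g x = b. w x t) = 0)"
  using assms(1,3,4)
proof (induction T rule: finite_induct)
  case empty
  obtain g :: "'a \<Rightarrow> nat" where g: "inj_on g X"
    using finite_imp_inj_to_nat_seg[OF assms(2)] by blast
  have "card {x \<in> X. g x = b} \<le> 1" for b
  proof -
    have all: "\<forall>x\<in>{x \<in> X. g x = b}. \<forall>y\<in>{x \<in> X. g x = b}. x = y"
      using g unfolding inj_on_def by blast
    have fin: "finite {x \<in> X. g x = b}" using assms(2) by simp
    show ?thesis unfolding One_nat_def card_le_Suc0_iff_eq[OF fin] by (rule all)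
  qed
  then show ?case by (intro exI[of _ g]) simp
next
  case (insert t T)
  obtain g :: "'a \<Rightarrow> nat" where g: "\<And>b. 2 * card {x \<in> X. g x = b} \<le> 2 ^ 2 ^ card T"
     "\<And>b t. t \<in> T \<Longrightarrow> (\<Sum>x | x \<in> X \<and> g x = b. w x t) = 0"
    using insert.IH[OF insert.prems] by blast
  define B where "B = g ` X"
  \<comment> \<open>The blocks themselves become the elements to be grouped, weighted by their sums
    in the new coordinate. Grouping keeps the earlier coordinates at zero, as they are zero on every
    block.\<close>
  define W where "W b = (\<Sum>x | x \<in> X \<and> g x = b. w x t)" for b
  define L :: nat where "L = 2 ^ 2 ^ card T div 2"
  have L: "2 * L = 2 ^ 2 ^ card T"
    unfolding L_def by (rule dvd_mult_div_cancel) (simp add: dvd_power)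
  have card_le: "card {x \<in> X. g x = b} \<le> L" for b using g(1)[of b] L by linarith
  have "\<bar>W b\<bar> \<le> int L" for b
  proof -
    have "\<bar>W b\<bar> \<le> (\<Sum>x | x \<in> X \<and> g x = b. \<bar>w x t\<bar>)" unfolding W_def by (rule sum_abs)
    also have "\<dots> \<le> (\<Sum>x | x \<in> X \<and> g x = b. 1)" using insert.prems(1) by (intro sum_mono) auto
    also have "\<dots> \<le> int L" using card_le[of b] by simp
    finally show ?thesis .
  qed
  moreover have "L > 0" using L by (cases L) auto
  moreover have "sum W B = 0"
    using insert.prems(2)[of t] sum.image_gen[OF assms(2), of "\<lambda>x. w x t" g]
    unfolding W_def B_def by simp
  ultimately obtain h :: "nat \<Rightarrow> nat" where
    h: "\<And>c. card {b \<in> B. h b = c} \<le> 2 * L" "\<And>c. sum W {b \<in> B. h b = c} = 0"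
    using zero_sum_partition[of B W L] assms(2) unfolding B_def by blast
  have fiber: "{x \<in> X. h (g x) = c} = (\<Union>b\<in>{b \<in> B. h b = c}. {x \<in> X. g x = b})" for c
    unfolding B_def by auto
  have sum_fiber: "(\<Sum>x | x \<in> X \<and> h (g x) = c. f x) =
      (\<Sum>b | b \<in> B \<and> h b = c. \<Sum>x | x \<in> X \<and> g x = b. f x)" for c and f :: "'a \<Rightarrow> int"
    unfolding fiber by (rule sum.UNION_disjoint) (use assms(2) in \<open>auto simp: B_def\<close>)
  have "2 * card {x \<in> X. h (g x) = c} \<le> 2 ^ 2 ^ card (insert t T)" for c
  proof -
    have "int (card {x \<in> X. h (g x) = c}) = (\<Sum>b | b \<in> B \<and> h b = c. int (card {x \<in> X. g x = b}))"
      using sum_fiber[of "\<lambda>_. 1" c] by simp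
    also have "\<dots> \<le> (\<Sum>b | b \<in> B \<and> h b = c. int L)" using card_le by (intro sum_mono) simp
    also have "\<dots> \<le> int (2 * L * L)" using h(1)[of c] by (simp flip: of_nat_mult)
    finally have "2 * card {x \<in> X. h (g x) = c} \<le> (2 * L) * (2 * L)" by linarith
    also have "\<dots> = 2 ^ 2 ^ card (insert t T)"
      unfolding L using insert.hyps by (simp add: mult_2 flip: power_add)
    finally show ?thesis .
  qed
  moreover have "(\<Sum>x | x \<in> X \<and> h (g x) = c. w x s) = 0" if "s \<in> insert t T" for c s
  proof (cases "s = t")
    case True
    then show ?thesis using h(2)[of c] unfolding sum_fiber W_def by simp
  next
    case False
    then show ?thesis using g(2)[of s] that unfolding sum_fiber by simp
  qed
  ultimately show ?case by (intro exI[of _ "\<lambda>x. h (g x)"]) simp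
qed

text \<open>Sign-compatibility: \<open>y\<close> is a point of the segment from 0 to
  \<open>d\<close>. A value shifted by \<open>y\<close> then lies between the old value and the
  value shifted by \<open>d\<close>, and meets every lower bound that both of these meet.\<close>

definition between :: "int \<Rightarrow> int \<Rightarrow> bool" where
  "between y d \<longleftrightarrow> 0 \<le> y \<and> y \<le> d \<or> d \<le> y \<and> y \<le> 0"

lemma between_sgn_mult: "0 \<le> k \<Longrightarrow> k \<le> \<bar>d\<bar> \<Longrightarrow> between (sgn d * k) d"
  unfolding between_def by (cases "d = 0"; cases "d > 0") auto

text \<open>
  The difference \<open>d\<close> is split into \<open>\<bar>d i\<bar>\<close> unit atoms for every \<open>i\<close>, and every constraint \<open>t\<close> into
  \<open>\<bar>D t\<bar>\<close> slack atoms that cancel the total \<open>D t\<close>. The blocks of a zero-sum partition of the atoms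
  are sign-compatible with \<open>d\<close>, and one of them has a negative total.
\<close>

lemma small_improvement:
  fixes a :: "'i \<Rightarrow> 't \<Rightarrow> int" and d :: "'i \<Rightarrow> int"
  assumes "finite I" "finite T" "\<And>i t. i \<in> I \<Longrightarrow> t \<in> T \<Longrightarrow> \<bar>a i t\<bar> \<le> 1" "sum d I < 0"
  shows "\<exists>y. (\<forall>i\<in>I. between (y i) (d i)) \<and> (\<Sum>i\<in>I. \<bar>y i\<bar>) \<le> 2 ^ 2 ^ card T \<and> sum y I < 0 \<and>
     (\<forall>t\<in>T. between (\<Sum>i\<in>I. a i t * y i) (\<Sum>i\<in>I. a i t * d i))"
proof -
  define D where "D t = (\<Sum>i\<in>I. a i t * d i)" for t
  define X where "X = Inl ` Sigma I (\<lambda>i. {..<nat \<bar>d i\<bar>}) \<union> Inr ` Sigma T (\<lambda>t. {..<nat \<bar>D t\<bar>})"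
  define w where "w x t = (case x of Inl p \<Rightarrow> sgn (d (fst p)) * a (fst p) t
      | Inr q \<Rightarrow> if fst q = t then - sgn (D t) else 0)" for x :: "'i \<times> nat + 't \<times> nat" and t
  have fin: "finite X" unfolding X_def using assms(1,2) by auto
  have w1: "\<bar>w x t\<bar> \<le> 1" if "x \<in> X" "t \<in> T" for x t
    using that assms(3) unfolding X_def w_def by (auto simp: abs_mult sgn_if)
  have split: "(\<Sum>x | x \<in> X \<and> P x. f x) =
      (\<Sum>i\<in>I. \<Sum>k | k < nat \<bar>d i\<bar> \<and> P (Inl (i, k)). f (Inl (i, k))) +
      (\<Sum>t\<in>T. \<Sum>k | k < nat \<bar>D t\<bar> \<and> P (Inr (t, k)). f (Inr (t, k)))" for P and f :: "_ \<Rightarrow> int"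
  proof -
    have "{x \<in> X. P x} = Inl ` Sigma I (\<lambda>i. {k. k < nat \<bar>d i\<bar> \<and> P (Inl (i, k))}) \<union>
        Inr ` Sigma T (\<lambda>t. {k. k < nat \<bar>D t\<bar> \<and> P (Inr (t, k))})"
      (is "_ = Inl ` ?A \<union> Inr ` ?B") unfolding X_def by auto
    moreover have "finite ?A" "finite ?B" using assms(1,2) by auto
    then have "sum f (Inl ` ?A \<union> Inr ` ?B) = sum f (Inl ` ?A) + sum f (Inr ` ?B)"
      by (intro sum.union_disjoint) auto
    moreover have "sum f (Inl ` ?A) = (\<Sum>i\<in>I. \<Sum>k | k < nat \<bar>d i\<bar> \<and> P (Inl (i, k)). f (Inl (i, k)))"
      using assms(1) by (simp add: sum.reindex sum.Sigma case_prod_unfold)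
    moreover have "sum f (Inr ` ?B) = (\<Sum>t\<in>T. \<Sum>k | k < nat \<bar>D t\<bar> \<and> P (Inr (t, k)). f (Inr (t, k)))"
      using assms(2) by (simp add: sum.reindex sum.Sigma case_prod_unfold)
    ultimately show ?thesis by simp
  qed
  have "(\<Sum>x\<in>X. w x t) = 0" if "t \<in> T" for t
  proof -
    have "(\<Sum>x\<in>X. w x t) = (\<Sum>i\<in>I. \<bar>d i\<bar> * (sgn (d i) * a i t)) +
        (\<Sum>s\<in>T. if s = t then - (\<bar>D t\<bar> * sgn (D t)) else 0)"
      using split[where P = "\<lambda>_. True" and f = "\<lambda>x. w x t"] by (auto simp: w_def intro!: sum.cong)
    also have "\<dots> = 0"
      using that assms(2) by (simp add: D_def abs_mult_sgn mult.left_commute mult.commute flip: mult.assoc)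
    finally show ?thesis .
  qed
  from zero_sum_vector_partition[where w = w, OF assms(2) fin w1 this] obtain g :: "_ \<Rightarrow> nat" where
    g: "\<And>b. 2 * card {x \<in> X. g x = b} \<le> 2 ^ 2 ^ card T"
      "\<And>b t. t \<in> T \<Longrightarrow> (\<Sum>x | x \<in> X \<and> g x = b. w x t) = 0" by blast
  define K where "K b i = card {k. k < nat \<bar>d i\<bar> \<and> g (Inl (i, k)) = b}" for b i
  define H where "H b t = card {k. k < nat \<bar>D t\<bar> \<and> g (Inr (t, k)) = b}" for b t
  have K_le: "int (K b i) \<le> \<bar>d i\<bar>" for b i
  proof -
    have "K b i \<le> card {..<nat \<bar>d i\<bar>}" unfolding K_def by (intro card_mono) auto
    then show ?thesis by simp
  qed
  have H_le: "int (H b t) \<le> \<bar>D t\<bar>" for b t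
  proof -
    have "H b t \<le> card {..<nat \<bar>D t\<bar>}" unfolding H_def by (intro card_mono) auto
    then show ?thesis by simp
  qed
  have "\<exists>b. (\<Sum>i\<in>I. sgn (d i) * int (K b i)) < 0"
  proof (rule ccontr)
    assume neg: "\<not> ?thesis"
    \<comment> \<open>Every unit atom lies in exactly one block and slack atoms count 0, so the
      block totals add up to \<open>sum d I\<close> and cannot all be nonnegative.\<close>
    have "sum d I = (\<Sum>i\<in>I. \<Sum>k<nat \<bar>d i\<bar>. sgn (d i))"
      by (auto simp: abs_mult_sgn intro!: sum.cong)
    also have "\<dots> = (\<Sum>x\<in>X. case x of Inl p \<Rightarrow> sgn (d (fst p)) | Inr q \<Rightarrow> 0)" (is "_ = sum ?f X")
      using split[where P = "\<lambda>_. True" and f = ?f] by (simp add: lessThan_def)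
    also have "\<dots> = (\<Sum>b\<in>g ` X. \<Sum>x | x \<in> X \<and> g x = b. ?f x)" by (rule sum.image_gen[OF fin])
    also have "\<dots> = (\<Sum>b\<in>g ` X. \<Sum>i\<in>I. sgn (d i) * int (K b i))"
      unfolding split by (simp add: K_def mult.commute)
    also have "\<dots> \<ge> 0" by (rule sum_nonneg) (use neg in \<open>simp add: not_less\<close>)
    finally show False using assms(4) by simp
  qed
  then obtain b where b: "(\<Sum>i\<in>I. sgn (d i) * int (K b i)) < 0" by blast
  define y where "y i = sgn (d i) * int (K b i)" for i
  have "between (y i) (d i)" for i unfolding y_def by (rule between_sgn_mult) (use K_le in auto)
  moreover have "(\<Sum>i\<in>I. \<bar>y i\<bar>) \<le> 2 ^ 2 ^ card T"
  proof -
    have "(\<Sum>i\<in>I. \<bar>y i\<bar>) \<le> (\<Sum>i\<in>I. int (K b i))"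
      unfolding y_def by (intro sum_mono) (auto simp: abs_mult sgn_if)
    also have "\<dots> \<le> (\<Sum>i\<in>I. int (K b i)) + (\<Sum>t\<in>T. int (H b t))" by (simp add: sum_nonneg)
    also have "\<dots> = int (card {x \<in> X. g x = b})"
      using split[where P = "\<lambda>x. g x = b" and f = "\<lambda>_. 1"] by (simp add: K_def H_def)
    also have "\<dots> \<le> 2 ^ 2 ^ card T" using g(1)[of b] by (simp add: of_nat_le_iff[symmetric] del: of_nat_le_iff)
    finally show ?thesis .
  qed
  \<comment> \<open>The block sums to zero in coordinate \<open>t\<close>, so its unit atoms
    contribute exactly what its slack atoms cancel: \<open>sgn (D t)\<close> times a number of atoms
    that is at most the absolute value of \<open>D t\<close>.\<close>
  moreover have "between (\<Sum>i\<in>I. a i t * y i) (D t)" if "t \<in> T" for t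
  proof -
    have "0 = (\<Sum>x | x \<in> X \<and> g x = b. w x t)" using g(2)[OF that] by simp
    also have "\<dots> = (\<Sum>i\<in>I. a i t * y i) +
        (\<Sum>s\<in>T. \<Sum>k | k < nat \<bar>D s\<bar> \<and> g (Inr (s, k)) = b. if s = t then - sgn (D t) else 0)"
      unfolding split by (simp add: w_def y_def K_def mult_ac)
    also have "(\<Sum>s\<in>T. \<Sum>k | k < nat \<bar>D s\<bar> \<and> g (Inr (s, k)) = b. if s = t then - sgn (D t) else 0) =
        (\<Sum>s\<in>T. if s = t then - (sgn (D t) * int (H b t)) else 0)"
      by (rule sum.cong) (auto simp: H_def)
    also have "\<dots> = - (sgn (D t) * int (H b t))" using that assms(2) by simp
    finally have "(\<Sum>i\<in>I. a i t * y i) = sgn (D t) * int (H b t)" by simp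
    then show ?thesis using between_sgn_mult[of "int (H b t)" "D t"] H_le by simp
  qed
  moreover have "sum y I < 0" using b unfolding y_def .
  ultimately show ?thesis unfolding D_def by (intro exI[of _ y]) blast
qed

section \<open>Twin classes, flips of single vertices and local improvements\<close>

locale twin_covered_graph =
  fixes G :: "nat pair_pre_digraph" and n :: nat and T :: "nat set"
  assumes graph: "pair_graph G" and verts: "pverts G = {..<n}" and cover: "twin_cover G T"
begin

abbreviation N :: "nat \<Rightarrow> nat set" where
  "N \<equiv> closed_nbhd G"

definition rest :: "nat set" where
  "rest = {..<n} - T"

text \<open>The trace of \<open>v\<close> in \<open>T\<close> as a binary number, with the digit of
  \<open>t\<close> at the rank of \<open>t\<close> in \<open>T\<close>. Ranks instead of vertex
  numbers keep the codes below \<open>2 ^ card T\<close>.\<close>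

definition code :: "nat \<Rightarrow> nat" where
  "code v = (\<Sum>t\<in>T \<inter> N v. 2 ^ card {s \<in> T. s < t})"

definition class_sum :: "(nat \<Rightarrow> nat) \<Rightarrow> nat \<Rightarrow> nat" where
  "class_sum F c = (\<Sum>v | v \<in> rest \<and> code v = c. F v)"

text \<open>With \<open>F\<close> = (f + 1) / 2, this is the condition that f sums to at least 1
  over \<open>N u\<close>.\<close>

definition ok_at :: "(nat \<Rightarrow> nat) \<Rightarrow> nat \<Rightarrow> bool" where
  "ok_at F u \<longleftrightarrow> card (N u) < 2 * sum F (N u)"

definition dominating :: "(nat \<Rightarrow> nat) \<Rightarrow> bool" where
  "dominating F \<longleftrightarrow> (\<forall>u<n. ok_at F u)"

text \<open>The invariant of a sequence of flips that starts at \<open>F\<close>. The constraints at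
  \<open>T\<close> are left out on purpose: they may fail between two flips and are regained only by
  the complete sequence.\<close>

definition tame :: "(nat \<Rightarrow> nat) \<Rightarrow> (nat \<Rightarrow> nat) \<Rightarrow> bool" where
  "tame F H \<longleftrightarrow> (\<forall>v<n. H v \<le> 1) \<and> (\<forall>t\<in>T. H t = F t) \<and> (\<forall>v\<in>rest. ok_at H v)"

text \<open>\<open>b\<close> is the value before the flip. Lowering a vertex lowers
  \<open>2 * sum H (N v)\<close> by 2, so a slack of 2 is demanded; raising it needs none.\<close>

definition eligible :: "nat \<Rightarrow> nat \<Rightarrow> (nat \<Rightarrow> nat) \<Rightarrow> nat \<Rightarrow> bool" where
  "eligible c b H v \<longleftrightarrow>
     v \<in> rest \<and> code v = c \<and> H v = b \<and> (b = 1 \<longrightarrow> card (N v) + 2 < 2 * sum H (N v))"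

lemma arc_less: "(u, v) \<in> parcs G \<Longrightarrow> u < n \<and> v < n"
proof -
  interpret pair_graph G by (rule graph)
  show "(u, v) \<in> parcs G \<Longrightarrow> u < n \<and> v < n" using wellformed(1,2)[of "(u, v)"] verts by auto
qed

lemma arc_sym: "(u, v) \<in> parcs G \<Longrightarrow> (v, u) \<in> parcs G"
proof -
  interpret pair_graph G by (rule graph)
  show "(u, v) \<in> parcs G \<Longrightarrow> (v, u) \<in> parcs G" using arcs_symmetric by simp
qed

lemma T_subset: "T \<subseteq> {..<n}" and finite_T [simp]: "finite T"
  using cover verts finite_subset[of T "{..<n}"] unfolding twin_cover_def by auto

lemma finite_rest [simp]: "finite rest"
  unfolding rest_def by simp

lemma rest_less: "v \<in> rest \<Longrightarrow> v < n"
  unfolding rest_def by simp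

lemma self_in_N [simp]: "u \<in> N u"
  unfolding closed_nbhd_def by simp

lemma N_subset: "u < n \<Longrightarrow> N u \<subseteq> {..<n}"
  unfolding closed_nbhd_def using arc_less by auto

lemma finite_N: "u < n \<Longrightarrow> finite (N u)"
  using N_subset finite_subset by blast

lemma N_sym: "v \<in> N u \<Longrightarrow> u \<in> N v"
  unfolding closed_nbhd_def using arc_sym by auto

lemma N_twins: "v \<in> rest \<Longrightarrow> w \<in> rest \<Longrightarrow> w \<in> N v \<Longrightarrow> N w = N v"
proof -
  assume a: "v \<in> rest" "w \<in> rest" "w \<in> N v"
  show "N w = N v"
  proof (cases "w = v")
    case False
    then have "(v, w) \<in> parcs G" using a(3) unfolding closed_nbhd_def by simp
    then have "twin_edge G v w \<or> v \<in> T \<or> w \<in> T" using cover unfolding twin_cover_def by blast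
    then show ?thesis using a(1,2) unfolding twin_edge_def rest_def by (metis DiffE)
  qed simp
qed

lemma rank_inj: "inj_on (\<lambda>t. card {s \<in> T. s < t}) T"
proof (rule inj_onI)
  fix x y assume xy: "x \<in> T" "y \<in> T" "card {s \<in> T. s < x} = card {s \<in> T. s < y}"
  have less: "card {s \<in> T. s < x} < card {s \<in> T. s < y}" if "x < y" "x \<in> T" for x y
    using that by (intro psubset_card_mono) auto
  then show "x = y" using less[of x y] less[of y x] xy by (cases x y rule: linorder_cases) auto
qed

lemma code_set_encode: "code v = set_encode ((\<lambda>t. card {s \<in> T. s < t}) ` (T \<inter> N v))"
  unfolding code_def set_encode_def
  by (subst sum.reindex) (auto intro: inj_on_subset[OF rank_inj])

lemma code_eq_iff: "code v = code w \<longleftrightarrow> T \<inter> N v = T \<inter> N w"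
  unfolding code_set_encode
  by (subst set_encode_eq) (auto simp: inj_on_image_eq_iff[OF rank_inj])

lemma set_encode_less:
  assumes "A \<subseteq> {..<m}"
  shows "set_encode A < 2 ^ m"
proof -
  have "set_encode A \<le> set_encode {..<m}"
    unfolding set_encode_def using assms by (intro sum_mono2) auto
  also have "\<dots> < 2 ^ m" unfolding set_encode_def by (induction m) auto
  finally show ?thesis .
qed

lemma code_less: "code v < 2 ^ card T"
proof -
  have "card {s \<in> T. s < t} < card T" if "t \<in> T" for t
    using that by (intro psubset_card_mono) auto
  then show ?thesis unfolding code_set_encode by (intro set_encode_less) auto
qed

lemma sum_N_split:
  fixes H :: "nat \<Rightarrow> nat"
  assumes "u < n"
  shows "sum H (N u) = sum H (N u \<inter> T) + sum H (N u \<inter> rest)"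
proof -
  have "N u = (N u \<inter> T) \<union> (N u \<inter> rest)" using N_subset[OF assms] unfolding rest_def by auto
  then have "sum H (N u) = sum H ((N u \<inter> T) \<union> (N u \<inter> rest))" by simp
  also have "\<dots> = sum H (N u \<inter> T) + sum H (N u \<inter> rest)"
    by (rule sum.union_disjoint) (auto simp: rest_def)
  finally show ?thesis .
qed

lemma sum_flip:
  fixes H :: "nat \<Rightarrow> nat"
  assumes "finite A" "H v = b" "b \<le> 1"
  shows "sum (H(v := 1 - b)) A + (if v \<in> A then b else 0) =
    sum H A + (if v \<in> A then 1 - b else 0)"
proof (cases "v \<in> A")
  case True
  then have "sum (H(v := 1 - b)) A = (1 - b) + sum H (A - {v})" "sum H A = b + sum H (A - {v})"
    using assms by (simp_all add: sum.remove)
  then show ?thesis using True by simp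
next
  case False
  then have "sum (H(v := 1 - b)) A = sum H A" by (intro sum.cong) auto
  then show ?thesis using False by simp
qed

text \<open>Only lowering can hurt, and only at those \<open>w\<close> outside \<open>T\<close>
  whose closed neighbourhood contains \<open>v\<close>. There \<open>N w = N v\<close>, so the slack
  found at \<open>v\<close> is also the slack at \<open>w\<close>.\<close>

lemma tame_flip:
  assumes "tame F H" "eligible c b H v" "b \<le> 1"
  shows "tame F (H(v := 1 - b))"
proof -
  have v: "v \<in> rest" "H v = b" using assms(2) unfolding eligible_def by auto
  have "ok_at (H(v := 1 - b)) w" if w: "w \<in> rest" for w
  proof -
    have ok: "card (N w) < 2 * sum H (N w)" using assms(1) w unfolding tame_def ok_at_def by blast
    note flip = sum_flip[of "N w" H v b, OF finite_N[OF rest_less[OF w]] v(2) assms(3)]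
    show ?thesis
    proof (cases "v \<in> N w \<and> b = 1")
      case True
      then have "N w = N v" using N_twins[OF w v(1)] by simp
      then show ?thesis using assms(2) True flip unfolding ok_at_def eligible_def by simp
    next
      case False
      then have "sum H (N w) \<le> sum (H(v := 1 - b)) (N w)" using flip assms(3) by (auto split: if_splits)
      then show ?thesis using ok unfolding ok_at_def by linarith
    qed
  qed
  moreover have "v \<notin> T" using v(1) unfolding rest_def by simp
  ultimately show ?thesis using assms(1) unfolding tame_def by auto
qed

lemma class_sum_flip:
  assumes "eligible c b H v" "b \<le> 1"
  shows "class_sum (H(v := 1 - b)) c' + (if c' = c then b else 0) =
    class_sum H c' + (if c' = c then 1 - b else 0)"
  using sum_flip[of "{v \<in> rest. code v = c'}" H v b] assms
  unfolding class_sum_def eligible_def by auto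

lemma eligible_up:
  assumes "class_sum H c < class_sum F c" "\<forall>v<n. H v \<le> 1" "\<forall>v<n. F v \<le> 1"
  shows "\<exists>v. eligible c 0 H v"
proof (rule ccontr)
  assume "\<not> ?thesis"
  then have "F v \<le> H v" if "v \<in> rest" "code v = c" for v
    using that assms(2,3) rest_less[OF that(1)] unfolding eligible_def
    by (metis le_antisym less_one not_less zero_neq_one)
  then have "class_sum F c \<le> class_sum H c" unfolding class_sum_def by (intro sum_mono) auto
  with assms(1) show False by simp
qed

lemma eligible_down:
  assumes "class_sum F c < class_sum H c" "tame E H" "dominating F" "\<forall>t\<in>T. F t = E t"
  shows "\<exists>v. eligible c 1 H v"
proof -
  let ?C = "{v \<in> rest. code v = c}"
  let ?K = "\<lambda>v. N v \<inter> rest"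
  \<comment> \<open>Adjacent vertices outside \<open>T\<close> are twins, so every clique
    \<open>?K v\<close> lies within one class, and two cliques that meet are equal.\<close>
  have K: "?K v = ?K w \<and> code w = code v" if "v \<in> rest" "w \<in> ?K v" for v w
    using that N_twins[of v w] unfolding code_def by auto
  have "\<Union> (?K ` ?C) = ?C"
  proof (intro equalityI subsetI)
    fix w assume "w \<in> \<Union> (?K ` ?C)"
    then obtain v where "v \<in> rest" "code v = c" "w \<in> ?K v" by auto
    with K[of v w] show "w \<in> ?C" by simp
  qed auto
  moreover have "sum h (\<Union> (?K ` ?C)) = sum (sum h) (?K ` ?C)" for h :: "nat \<Rightarrow> nat"
  proof (subst sum.Union_disjoint)
    show "\<forall>A\<in>?K ` ?C. \<forall>B\<in>?K ` ?C. A \<noteq> B \<longrightarrow> A \<inter> B = {}"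
    proof (intro ballI impI)
      fix A B assume AB: "A \<in> ?K ` ?C" "B \<in> ?K ` ?C" "A \<noteq> B"
      then obtain v w where vw: "v \<in> rest" "w \<in> rest" "A = ?K v" "B = ?K w" by auto
      show "A \<inter> B = {}"
      proof (rule ccontr)
        assume "A \<inter> B \<noteq> {}"
        then obtain x where "x \<in> ?K v" "x \<in> ?K w" unfolding vw by blast
        then show False using AB(3) K[of v x] K[of w x] vw by simp
      qed
    qed
  qed auto
  ultimately have "sum (sum F) (?K ` ?C) < sum (sum H) (?K ` ?C)"
    using assms(1) unfolding class_sum_def by metis
  then obtain B where "B \<in> ?K ` ?C" "sum F B < sum H B"
    by (meson not_less sum_mono)
  then obtain v where v: "v \<in> rest" "code v = c" "sum F (?K v) < sum H (?K v)" by blast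
  have "\<exists>w\<in>?K v. H w \<noteq> 0"
  proof (rule ccontr)
    assume "\<not> ?thesis"
    then have "sum H (?K v) = 0" by (intro sum.neutral) blast
    then show False using v(3) by simp
  qed
  then obtain w where w: "w \<in> ?K v" "H w \<noteq> 0" by blast
  have "H w = 1" using w assms(2) rest_less[of w] unfolding tame_def
    by (metis IntD2 One_nat_def le_SucE le_zero_eq)
  have "N w = N v" using N_twins[of v w] v(1) w(1) by blast
  have vn: "v < n" using rest_less v(1) by simp
  \<comment> \<open>The clique sum of \<open>H\<close> exceeds that of \<open>F\<close> by at least
    1, while \<open>F\<close> satisfies the constraint and agrees with \<open>H\<close> on
    \<open>T\<close>; doubled, this is the slack of 2.\<close>
  have "sum H (N v \<inter> T) = sum F (N v \<inter> T)"
    using assms(2,4) unfolding tame_def by (intro sum.cong) auto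
  moreover have "card (N v) < 2 * sum F (N v)" using assms(3) vn unfolding dominating_def ok_at_def by simp
  ultimately have "card (N v) + 2 < 2 * sum H (N v)"
    using v(3) sum_N_split[OF vn, of H] sum_N_split[OF vn, of F] by simp
  then have "eligible c 1 H w"
    unfolding eligible_def using \<open>H w = 1\<close> \<open>N w = N v\<close> w(1) K[OF v(1) w(1)] v(2) by (metis IntD2)
  then show ?thesis ..
qed

text \<open>The number of flips already made in round \<open>q\<close>. The minimum is there because
  every round takes the same number of steps, of which only the first \<open>r q\<close> flip a
  vertex.\<close>

definition todo :: "(nat \<Rightarrow> nat) \<Rightarrow> nat \<Rightarrow> nat \<Rightarrow> nat \<Rightarrow> nat" where
  "todo r p j q = (if q < p then r q else if q = p then min j (r q) else 0)"

text \<open>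
  The flips prescribed by \<open>r\<close> are carried out in rounds: round \<open>2 * c\<close> raises \<open>r (2 * c)\<close> vertices
  of class \<open>c\<close>, and round \<open>2 * c + 1\<close> lowers \<open>r (2 * c + 1)\<close> of them. The state describes \<open>H\<close> after
  \<open>j\<close> steps of round \<open>p\<close>.
\<close>

definition progress :: "(nat \<Rightarrow> nat) \<Rightarrow> (nat \<Rightarrow> nat) \<Rightarrow> nat \<Rightarrow> nat \<Rightarrow> (nat \<Rightarrow> nat) \<Rightarrow> bool" where
  "progress F r p j H \<longleftrightarrow> tame F H \<and>
     (\<forall>c. class_sum H c + todo r p j (2 * c + 1) = class_sum F c + todo r p j (2 * c))"

lemma progress_skip: "progress F r p j H \<Longrightarrow> r p \<le> j \<Longrightarrow> progress F r p (Suc j) H"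
proof -
  assume "progress F r p j H" "r p \<le> j"
  moreover from this(2) have "todo r p (Suc j) = todo r p j" by (intro ext) (auto simp: todo_def)
  ultimately show ?thesis unfolding progress_def by simp
qed

lemma progress_next: "progress F r p j H \<Longrightarrow> r p \<le> j \<Longrightarrow> progress F r (Suc p) 0 H"
proof -
  assume "progress F r p j H" "r p \<le> j"
  moreover from this(2) have "todo r (Suc p) 0 = todo r p j"
    by (intro ext) (auto simp: todo_def less_Suc_eq)
  ultimately show ?thesis unfolding progress_def by simp
qed

lemma progress_flip:
  assumes "progress F r p j H" "j < r p" "eligible (p div 2) (p mod 2) H v"
  shows "progress F r p (Suc j) (H(v := 1 - H v))"
proof -
  have b: "p mod 2 \<le> 1" "H v = p mod 2" using assms(3) unfolding eligible_def by auto
  have todo: "todo r p (Suc j) q = todo r p j q + (if q = p then 1 else 0)" for q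
    using assms(2) unfolding todo_def by auto
  have "class_sum (H(v := 1 - p mod 2)) c + todo r p (Suc j) (2 * c + 1) =
      class_sum F c + todo r p (Suc j) (2 * c)" for c
  proof -
    note flip = class_sum_flip[OF assms(3) b(1), of c]
    have "class_sum H c + todo r p j (2 * c + 1) = class_sum F c + todo r p j (2 * c)"
      using assms(1) unfolding progress_def by blast
    moreover have "2 * c = p \<longleftrightarrow> c = p div 2 \<and> p mod 2 = 0" "2 * c + 1 = p \<longleftrightarrow> c = p div 2 \<and> p mod 2 = 1"
      by presburger+
    ultimately show ?thesis using flip unfolding todo by (cases "p mod 2 = 0") (auto split: if_splits)
  qed
  then show ?thesis using tame_flip[OF _ assms(3) b(1)] assms(1) b(2) unfolding progress_def by simp
qed

text \<open>The counts \<open>r\<close> come from the better function \<open>F\<close>, but every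
  sequence of eligible flips with these counts can be continued and ends in an improvement. So
  neither \<open>F\<close> nor the vertices to be flipped have to be known to the search.\<close>

lemma local_improvement:
  assumes "\<forall>v<n. E v \<le> 1" "\<forall>v<n. F v \<le> 1" "dominating E" "dominating F" "\<forall>t\<in>T. F t = E t"
    and "sum F {..<n} < sum E {..<n}"
  obtains r where "\<And>p. r p \<le> 2 ^ 2 ^ card T" "progress E r 0 0 E"
    "\<And>p j H. progress E r p j H \<Longrightarrow> j < r p \<Longrightarrow> \<exists>v. eligible (p div 2) (p mod 2) H v"
    "\<And>H. progress E r (2 * 2 ^ card T) 0 H \<Longrightarrow> dominating H \<and> sum H {..<n} < sum E {..<n}"
proof -
  define I where "I = code ` rest"
  define a :: "nat \<Rightarrow> nat \<Rightarrow> int" where "a c t = (if c \<in> code ` (N t \<inter> rest) then 1 else 0)" for c t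
  define d where "d c = int (class_sum F c) - int (class_sum E c)" for c
  have total: "sum H {..<n} = sum H T + (\<Sum>c\<in>I. class_sum H c)" for H :: "nat \<Rightarrow> nat"
  proof -
    have "{..<n} = T \<union> rest" using T_subset unfolding rest_def by auto
    have "sum H {..<n} = sum H T + sum H rest"
      unfolding \<open>{..<n} = T \<union> rest\<close> by (intro sum.union_disjoint) (auto simp: rest_def)
    also have "sum H rest = (\<Sum>c\<in>I. class_sum H c)"
      unfolding I_def class_sum_def by (rule sum.image_gen) simp
    finally show ?thesis .
  qed
  have at_T: "int (sum H (N t)) = int (sum H (N t \<inter> T)) + (\<Sum>c\<in>I. a c t * int (class_sum H c))"
    if t: "t \<in> T" for H t
  proof -
    \<comment> \<open>The code of a vertex records whether \<open>t\<close> is its neighbour, so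
      each class lies inside \<open>N t\<close> or is disjoint from it.\<close>
    have same: "{v \<in> N t \<inter> rest. code v = c} = {v \<in> rest. code v = c}" if "c \<in> code ` (N t \<inter> rest)" for c
    proof -
      have "w \<in> N t" if w: "w \<in> rest" "code w = c" for w
      proof -
        obtain v where "v \<in> N t" "code v = code w" using \<open>c \<in> _\<close> w by auto
        then have "t \<in> T \<inter> N w" using t N_sym code_eq_iff by blast
        then show ?thesis using N_sym by blast
      qed
      then show ?thesis by auto
    qed
    have "sum H (N t \<inter> rest) = (\<Sum>c\<in>code ` (N t \<inter> rest). \<Sum>v | v \<in> N t \<inter> rest \<and> code v = c. H v)"
      by (rule sum.image_gen) simp
    also have "\<dots> = (\<Sum>c\<in>code ` (N t \<inter> rest). class_sum H c)"
      unfolding class_sum_def by (intro sum.cong same) auto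
    finally have "int (sum H (N t \<inter> rest)) = (\<Sum>c\<in>code ` (N t \<inter> rest). int (class_sum H c))" by simp
    also have "\<dots> = (\<Sum>c\<in>I. a c t * int (class_sum H c))"
      unfolding a_def I_def by (intro sum.mono_neutral_cong_left) auto
    finally have "int (sum H (N t \<inter> rest)) = (\<Sum>c\<in>I. a c t * int (class_sum H c))" .
    moreover have "t < n" using t T_subset by auto
    ultimately show ?thesis using sum_N_split[of t H] by linarith
  qed
  have "sum d I < 0"
    using assms(6) total[of F] total[of E] sum.cong[OF refl, of T F E] assms(5)
    by (simp add: d_def sum_subtractf flip: of_nat_sum)
  moreover have "finite I" unfolding I_def by simp
  moreover have "\<bar>a c t\<bar> \<le> 1" for c t unfolding a_def by simp
  ultimately have "\<exists>y. (\<forall>c\<in>I. between (y c) (d c)) \<and> (\<Sum>c\<in>I. \<bar>y c\<bar>) \<le> 2 ^ 2 ^ card T \<and> sum y I < 0 \<and>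
     (\<forall>t\<in>T. between (\<Sum>c\<in>I. a c t * y c) (\<Sum>c\<in>I. a c t * d c))"
    by (intro small_improvement finite_T)
  then obtain y where
    y: "\<And>c. c \<in> I \<Longrightarrow> between (y c) (d c)" "(\<Sum>c\<in>I. \<bar>y c\<bar>) \<le> 2 ^ 2 ^ card T" "sum y I < 0"
      "\<And>t. t \<in> T \<Longrightarrow> between (\<Sum>c\<in>I. a c t * y c) (\<Sum>c\<in>I. a c t * d c)"
    by blast
  define z where "z c = (if c \<in> I then y c else 0)" for c
  \<comment> \<open>A positive change of class \<open>c\<close> is left to round
    \<open>2 * c\<close>, a negative one to round \<open>2 * c + 1\<close>; truncation by
    \<open>nat\<close> makes the other round empty.\<close>
  define r where "r p = (if even p then nat (z (p div 2)) else nat (- z (p div 2)))" for p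
  have r_simps: "r (2 * c) = nat (z c)" "r (Suc (2 * c)) = nat (- z c)" for c
    unfolding r_def by simp_all
  show ?thesis
  proof
    show "r p \<le> 2 ^ 2 ^ card T" for p
    proof -
      have "\<bar>z c\<bar> \<le> 2 ^ 2 ^ card T" for c
      proof (cases "c \<in> I")
        case True
        then have "\<bar>y c\<bar> \<le> (\<Sum>c\<in>I. \<bar>y c\<bar>)"
          by (intro member_le_sum) (auto simp: I_def)
        then show ?thesis using y(2) True unfolding z_def by simp
      qed (simp add: z_def)
      then have "\<bar>z (p div 2)\<bar> \<le> 2 ^ 2 ^ card T" .
      then have "z (p div 2) \<le> 2 ^ 2 ^ card T" "- z (p div 2) \<le> 2 ^ 2 ^ card T"
        by linarith+
      then have "int (r p) \<le> int (2 ^ 2 ^ card T)" unfolding r_def by simp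
      then show ?thesis by linarith
    qed
    show "progress E r 0 0 E"
      using assms(1,3) unfolding progress_def tame_def todo_def dominating_def rest_def by auto
    show "\<exists>v. eligible (p div 2) (p mod 2) H v" if pr: "progress E r p j H" and j: "j < r p" for p j H
    proof -
      define c where "c = p div 2"
      have sums: "class_sum H c + todo r p j (2 * c + 1) = class_sum E c + todo r p j (2 * c)"
        and tm: "tame E H" using pr unfolding progress_def by auto
      have "c \<in> I" using j unfolding r_def c_def z_def by (auto split: if_splits)
      then have bt: "between (z c) (d c)" using y(1) unfolding z_def by simp
      show ?thesis
      proof (cases "even p")
        case True
        then have p: "p = 2 * c" unfolding c_def by simp
        \<comment> \<open>Only \<open>j\<close> of the \<open>z c\<close> raises have been made and
          \<open>z c \<le> d c\<close>, so the class has not yet reached its sum in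
          \<open>F\<close>.\<close>
        then have "int j < z c" using j unfolding p r_simps by linarith
        moreover have "class_sum H c = class_sum E c + j"
          using sums j unfolding todo_def p by simp
        ultimately have "class_sum H c < class_sum F c" using bt unfolding between_def d_def by linarith
        then show ?thesis using eligible_up[of H c F] tm assms(2) True
          unfolding tame_def c_def by (simp add: even_iff_mod_2_eq_zero)
      next
        case False
        then have p: "p = Suc (2 * c)" unfolding c_def by presburger
        then have "int j < - z c" using j unfolding p r_simps by linarith
        moreover from this have "nat (z c) = 0" by simp
        then have "class_sum H c + j = class_sum E c"
          using sums j unfolding todo_def p by (simp add: r_simps)
        ultimately have "class_sum F c < class_sum H c" using bt unfolding between_def d_def by linarith
        then show ?thesis using eligible_down[of F c H E] tm assms(4,5) False
          unfolding c_def by (simp add: odd_iff_mod_2_eq_one)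
      qed
    qed
    show "dominating H \<and> sum H {..<n} < sum E {..<n}" if pr: "progress E r (2 * 2 ^ card T) 0 H" for H
    proof -
      have cs: "int (class_sum H c) = int (class_sum E c) + y c" if "c \<in> I" for c
      proof -
        have "c < 2 ^ card T" using that code_less unfolding I_def by auto
        then have "todo r (2 * 2 ^ card T) 0 (2 * c + 1) = r (Suc (2 * c))"
           "todo r (2 * 2 ^ card T) 0 (2 * c) = r (2 * c)"
          unfolding todo_def by auto
        then have "class_sum H c + r (Suc (2 * c)) = class_sum E c + r (2 * c)"
          using pr unfolding progress_def by metis
        then show ?thesis using that unfolding r_simps z_def by (cases "y c \<ge> 0") auto
      qed
      have tm: "\<And>t. t \<in> T \<Longrightarrow> H t = E t" "\<And>v. v \<in> rest \<Longrightarrow> ok_at H v"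
        using pr unfolding progress_def tame_def by auto
      have "sum H T = sum E T" using tm(1) by simp
      moreover have "int (\<Sum>c\<in>I. class_sum H c) = int (\<Sum>c\<in>I. class_sum E c) + sum y I"
        using cs by (simp add: sum.distrib)
      ultimately have "sum H {..<n} < sum E {..<n}" unfolding total using y(3) by linarith
      moreover have "ok_at H t" if t: "t \<in> T" for t
      proof -
        let ?s = "\<lambda>f. \<Sum>c\<in>I. a c t * f c"
        have "sum H (N t \<inter> T) = sum E (N t \<inter> T)" "sum F (N t \<inter> T) = sum E (N t \<inter> T)"
          using tm(1) assms(5) by (auto intro: sum.cong)
        moreover have "?s (\<lambda>c. int (class_sum H c)) = ?s (\<lambda>c. int (class_sum E c)) + ?s y"
          using cs by (simp add: distrib_left sum.distrib)
        moreover have "?s (\<lambda>c. int (class_sum F c)) = ?s (\<lambda>c. int (class_sum E c)) + ?s d"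
          unfolding d_def by (simp add: right_diff_distrib sum_subtractf)
        ultimately have "int (sum H (N t)) = int (sum E (N t)) + ?s y"
          "int (sum F (N t)) = int (sum E (N t)) + ?s d"
          unfolding at_T[OF t] by simp_all
        \<comment> \<open>The change at \<open>t\<close> is between 0 and the change from
          \<open>E\<close> to \<open>F\<close>, so the new sum is no smaller than one of the two
          sums, and either is large enough.\<close>
        then have "sum E (N t) \<le> sum H (N t) \<or> sum F (N t) \<le> sum H (N t)"
          using y(4)[OF t] unfolding between_def by linarith
        moreover have "ok_at E t" "ok_at F t" using assms(3,4) t T_subset unfolding dominating_def by auto
        ultimately show ?thesis unfolding ok_at_def by linarith
      qed
      ultimately show ?thesis using tm(2) unfolding dominating_def rest_def by blast
    qed
  qed
qed

lemma sum_zero_one_signs: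
  fixes F :: "nat \<Rightarrow> nat"
  shows "(\<Sum>v\<in>A. 2 * int (F v) - 1) = 2 * int (sum F A) - int (card A)"
  by (simp add: sum_subtractf sum_distrib_left)

text \<open>Under f = 2 F - 1 the weight becomes \<open>2 * sum F {..<n} - n\<close>. The comparison
  is made in the integers, as \<open>k\<close> may be negative.\<close>

lemma signed_domination_iff:
  "(\<exists>f. signed_dominating G f \<and> weight G f \<le> k) \<longleftrightarrow>
   (\<exists>F. (\<forall>v<n. F v \<le> 1) \<and> dominating F \<and> 2 * int (sum F {..<n}) \<le> int n + k)"
proof
  assume "\<exists>f. signed_dominating G f \<and> weight G f \<le> k"
  then obtain f where f: "signed_dominating G f" "weight G f \<le> k" by blast
  define F where "F v = (if f v = 1 then 1 else 0 :: nat)" for v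
  have fF: "f v = 2 * int (F v) - 1" if "v < n" for v
    using f(1) that verts unfolding signed_dominating_def F_def by auto
  have sum: "sum f A = 2 * int (sum F A) - int (card A)" if "A \<subseteq> {..<n}" for A
    unfolding sum_zero_one_signs[symmetric] by (intro sum.cong fF) (use that in auto)
  have "ok_at F u" if "u < n" for u
  proof -
    have "sum f (N u) \<ge> 1" using f(1) that verts unfolding signed_dominating_def by simp
    then show ?thesis unfolding ok_at_def sum[OF N_subset[OF that]] by linarith
  qed
  moreover have "2 * int (sum F {..<n}) \<le> int n + k"
    using f(2) sum[of "{..<n}"] verts unfolding weight_def by simp
  ultimately show "\<exists>F. (\<forall>v<n. F v \<le> 1) \<and> dominating F \<and> 2 * int (sum F {..<n}) \<le> int n + k"
    by (intro exI[of _ F]) (simp add: dominating_def F_def)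
next
  assume "\<exists>F. (\<forall>v<n. F v \<le> 1) \<and> dominating F \<and> 2 * int (sum F {..<n}) \<le> int n + k"
  then obtain F where F: "\<forall>v<n. F v \<le> 1" "dominating F" "2 * int (sum F {..<n}) \<le> int n + k"
    by blast
  let ?f = "\<lambda>v. 2 * int (F v) - 1"
  have "?f v \<in> {- 1, 1}" if "v < n" for v
  proof -
    have "F v = 0 \<or> F v = 1" using F(1) that by (metis One_nat_def le_SucE le_zero_eq)
    then show ?thesis by auto
  qed
  moreover have "(\<Sum>v\<in>N u. ?f v) \<ge> 1" if "u < n" for u
  proof -
    have "card (N u) < 2 * sum F (N u)" using F(2) that unfolding dominating_def ok_at_def by blast
    then show ?thesis unfolding sum_zero_one_signs by linarith
  qed
  ultimately have "signed_dominating G ?f" unfolding signed_dominating_def verts by simp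
  moreover have "weight G ?f \<le> k" unfolding weight_def verts sum_zero_one_signs using F(3) by simp
  ultimately show "\<exists>f. signed_dominating G f \<and> weight G f \<le> k" by (intro exI[of _ ?f] conjI)
qed

end

text \<open>All vertices together form a twin cover, so the \<open>LEAST\<close> in the definition
  ranges over a nonempty set.\<close>

lemma twin_cover_number_attained:
  assumes "pair_graph G"
  obtains T where "twin_cover G T" "card T = twin_cover_number G"
proof -
  interpret pair_graph G by (rule assms)
  have "twin_cover G (pverts G)" unfolding twin_cover_def using wellformed(1) by fastforce
  then have "\<exists>c T. twin_cover G T \<and> card T = c" by blast
  from LeastI_ex[OF this] show ?thesis using that unfolding twin_cover_number_def by blast
qed

section \<open>The local search\<close>

declare One_nat_def [simp del]
declare run.simps(6) [simp del]

abbreviation (input) "rn \<equiv> 2 :: nat"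
abbreviation (input) "rS \<equiv> 3 :: nat"
abbreviation (input) "rS2 \<equiv> 4 :: nat"
abbreviation (input) "rE \<equiv> 5 :: nat"
abbreviation (input) "rL \<equiv> 6 :: nat"
abbreviation (input) "rQ \<equiv> 7 :: nat"
abbreviation (input) "rA \<equiv> 8 :: nat"
abbreviation (input) "rq \<equiv> 9 :: nat"
abbreviation (input) "rneg \<equiv> 10 :: nat"
abbreviation (input) "rk \<equiv> 11 :: nat"
abbreviation (input) "ru \<equiv> 12 :: nat"
abbreviation (input) "rv \<equiv> 13 :: nat"
abbreviation (input) "rw \<equiv> 14 :: nat"
abbreviation (input) "rz \<equiv> 15 :: nat"
abbreviation (input) "rt \<equiv> 16 :: nat"
abbreviation (input) "rs \<equiv> 17 :: nat"
abbreviation (input) "ri \<equiv> 18 :: nat"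
abbreviation (input) "ra \<equiv> 19 :: nat"
abbreviation (input) "rx \<equiv> 20 :: nat"
abbreviation (input) "rp \<equiv> 21 :: nat"
abbreviation (input) "rj \<equiv> 22 :: nat"
abbreviation (input) "ridx \<equiv> 23 :: nat"
abbreviation (input) "rans \<equiv> 24 :: nat"
abbreviation (input) "aT \<equiv> 1 :: nat"
abbreviation (input) "aF \<equiv> 2 :: nat"
abbreviation (input) "aH \<equiv> 3 :: nat"

text \<open>
  Array \<open>0\<close> holds the input word. Array \<open>aT\<close> holds \<open>2\<close> to the rank of \<open>t\<close> in \<open>T\<close> for \<open>t \<in> T\<close>, and
  \<open>0\<close> elsewhere, so that summing it over a neighbourhood gives the code of the trace in \<open>T\<close>.
  Arrays \<open>aF\<close> and \<open>aH\<close> hold the current and the tentative function, with \<open>0\<close> in place of \<open>- 1\<close>.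
\<close>

definition adj_exp :: "nat \<Rightarrow> nat \<Rightarrow> exp" where
  "adj_exp u v = Arr 0 (Plus (Plus (Plus (Var rn) (Num 1))
     (SumUpto rz rn (Cond (Minus (Var u) (Var rz)) (Var rn) (Num 0)))) (Var v))"

definition nbr_exp :: "nat \<Rightarrow> nat \<Rightarrow> exp" where
  "nbr_exp u v = Cond (Plus (Minus (Var u) (Var v)) (Minus (Var v) (Var u))) (adj_exp u v) (Num 1)"

definition degree_exp :: "nat \<Rightarrow> exp" where
  "degree_exp u = SumUpto rw rn (Cond (nbr_exp u rw) (Num 1) (Num 0))"

definition nsum_exp :: "nat \<Rightarrow> nat \<Rightarrow> exp" where
  "nsum_exp k u = SumUpto rw rn (Cond (nbr_exp u rw) (Arr k (Var rw)) (Num 0))"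

definition bad_exp :: "nat \<Rightarrow> exp" where
  "bad_exp k = SumUpto ru rn (Cond (Minus (Plus (nsum_exp k ru) (nsum_exp k ru)) (degree_exp ru)) (Num 0) (Num 1))"

definition total_exp :: "nat \<Rightarrow> exp" where
  "total_exp k = SumUpto rv rn (Arr k (Var rv))"

definition odd_exp :: "nat \<Rightarrow> exp" where
  "odd_exp x = Minus (Var x) (Plus (Halve (Var x)) (Halve (Var x)))"

text \<open>Twice the code plus the value of the vertex: a single comparison with the round number
  \<open>rp\<close> tests both the class and the direction of the flip.\<close>

definition key_exp :: exp where
  "key_exp = Plus (Plus (nsum_exp aT rv) (nsum_exp aT rv)) (Arr aH (Var rv))"

definition eligible_exp :: exp where
  "eligible_exp = Cond (Arr aT (Var rv)) (Num 0)
     (Cond (Plus (Minus key_exp (Var rp)) (Minus (Var rp) key_exp)) (Num 0)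
     (Cond (Arr aH (Var rv))
        (Minus (Plus (nsum_exp aH rv) (nsum_exp aH rv)) (Plus (degree_exp rv) (Num 2)))
        (Num 1)))"

text \<open>If no vertex is eligible, only the unused cell \<open>n\<close> of the array is changed.\<close>

definition flip_com :: com where
  "flip_com = Assign ridx (Var rn) ;;
     For rv rn (Branch eligible_exp (Assign ridx (Var rv)) Nop) ;;
     Write aH (Var ridx) (Minus (Num 1) (Arr aH (Var ridx)))"

definition copy_com :: "nat \<Rightarrow> nat \<Rightarrow> com" where
  "copy_com k l = For rv rn (Write k (Var rv) (Arr l (Var rv)))"

definition step_com :: com where
  "step_com = Branch (odd_exp rx) flip_com Nop ;; Assign rx (Halve (Var rx))"

text \<open>Bit \<open>p * L + j\<close> of the advice tells whether step \<open>j\<close> of round \<open>p\<close> flips a vertex.\<close>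

definition advice_com :: com where
  "advice_com = Assign rx (Var ra) ;; For rp rS2 (For rj rL step_com)"

text \<open>The advice is tried blindly and the flips ignore the constraints at \<open>T\<close>, so
  the outcome is kept only after domination and strict improvement have been checked.\<close>

definition update_com :: com where
  "update_com = Branch (bad_exp aH) Nop
     (Branch (Minus (total_exp aF) (total_exp aH)) (copy_com aF aH) Nop)"

definition candidate_com :: com where
  "candidate_com = copy_com aH aF ;; advice_com ;; update_com"

text \<open>
  As long as the function is not optimal, a pass over all advice lowers its number of ones, so that
  \<open>n\<close> passes suffice.
\<close>

definition search_com :: com where
  "search_com = For ri rn (For ra rA candidate_com)"

text \<open>Scanning in increasing order hands to each \<open>t\<close> in \<open>T\<close> the
  binary digit of \<open>rs\<close> at the rank of \<open>t\<close>, so that the values of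
  \<open>rs\<close> run through all assignments on \<open>T\<close>.\<close>

definition init_com :: com where
  "init_com = Assign rx (Var rs) ;;
     For rt rn (Branch (Arr aT (Var rt))
       (Write aF (Var rt) (odd_exp rx) ;; Assign rx (Halve (Var rx)))
       (Write aF (Var rt) (Num 1)))"

text \<open>Nonzero if and only if twice the number of ones exceeds n + k. The absolute value of k
  is moved to the side where it is added, since subtraction is truncated.\<close>

definition excess_exp :: exp where
  "excess_exp = Cond (Var rneg)
     (Minus (Plus (Plus (total_exp aF) (total_exp aF)) (Var rk)) (Var rn))
     (Minus (Plus (total_exp aF) (total_exp aF)) (Plus (Var rn) (Var rk)))"

definition solve_com :: com where
  "solve_com = Assign rans (Num 0) ;;
     For rs rS (init_com ;; search_com ;;
       Branch (bad_exp aF) Nop (Branch excess_exp Nop (Assign rans (Num 1))))"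

lemmas exp_defs = adj_exp_def nbr_exp_def degree_exp_def nsum_exp_def bad_exp_def total_exp_def
  odd_exp_def key_exp_def eligible_exp_def excess_exp_def

lemmas com_defs = flip_com_def step_com_def copy_com_def advice_com_def update_com_def candidate_com_def search_com_def
  init_com_def solve_com_def

section \<open>Values of the expressions and effects of the commands\<close>

definition graph_store :: "nat pair_pre_digraph \<Rightarrow> nat \<Rightarrow> (nat \<Rightarrow> nat) \<Rightarrow> (nat \<Rightarrow> nat \<Rightarrow> nat) \<Rightarrow> bool" where
  "graph_store G n V A \<longleftrightarrow> V rn = n \<and>
     (\<forall>u<n. \<forall>v<n. A 0 (n + 1 + u * n + v) \<noteq> 0 \<longleftrightarrow> (u, v) \<in> parcs G)"

lemma graph_store_upd [simp]: "x \<noteq> rn \<Longrightarrow> graph_store G n (V(x := i)) A \<longleftrightarrow> graph_store G n V A"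
  unfolding graph_store_def by simp

lemma graph_store_n: "graph_store G n V A \<Longrightarrow> V rn = n"
  unfolding graph_store_def by simp

lemma sum_mult_less: "u \<le> n \<Longrightarrow> (\<Sum>i<n. if u - i \<noteq> 0 then m else 0) = u * (m :: nat)"
proof -
  assume "u \<le> n"
  then have "{..<n} \<inter> {i. u - i \<noteq> 0} = {..<u}" by auto
  then show ?thesis by (simp add: sum.If_cases)
qed

lemma eval_adj:
  assumes "graph_store G n V A" "V u < n" "V v < n" "u \<noteq> rz" "v \<noteq> rz"
  shows "eval (adj_exp u v) V A \<noteq> 0 \<longleftrightarrow> (V u, V v) \<in> parcs G"
proof -
  have "eval (adj_exp u v) V A = A 0 (n + 1 + V u * n + V v)"
    using assms sum_mult_less[of "V u" n n] graph_store_n[OF assms(1)]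
    unfolding adj_exp_def eval.simps by (simp cong: if_cong)
  then show ?thesis using assms(1-3) unfolding graph_store_def by auto
qed

lemma eval_nbr:
  assumes "graph_store G n V A" "V u < n" "V v < n" "u \<noteq> rz" "v \<noteq> rz"
  shows "eval (nbr_exp u v) V A \<noteq> 0 \<longleftrightarrow> V v \<in> closed_nbhd G (V u)"
  using eval_adj[OF assms] unfolding nbr_exp_def closed_nbhd_def by auto

lemma eval_odd: "eval (odd_exp x) V A = V x mod 2"
  unfolding odd_exp_def by (simp add: minus_mult_div_eq_mod[symmetric] mult_2)

lemma eval_total: "graph_store G n V A \<Longrightarrow> eval (total_exp k) V A = sum (A k) {..<n}"
  unfolding total_exp_def by (simp add: graph_store_n)

context twin_covered_graph
begin

lemma eval_nsum:
  assumes "graph_store G n V A" "V u < n" "u \<noteq> rz" "u \<noteq> rw"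
  shows "eval (nsum_exp k u) V A = sum (A k) (N (V u))"
proof -
  have "eval (nsum_exp k u) V A = (\<Sum>i<n. if i \<in> N (V u) then A k i else 0)"
    unfolding nsum_exp_def eval.simps graph_store_n[OF assms(1)]
    using assms eval_nbr[of G n "V(rw := _)" A u rw] by (intro sum.cong) auto
  also have "{..<n} \<inter> {i. i \<in> N (V u)} = N (V u)" using N_subset[OF assms(2)] by auto
  then have "(\<Sum>i<n. if i \<in> N (V u) then A k i else 0) = sum (A k) (N (V u))"
    by (simp add: sum.If_cases)
  finally show ?thesis .
qed

lemma eval_degree:
  assumes "graph_store G n V A" "V u < n" "u \<noteq> rz" "u \<noteq> rw"
  shows "eval (degree_exp u) V A = card (N (V u))"
proof -
  have "eval (degree_exp u) V A = (\<Sum>i<n. if i \<in> N (V u) then 1 else 0)"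
    unfolding degree_exp_def eval.simps graph_store_n[OF assms(1)]
    using assms eval_nbr[of G n "V(rw := _)" A u rw] by (intro sum.cong) auto
  also have "{..<n} \<inter> {i. i \<in> N (V u)} = N (V u)" using N_subset[OF assms(2)] by auto
  then have "(\<Sum>i<n. if i \<in> N (V u) then 1 else 0) = card (N (V u))"
    by (simp add: sum.If_cases)
  finally show ?thesis .
qed

lemma eval_bad:
  assumes "graph_store G n V A"
  shows "eval (bad_exp k) V A = 0 \<longleftrightarrow> dominating (A k)"
proof -
  have "eval (nsum_exp k ru) (V(ru := i)) A = sum (A k) (N i)"
    "eval (degree_exp ru) (V(ru := i)) A = card (N i)" if "i < n" for i
    using eval_nsum[of "V(ru := i)" A ru k] eval_degree[of "V(ru := i)" A ru] assms that by auto
  then have "eval (bad_exp k) V A = (\<Sum>i<n. if ok_at (A k) i then 0 else 1)"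
    unfolding bad_exp_def eval.simps graph_store_n[OF assms(1)]
    by (intro sum.cong) (auto simp: ok_at_def)
  then show ?thesis unfolding dominating_def by auto
qed

definition ranked :: "(nat \<Rightarrow> nat) \<Rightarrow> (nat \<Rightarrow> nat \<Rightarrow> nat) \<Rightarrow> bool" where
  "ranked V A \<longleftrightarrow> graph_store G n V A \<and>
     (\<forall>v<n. A aT v = (if v \<in> T then 2 ^ card {s \<in> T. s < v} else 0))"

lemma ranked_cong:
  "ranked V A \<Longrightarrow> V' rn = V rn \<Longrightarrow> A' 0 = A 0 \<Longrightarrow> A' aT = A aT \<Longrightarrow> ranked V' A'"
  unfolding ranked_def graph_store_def by simp

lemma ranked_run:
  "ranked (fst s) (snd s) \<Longrightarrow> rn \<notin> writes c \<Longrightarrow> 0 \<notin> array_writes c \<Longrightarrow> aT \<notin> array_writes c \<Longrightarrow>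
   ranked (fst (run c s)) (snd (run c s))"
  by (rule ranked_cong) (simp_all add: run_frame run_array_frame)

lemma eval_eligible:
  assumes "ranked V A" "V rv < n" "A aH (V rv) \<le> 1"
  shows "eval eligible_exp V A \<noteq> 0 \<longleftrightarrow> eligible (V rp div 2) (V rp mod 2) (A aH) (V rv)"
proof -
  let ?v = "V rv"
  have gs: "graph_store G n V A" and T: "\<forall>v<n. A aT v = (if v \<in> T then 2 ^ card {s \<in> T. s < v} else 0)"
    using assms(1) unfolding ranked_def by auto
  have "sum (A aT) (N ?v) = (\<Sum>t\<in>N ?v. if t \<in> T then 2 ^ card {s \<in> T. s < t} else 0)"
    using N_subset[OF assms(2)] T by (intro sum.cong) auto
  also have "\<dots> = code ?v"
    unfolding code_def using finite_N[OF assms(2)] by (simp add: sum.inter_restrict[symmetric] Int_commute)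
  finally have code: "sum (A aT) (N ?v) = code ?v" .
  have key: "eval key_exp V A = 2 * code ?v + A aH ?v"
    unfolding key_exp_def using eval_nsum[OF gs assms(2), of aT] code by simp
  have T: "A aT ?v \<noteq> 0 \<longleftrightarrow> ?v \<in> T" using T assms(2) by simp
  have "2 * code ?v + A aH ?v = V rp \<longleftrightarrow> code ?v = V rp div 2 \<and> A aH ?v = V rp mod 2"
    using assms(3) by presburger
  moreover have "eval (nsum_exp aH rv) V A = sum (A aH) (N ?v)" "eval (degree_exp rv) V A = card (N ?v)"
    using eval_nsum[OF gs assms(2), of aH] eval_degree[OF gs assms(2)] by simp_all
  moreover have "?v \<in> rest \<longleftrightarrow> A aT ?v = 0" using T assms(2) unfolding rest_def by auto
  moreover have "A aH ?v = 0 \<or> A aH ?v = 1" using assms(3) by linarith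
  moreover have "(x - y) + (y - x) \<noteq> 0 \<longleftrightarrow> x \<noteq> y" for x y :: nat by auto
  moreover have "(x + x) - y \<noteq> 0 \<longleftrightarrow> y < 2 * x" for x y :: nat by auto
  ultimately show ?thesis
    unfolding eligible_exp_def eval.simps key eligible_def by (simp only:) auto
qed

lemma dominating_cong:
  assumes "\<forall>u<n. H u = H' u" "dominating H"
  shows "dominating H'"
proof -
  have "sum H (N v) = sum H' (N v)" if "v < n" for v
    using N_subset[OF that] assms(1) by (intro sum.cong) auto
  then show ?thesis using assms(2) unfolding dominating_def ok_at_def by simp
qed

lemma progress_cong:
  assumes "\<forall>u<n. H u = H' u" "progress F r p j H"
  shows "progress F r p j H'"
proof -
  have "sum H (N v) = sum H' (N v)" if "v < n" for v
    using N_subset[OF that] assms(1) by (intro sum.cong) auto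
  then have "tame F H'" using assms T_subset rest_less
    unfolding progress_def tame_def ok_at_def by (metis lessThan_iff subsetD)
  moreover have "class_sum H' c = class_sum H c" for c
    unfolding class_sum_def using assms(1) rest_less by (intro sum.cong) auto
  ultimately show ?thesis using assms(2) unfolding progress_def by simp
qed

text \<open>What remains true of the working functions even if the guess on \<open>T\<close> has no
  dominating completion or the advice is wrong. Together with the final check this makes a positive
  answer sound.\<close>

definition extends :: "(nat \<Rightarrow> nat) \<Rightarrow> (nat \<Rightarrow> nat) \<Rightarrow> bool" where
  "extends F H \<longleftrightarrow> (\<forall>v<n. H v \<le> 1) \<and> (\<forall>t\<in>T. H t = F t)"

lemma extends_cong: "\<forall>u<n. H u = H' u \<Longrightarrow> extends F H \<Longrightarrow> extends F H'"
  unfolding extends_def using T_subset by auto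

lemma extends_flip: "extends F H \<Longrightarrow> eligible c b H v \<Longrightarrow> extends F (H(v := 1 - H v))"
  unfolding extends_def eligible_def rest_def by auto

text \<open>Which eligible vertex is flipped stays open, and equality is claimed below
  \<open>n\<close> only, since cell \<open>n\<close> absorbs the write if there is none.\<close>

lemma run_flip:
  assumes "ranked (fst s) (snd s)" "\<forall>v<n. snd s aH v \<le> 1"
  defines "el \<equiv> eligible (fst s rp div 2) (fst s rp mod 2) (snd s aH)"
  shows "(\<exists>v. el v \<and> (\<forall>u<n. snd (run flip_com s) aH u = ((snd s aH)(v := 1 - snd s aH v)) u)) \<or>
    (\<forall>v. \<not> el v) \<and> (\<forall>u<n. snd (run flip_com s) aH u = snd s aH u)"
proof -
  let ?body = "Branch eligible_exp (Assign ridx (Var rv)) Nop"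
  let ?s = "((fst s)(ridx := n), snd s)"
  have n: "fst s rn = n" using assms(1) graph_store_n unfolding ranked_def by blast
  define P where "P i t \<longleftrightarrow> snd t = snd s \<and> ranked (fst t) (snd t) \<and> fst t rp = fst s rp \<and>
    (fst t ridx = n \<and> (\<forall>v<i. \<not> el v) \<or> fst t ridx < n \<and> el (fst t ridx))" for i and t :: store
  have "P (fst ?s rn) (run (For rv rn ?body) ?s)"
  proof (rule run_For_induct)
    show "P 0 ?s" unfolding P_def using ranked_cong[OF assms(1)] by auto
    fix i t assume i: "i < fst ?s rn" and P: "P i t"
    let ?t = "((fst t)(rv := i), snd t)"
    have rk: "ranked (fst ?t) (snd ?t)" using P ranked_cong unfolding P_def by fastforce
    have "eval eligible_exp (fst ?t) (snd ?t) \<noteq> 0 \<longleftrightarrow> el i"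
      using eval_eligible[OF rk] i n assms(2) P unfolding P_def el_def by simp
    then show "P (Suc i) (run ?body ?t)"
      using P rk i n ranked_cong[OF rk] unfolding P_def by (auto simp: less_Suc_eq)
  qed
  then have P: "P n (run (For rv rn ?body) ?s)" using n by simp
  define t where "t = run (For rv rn ?body) ?s"
  have run: "run flip_com s = (fst t, (snd t)(aH := (snd t aH)(fst t ridx := 1 - snd t aH (fst t ridx))))"
    unfolding flip_com_def t_def using n by simp
  from P consider "fst t ridx = n" "\<forall>v<n. \<not> el v" "snd t = snd s"
    | "fst t ridx < n" "el (fst t ridx)" "snd t = snd s"
    unfolding P_def t_def by blast
  then show ?thesis
  proof cases
    case 1
    moreover have "\<not> el v" for v using 1(2) rest_less unfolding el_def eligible_def by blast
    ultimately show ?thesis unfolding run by simp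
  next
    case 2
    then show ?thesis unfolding run by auto
  qed
qed

lemma run_copy:
  assumes "fst s rn = n" "k \<noteq> l"
  shows "\<forall>u<n. snd (run (copy_com k l) s) k u = snd s l u"
proof -
  let ?c = "Write k (Var rv) (Arr l (Var rv))"
  have "(\<forall>u<fst s rn. snd (run (For rv rn ?c) s) k u = snd s l u) \<and> snd (run (For rv rn ?c) s) l = snd s l"
    by (rule run_For_induct[of "\<lambda>i t. (\<forall>u<i. snd t k u = snd s l u) \<and> snd t l = snd s l"])
      (use assms(2) in \<open>auto simp: less_Suc_eq\<close>)
  then show ?thesis using assms(1) unfolding copy_com_def by simp
qed

lemma writes_flip [simp]: "writes flip_com = {ridx, rv}" "array_writes flip_com = {aH}"
  unfolding flip_com_def by auto

lemma writes_copy [simp]: "writes (copy_com k l) = {rv}" "array_writes (copy_com k l) = {k}"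
  unfolding copy_com_def by auto

lemma writes_step [simp]: "writes step_com = {rx, ridx, rv}" "array_writes step_com = {aH}"
  unfolding step_com_def by auto

lemma writes_advice [simp]: "writes advice_com = {rx, rp, rj, ridx, rv}" "array_writes advice_com = {aH}"
  unfolding advice_com_def by auto

lemma writes_update [simp]: "writes update_com = {rv}" "array_writes update_com = {aF}"
  unfolding update_com_def by auto

lemma writes_candidate [simp]:
  "writes candidate_com = {rx, rp, rj, ridx, rv}" "array_writes candidate_com = {aF, aH}"
  unfolding candidate_com_def by auto

lemma writes_search [simp]:
  "writes search_com = {ri, ra, rx, rp, rj, ridx, rv}" "array_writes search_com = {aF, aH}"
  unfolding search_com_def by auto

lemma writes_init [simp]: "writes init_com = {rx, rt}" "array_writes init_com = {aF}"
  unfolding init_com_def by auto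

lemma run_advice_extends:
  assumes "ranked (fst s) (snd s)" "extends F (snd s aH)"
  shows "extends F (snd (run advice_com s) aH)"
proof -
  define P where "P t \<longleftrightarrow> ranked (fst t) (snd t) \<and> extends F (snd t aH)" for t :: store
  have upd: "P ((fst t)(x := i), snd t)" if "P t" "x \<noteq> rn" for t x i
    using that ranked_cong unfolding P_def by fastforce
  have flip: "P (run flip_com t)" if "P t" for t
  proof -
    have rk: "ranked (fst t) (snd t)" and ext: "extends F (snd t aH)" using that unfolding P_def by auto
    then have "\<forall>v<n. snd t aH v \<le> 1" unfolding extends_def by blast
    from run_flip[OF rk this] have "extends F (snd (run flip_com t) aH)"
      using extends_cong[OF _ extends_flip[OF ext]] extends_cong[OF _ ext] by metis
    then show ?thesis using ranked_run[OF rk] unfolding P_def by simp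
  qed
  have step: "P (run step_com t)" if "P t" for t
    using upd[of _ rx] flip[OF that] that unfolding step_com_def by simp
  have inner: "P (run (For rj rL step_com) t)" if "P t" for t
    by (rule run_For_induct[of "\<lambda>_. P"]) (use that step upd in auto)
  have "P (run (For rp rS2 (For rj rL step_com)) ((fst s)(rx := fst s ra), snd s))"
  proof (rule run_For_induct[of "\<lambda>_. P"])
    show "P ((fst s)(rx := fst s ra), snd s)" using upd[of s rx] assms unfolding P_def by simp
    fix i t assume "P t"
    from inner[OF upd[OF this]] show "P (run (For rj rL step_com) ((fst t)(rp := i), snd t))" by simp
  qed
  then show ?thesis unfolding advice_com_def P_def by simp
qed

text \<open>The advice is \<open>r\<close> in unary: in the block of \<open>L\<close> digits for
  round \<open>p\<close> the first \<open>r p\<close> are ones. By \<open>el\<close>, an eligible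
  vertex exists whenever a digit demands a flip.\<close>

lemma run_advice_progress:
  assumes rk: "ranked (fst s) (snd s)" and start: "progress E r 0 0 (snd s aH)"
    and S2: "fst s rS2 = S2" and L: "fst s rL = L"
    and r: "\<And>p. r p \<le> L"
    and el: "\<And>p j H. progress E r p j H \<Longrightarrow> j < r p \<Longrightarrow> \<exists>v. eligible (p div 2) (p mod 2) H v"
    and bits: "\<And>p j. p < S2 \<Longrightarrow> j < L \<Longrightarrow> odd (fst s ra div 2 ^ (p * L + j)) \<longleftrightarrow> j < r p"
  shows "progress E r S2 0 (snd (run advice_com s) aH)"
proof -
  define P where "P p j t \<longleftrightarrow> ranked (fst t) (snd t) \<and> progress E r p j (snd t aH) \<and> fst t rL = L \<and>
    fst t rx = fst s ra div 2 ^ (p * L + j)" for p j and t :: store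
  have upd: "P p j ((fst t)(x := i), snd t)" if "P p j t" "x \<notin> {rn, rL, rx}" for t x i p j
    using that ranked_cong unfolding P_def by fastforce
  have step: "P p (Suc j) (run step_com t)" if P: "P p j t" "fst t rp = p" and pj: "p < S2" "j < L" for p j t
  proof -
    have rk: "ranked (fst t) (snd t)" and pr: "progress E r p j (snd t aH)" and tL: "fst t rL = L"
      and x: "fst t rx = fst s ra div 2 ^ (p * L + j)" using P unfolding P_def by auto
    have bin: "\<forall>v<n. snd t aH v \<le> 1" using pr unfolding progress_def tame_def by blast
    define t' where "t' = run (Branch (odd_exp rx) flip_com Nop) t"
    have "progress E r p (Suc j) (snd t' aH)"
    proof (cases "j < r p")
      case True
      then have "t' = run flip_com t"
        using bits[OF pj] x unfolding t'_def by (simp add: eval_odd odd_iff_mod_2_eq_one)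
      moreover obtain v where "eligible (p div 2) (p mod 2) (snd t aH) v"
        "\<forall>u<n. snd (run flip_com t) aH u = ((snd t aH)(v := 1 - snd t aH v)) u"
        using run_flip[OF rk bin] el[OF pr True] P(2) by auto
      ultimately show ?thesis
        using progress_cong[OF _ progress_flip[OF pr True]] by metis
    next
      case False
      then have "t' = t" using bits[OF pj] x unfolding t'_def by (simp add: eval_odd even_iff_mod_2_eq_zero)
      then show ?thesis using progress_skip[OF pr] False by simp
    qed
    moreover have "ranked (fst t') (snd t')" "fst t' rL = L" "fst t' rx = fst t rx"
      unfolding t'_def using tL by (auto intro!: ranked_run[OF rk] simp: run_frame simp del: run.simps)
    moreover have "run step_com t = ((fst t')(rx := fst t' rx div 2), snd t')"
      unfolding step_com_def t'_def by simp
    moreover have "ranked ((fst t')(rx := fst t' rx div 2)) (snd t')"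
      using calculation(2) ranked_cong by fastforce
    moreover have "fst s ra div 2 ^ (p * L + Suc j) = fst s ra div 2 ^ (p * L + j) div 2"
      by (metis add_Suc_right div_mult2_eq power_Suc2)
    ultimately show ?thesis using x unfolding P_def by simp
  qed
  have inner: "P (Suc p) 0 (run (For rj rL step_com) t)" if P: "P p 0 t" "fst t rp = p" and p: "p < S2" for p t
  proof -
    have "fst t rL = L" using P unfolding P_def by simp
    moreover have "P p (fst t rL) (run (For rj rL step_com) t) \<and> fst (run (For rj rL step_com) t) rp = p"
    proof (rule run_For_induct[of "\<lambda>j t. P p j t \<and> fst t rp = p"])
      fix j t' assume "j < fst t rL" "P p j t' \<and> fst t' rp = p"
      then show "P p (Suc j) (run step_com ((fst t')(rj := j), snd t')) \<and>
          fst (run step_com ((fst t')(rj := j), snd t')) rp = p"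
        using step[OF upd[of p j t' rj j]] p \<open>fst t rL = L\<close> by (simp add: run_frame)
    qed (use P in simp)
    ultimately show ?thesis
      using progress_next[of E r p L] r[of p] unfolding P_def by (simp add: algebra_simps)
  qed
  let ?s = "((fst s)(rx := fst s ra), snd s)"
  have "P (fst ?s rS2) 0 (run (For rp rS2 (For rj rL step_com)) ?s)"
  proof (rule run_For_induct[of "\<lambda>p. P p 0"])
    show "P 0 0 ?s" unfolding P_def using ranked_cong[OF rk] start L by simp
    fix p t assume "p < fst ?s rS2" "P p 0 t"
    then show "P (Suc p) 0 (run (For rj rL step_com) ((fst t)(rp := p), snd t))"
      using inner[OF upd[of p 0 t rp p]] S2 by simp
  qed
  then show ?thesis using S2 unfolding advice_com_def P_def by simp
qed

text \<open>The first two claims hold for any advice and ensure that wrong advice does no damage;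
  the third lets good advice take effect.\<close>

lemma run_candidate:
  assumes rk: "ranked (fst s) (snd s)" and ext: "extends F (snd s aF)"
  defines "E \<equiv> snd s aF" and "E' \<equiv> snd (run candidate_com s) aF"
    and "H \<equiv> snd (run advice_com (run (copy_com aH aF) s)) aH"
  shows "extends F E'"
    and "(\<forall>u<n. E' u = E u) \<or> dominating E' \<and> sum E' {..<n} < sum E {..<n}"
    and "dominating H \<Longrightarrow> sum H {..<n} < sum E {..<n} \<Longrightarrow> sum E' {..<n} < sum E {..<n}"
proof -
  define s1 where "s1 = run (copy_com aH aF) s"
  define s2 where "s2 = run advice_com s1"
  have n: "fst s rn = n" using rk graph_store_n unfolding ranked_def by blast
  have "snd s1 aF = E" unfolding s1_def E_def by (simp add: run_array_frame)
  moreover have "\<forall>u<n. snd s aF u = snd s1 aH u" unfolding s1_def using run_copy[OF n, of aH aF] by simp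
  then have "extends F (snd s1 aH)" by (rule extends_cong[OF _ ext])
  moreover have "ranked (fst s1) (snd s1)" unfolding s1_def by (rule ranked_run[OF rk]) auto
  ultimately have s2: "ranked (fst s2) (snd s2)" "extends F H" "snd s2 aF = E" "snd s2 aH = H"
    unfolding s2_def H_def s1_def[symmetric]
    using run_advice_extends[of s1 F] ranked_run[of s1 advice_com] by (auto simp: run_array_frame)
  have gs: "graph_store G n (fst s2) (snd s2)" using s2(1) unfolding ranked_def by blast
  have E': "E' = snd (run update_com s2) aF" unfolding E'_def candidate_com_def s2_def s1_def by simp
  have "extends F E' \<and> ((\<forall>u<n. E' u = E u) \<or> dominating E' \<and> sum E' {..<n} < sum E {..<n}) \<and>
    (dominating H \<and> sum H {..<n} < sum E {..<n} \<longrightarrow> sum E' {..<n} < sum E {..<n})"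
  proof (cases "dominating H \<and> sum H {..<n} < sum E {..<n}")
    case True
    then have "E' = snd (run (copy_com aF aH) s2) aF"
      unfolding E' update_com_def using eval_bad[OF gs, of aH] eval_total[OF gs] s2 by simp
    then have E'H: "\<forall>u<n. E' u = H u"
      using run_copy[OF graph_store_n[OF gs], of aF aH] s2 by simp
    then have "sum E' {..<n} = sum H {..<n}" by (intro sum.cong) auto
    moreover have "dominating E'" by (rule dominating_cong[OF _ conjunct1[OF True]]) (use E'H in simp)
    moreover have "extends F E'" by (rule extends_cong[OF _ s2(2)]) (use E'H in simp)
    ultimately show ?thesis
      using True by auto
  next
    case False
    then have "E' = E"
      unfolding E' update_com_def using eval_bad[OF gs, of aH] eval_total[OF gs] s2 by auto
    then show ?thesis
      using False ext unfolding E_def by auto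
  qed
  then show "extends F E'"
    and "(\<forall>u<n. E' u = E u) \<or> dominating E' \<and> sum E' {..<n} < sum E {..<n}"
    and "dominating H \<Longrightarrow> sum H {..<n} < sum E {..<n} \<Longrightarrow> sum E' {..<n} < sum E {..<n}"
    by blast+
qed

text \<open>With S = \<open>2 ^ card T\<close> there are S assignments on \<open>T\<close> and S
  possible codes, hence 2 S rounds. A round has at most 2 ^ S flips by
  \<open>small_improvement\<close>, and by \<open>advice_size\<close> there are enough advice
  numbers for all strings of 2 S * 2 ^ S bits.\<close>

definition sized :: "(nat \<Rightarrow> nat) \<Rightarrow> bool" where
  "sized V \<longleftrightarrow> V rS = 2 ^ card T \<and> V rS2 = 2 * 2 ^ card T \<and> V rL = 2 ^ 2 ^ card T \<and>
     V rA = 2 ^ 2 ^ (4 * 2 ^ card T)"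

text \<open>The set of positions of ones is encoded as a number; uniqueness of quotient and
  remainder modulo \<open>L\<close> keeps the blocks of different rounds apart.\<close>

lemma advice_exists:
  fixes L S2 :: nat
  shows "\<exists>a<2 ^ (S2 * L) :: nat. \<forall>p<S2. \<forall>j<L. odd (a div 2 ^ (p * L + j)) \<longleftrightarrow> j < r p"
proof (intro exI conjI allI impI)
  define K where "K = {p * L + j | p j. p < S2 \<and> j < L \<and> j < r p}"
  have K: "K \<subseteq> {..<S2 * L}"
  proof
    fix i assume "i \<in> K"
    then obtain p j where "i = p * L + j" "p < S2" "j < L" unfolding K_def by blast
    moreover from this have "Suc p * L \<le> S2 * L" by (intro mult_le_mono1) simp
    ultimately have "i < Suc p * L" "Suc p * L \<le> S2 * L" by simp_all
    then show "i \<in> {..<S2 * L}" by simp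
  qed
  show "set_encode K < 2 ^ (S2 * L)" by (rule set_encode_less[OF K])
  have "finite K" using K finite_subset by blast
  then have dec: "odd (set_encode K div 2 ^ i) \<longleftrightarrow> i \<in> K" for i
    using set_encode_inverse[of K] unfolding set_decode_def by blast
  show "odd (set_encode K div 2 ^ (p * L + j)) \<longleftrightarrow> j < r p" if "p < S2" "j < L" for p j
  proof -
    have "p = p' \<and> j = j'" if "p * L + j = p' * L + j'" "j' < L" for p' j'
    proof -
      have "(p * L + j) div L = p" "(p' * L + j') div L = p'"
        using that(2) \<open>j < L\<close> by simp_all
      then have "p = p'" using that(1) by simp
      then show ?thesis using that by simp
    qed
    then have "p * L + j \<in> K \<longleftrightarrow> j < r p" unfolding K_def using that by blast
    then show ?thesis unfolding dec .
  qed
qed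

lemma advice_size:
  fixes S :: nat
  assumes "S > 0"
  shows "(2 * S) * 2 ^ S \<le> (2 :: nat) ^ (4 * S)"
proof -
  have "S < 2 ^ S" by (rule less_exp)
  then have "2 * S * 2 ^ S \<le> 2 * 2 ^ S * 2 ^ S" by (intro mult_le_mono) auto
  also have "\<dots> = 2 ^ (1 + S + S)" by (simp add: power_add)
  also have "\<dots> \<le> 2 ^ (4 * S)" using assms by (intro power_increasing) auto
  finally show ?thesis .
qed

text \<open>\<open>B\<close> is any competitor with the same values on \<open>T\<close>. If it is
  better than the function at the start of the pass, then some advice number improves on that
  function.\<close>

lemma run_pass:
  assumes rk: "ranked (fst s) (snd s)" and sz: "sized (fst s)" and ext: "extends F (snd s aF)"
    and dom: "dominating (snd s aF)" and opt: "extends F B" "dominating B"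
  defines "E \<equiv> snd s aF" and "E' \<equiv> snd (run (For ra rA candidate_com) s) aF"
  shows "extends F E' \<and> dominating E' \<and> sum E' {..<n} \<le> sum E {..<n} \<and>
    (sum E {..<n} \<le> sum B {..<n} \<or> sum E' {..<n} < sum E {..<n})"
proof -
  define Q where "Q t \<longleftrightarrow> ranked (fst t) (snd t) \<and> sized (fst t) \<and> extends F (snd t aF) \<and>
    dominating (snd t aF)" for t :: store
  have Q_upd: "Q ((fst t)(ra := i), snd t)" if "Q t" for t i
    using that ranked_cong unfolding Q_def sized_def by fastforce
  have Q_cand: "Q (run candidate_com t)" if "Q t" for t
  proof -
    have t: "ranked (fst t) (snd t)" "extends F (snd t aF)" using that unfolding Q_def by auto
    have "dominating (snd (run candidate_com t) aF)"
      using run_candidate(2)[OF t] dominating_cong[of "snd t aF"] that unfolding Q_def by metis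
    then show ?thesis using run_candidate(1)[OF t] ranked_run[OF t(1), of candidate_com] that
      unfolding Q_def sized_def by (auto simp: run_frame)
  qed
  have le: "sum (snd (run candidate_com t) aF) {..<n} \<le> sum (snd t aF) {..<n}" if "Q t" for t
  proof -
    have t: "ranked (fst t) (snd t)" "extends F (snd t aF)" using that unfolding Q_def by auto
    from run_candidate(2)[OF t] show ?thesis
    proof
      assume "\<forall>u<n. snd (run candidate_com t) aF u = snd t aF u"
      then show ?thesis by (intro sum_mono) simp
    qed simp
  qed
  show ?thesis
  proof (cases "sum E {..<n} \<le> sum B {..<n}")
    case True
    have "Q (run (For ra rA candidate_com) s) \<and> sum E' {..<n} \<le> sum E {..<n}"
      unfolding E'_def E_def
    proof (rule run_For_induct[of "\<lambda>_ t. Q t \<and> sum (snd t aF) {..<n} \<le> sum (snd s aF) {..<n}"])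
      show "Q s \<and> sum (snd s aF) {..<n} \<le> sum (snd s aF) {..<n}"
        using assms unfolding Q_def by simp
      fix i t assume "Q t \<and> sum (snd t aF) {..<n} \<le> sum (snd s aF) {..<n}"
      then show "Q (run candidate_com ((fst t)(ra := i), snd t)) \<and>
        sum (snd (run candidate_com ((fst t)(ra := i), snd t)) aF) {..<n} \<le> sum (snd s aF) {..<n}"
        using Q_cand[OF Q_upd[of t i]] le[OF Q_upd[of t i]] by auto
    qed
    then show ?thesis using True unfolding Q_def E'_def by simp
  next
    case False
    have EB: "\<forall>t\<in>T. B t = E t" using ext opt unfolding extends_def E_def by simp
    obtain r where r: "\<And>p. r p \<le> 2 ^ 2 ^ card T" "progress E r 0 0 E"
      "\<And>p j H. progress E r p j H \<Longrightarrow> j < r p \<Longrightarrow> \<exists>v. eligible (p div 2) (p mod 2) H v"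
      "\<And>H. progress E r (2 * 2 ^ card T) 0 H \<Longrightarrow> dominating H \<and> sum H {..<n} < sum E {..<n}"
      using local_improvement[of E B] ext opt dom EB False unfolding extends_def E_def by auto
    let ?L = "2 ^ 2 ^ card T :: nat" and ?S2 = "2 * 2 ^ card T :: nat"
    obtain a :: nat where a: "a < 2 ^ (?S2 * ?L)"
      "\<And>p j. p < ?S2 \<Longrightarrow> j < ?L \<Longrightarrow> odd (a div 2 ^ (p * ?L + j)) \<longleftrightarrow> j < r p"
      using advice_exists[of ?S2 ?L r] by metis
    have "(2 :: nat) ^ (?S2 * ?L) \<le> 2 ^ 2 ^ (4 * 2 ^ card T)"
      using advice_size[of "2 ^ card T"] by (intro power_increasing) auto
    from less_le_trans[OF a(1) this] sz have aA: "a < fst s rA" unfolding sized_def by simp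
    \<comment> \<open>The advice \<open>a\<close> was chosen for the function \<open>E\<close> at
      the start of the pass. Either \<open>E\<close> is still in place when \<open>a\<close> is
      tried, or an earlier advice number has already lowered the sum.\<close>
    define P where "P i t \<longleftrightarrow> Q t \<and> (sum (snd t aF) {..<n} < sum E {..<n} \<or>
      (\<forall>u<n. snd t aF u = E u) \<and> i \<le> a)" for i and t :: store
    have "P (fst s rA) (run (For ra rA candidate_com) s)"
    proof (rule run_For_induct)
      show "P 0 s" using assms unfolding P_def Q_def E_def by simp
      fix i t assume P: "P i t"
      let ?t = "((fst t)(ra := i), snd t)"
      have Q: "Q ?t" using Q_upd P unfolding P_def by blast
      then have t: "ranked (fst ?t) (snd ?t)" "extends F (snd ?t aF)" and sz: "sized (fst ?t)"
        unfolding Q_def by auto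
      consider "sum (snd t aF) {..<n} < sum E {..<n}" | "\<forall>u<n. snd t aF u = E u" "i < a"
        | "\<forall>u<n. snd t aF u = E u" "i = a"
        using P le_less[of i a] unfolding P_def by blast
      then show "P (Suc i) (run candidate_com ?t)"
      proof cases
        case 1
        then show ?thesis using Q_cand[OF Q] le[OF Q] unfolding P_def by simp
      next
        case 2
        then have "sum (snd t aF) {..<n} = sum E {..<n}" by (intro sum.cong) auto
        with run_candidate(2)[OF t] 2 show ?thesis using Q_cand[OF Q] unfolding P_def by auto
      next
        case 3
        define t1 where "t1 = run (copy_com aH aF) ?t"
        have n: "fst ?t rn = n" using t(1) graph_store_n unfolding ranked_def by blast
        have "progress E r ?S2 0 (snd (run advice_com t1) aH)"
        proof (rule run_advice_progress[where L = ?L])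
          show "ranked (fst t1) (snd t1)" unfolding t1_def by (rule ranked_run[OF t(1)]) auto
          have "\<forall>u<n. E u = snd t1 aH u" using run_copy[OF n, of aH aF] 3(1) unfolding t1_def by simp
          then show "progress E r 0 0 (snd t1 aH)" using progress_cong r(2) by blast
          show "fst t1 rS2 = ?S2" "fst t1 rL = ?L"
            using sz unfolding t1_def sized_def by (simp_all add: run_frame)
          show "odd (fst t1 ra div 2 ^ (p * ?L + j)) \<longleftrightarrow> j < r p" if "p < ?S2" "j < ?L" for p j
            using a(2)[OF that] 3(2) unfolding t1_def by (simp add: run_frame)
        qed (use r in auto)
        from r(4)[OF this] have H: "dominating (snd (run advice_com t1) aH)"
          "sum (snd (run advice_com t1) aH) {..<n} < sum E {..<n}" by auto
        have "sum (snd t aF) {..<n} = sum E {..<n}" using 3(1) by (intro sum.cong) auto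
        with run_candidate(3)[OF t] H have "sum (snd (run candidate_com ?t) aF) {..<n} < sum E {..<n}"
          unfolding t1_def by simp
        then show ?thesis using Q_cand[OF Q] unfolding P_def by simp
      qed
    qed
    then show ?thesis using aA unfolding P_def Q_def E'_def by auto
  qed
qed

lemma run_search_extends:
  assumes "ranked (fst s) (snd s)" "extends F (snd s aF)"
  shows "extends F (snd (run search_com s) aF)"
proof -
  define P where "P t \<longleftrightarrow> ranked (fst t) (snd t) \<and> extends F (snd t aF)" for t :: store
  have upd: "P ((fst t)(x := i), snd t)" if "P t" "x \<noteq> rn" for t x i
    using that ranked_cong unfolding P_def by fastforce
  have cand: "P (run candidate_com t)" if "P t" for t
    using that run_candidate(1)[of t F] ranked_run[of t candidate_com] unfolding P_def by simp
  have pass: "P (run (For ra rA candidate_com) t)" if "P t" for t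
    by (rule run_For_induct[of "\<lambda>_. P"]) (use that cand upd in auto)
  have "P (run search_com s)"
    unfolding search_com_def
    by (rule run_For_induct[of "\<lambda>_. P"]) (use assms pass upd in \<open>auto simp: P_def\<close>)
  then show ?thesis unfolding P_def by simp
qed

lemma run_search_optimal:
  assumes rk: "ranked (fst s) (snd s)" and sz: "sized (fst s)" and ext: "extends F (snd s aF)"
    and dom: "dominating (snd s aF)" and opt: "extends F B" "dominating B"
  shows "dominating (snd (run search_com s) aF) \<and>
    sum (snd (run search_com s) aF) {..<n} \<le> sum B {..<n}"
proof -
  have n: "fst s rn = n" using rk graph_store_n unfolding ranked_def by blast
  \<comment> \<open>Each pass lowers a sum that still exceeds that of \<open>B\<close>, and the sum
    is at most \<open>n\<close> initially. After \<open>n\<close> passes the second alternative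
    forces the sum to be 0.\<close>
  define P where "P i t \<longleftrightarrow> ranked (fst t) (snd t) \<and> sized (fst t) \<and> extends F (snd t aF) \<and>
    dominating (snd t aF) \<and> (sum (snd t aF) {..<n} \<le> sum B {..<n} \<or> sum (snd t aF) {..<n} + i \<le> n)"
    for i and t :: store
  have "P (fst s rn) (run (For ri rn (For ra rA candidate_com)) s)"
  proof (rule run_For_induct)
    have "sum (snd s aF) {..<n} \<le> (\<Sum>v<n. 1)" using ext unfolding extends_def by (intro sum_mono) simp
    then show "P 0 s" using assms unfolding P_def by simp
    fix i t assume P: "P i t"
    let ?t = "((fst t)(ri := i), snd t)"
    have t: "ranked (fst ?t) (snd ?t)" "sized (fst ?t)" "extends F (snd ?t aF)" "dominating (snd ?t aF)"
      using P ranked_cong[of "fst t" "snd t" "fst ?t" "snd ?t"] unfolding P_def sized_def by auto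
    have "ranked (fst (run (For ra rA candidate_com) ?t)) (snd (run (For ra rA candidate_com) ?t))"
      by (rule ranked_run[OF t(1)]) auto
    moreover have "sized (fst (run (For ra rA candidate_com) ?t))"
      using t(2) unfolding sized_def by (simp add: run_frame)
    ultimately show "P (Suc i) (run (For ra rA candidate_com) ?t)"
      using run_pass[OF t opt] P unfolding P_def by auto
  qed
  then show ?thesis using n unfolding P_def search_com_def by auto
qed

definition matches :: "(nat \<Rightarrow> nat) \<Rightarrow> nat \<Rightarrow> bool" where
  "matches F i \<longleftrightarrow> (\<forall>t\<in>T. F t = i div 2 ^ card {s \<in> T. s < t} mod 2)"

lemma matches_exists:
  assumes "\<forall>v<n. F v \<le> 1"
  shows "\<exists>i<2 ^ card T. matches F i"
proof -
  let ?rank = "\<lambda>t. card {s \<in> T. s < t}"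
  let ?K = "?rank ` {t \<in> T. F t = 1}"
  have "?rank t < card T" if "t \<in> T" for t
    using that by (intro psubset_card_mono) auto
  then have "set_encode ?K < 2 ^ card T" by (intro set_encode_less) auto
  moreover have "matches F (set_encode ?K)"
    unfolding matches_def
  proof
    fix t assume t: "t \<in> T"
    have "odd (set_encode ?K div 2 ^ ?rank t) \<longleftrightarrow> ?rank t \<in> ?K"
      using set_encode_inverse[of ?K] unfolding set_decode_def by auto
    also have "\<dots> \<longleftrightarrow> F t = 1" using t rank_inj by (auto dest: inj_onD)
    finally show "F t = set_encode ?K div 2 ^ ?rank t mod 2"
      using assms t T_subset by (auto simp: odd_iff_mod_2_eq_one le_Suc_eq One_nat_def)
  qed
  ultimately show ?thesis by blast
qed

lemma run_init:
  assumes rk: "ranked (fst s) (snd s)"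
  defines "E \<equiv> snd (run init_com s) aF"
  shows "matches E (fst s rs)" "\<forall>v<n. E v \<le> 1" "\<forall>v\<in>rest. E v = 1"
proof -
  let ?body = "Branch (Arr aT (Var rt))
       (Write aF (Var rt) (odd_exp rx) ;; Assign rx (Halve (Var rx)))
       (Write aF (Var rt) (Num 1))"
  let ?s = "((fst s)(rx := fst s rs), snd s)"
  have n: "fst s rn = n" using rk graph_store_n unfolding ranked_def by blast
  define P where "P i t \<longleftrightarrow> ranked (fst t) (snd t) \<and> fst t rx = fst s rs div 2 ^ card {s \<in> T. s < i} \<and>
    (\<forall>v<i. snd t aF v = (if v \<in> T then fst s rs div 2 ^ card {s \<in> T. s < v} mod 2 else 1))" for i and t :: store
  have "P (fst ?s rn) (run (For rt rn ?body) ?s)"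
  proof (rule run_For_induct)
    show "P 0 ?s" unfolding P_def using ranked_cong[OF rk] by simp
    fix i t assume i: "i < fst ?s rn" and P: "P i t"
    let ?t = "((fst t)(rt := i), snd t)"
    have rk: "ranked (fst ?t) (snd ?t)" using P ranked_cong unfolding P_def by fastforce
    have T: "snd t aT i \<noteq> 0 \<longleftrightarrow> i \<in> T" using rk i n unfolding ranked_def by simp
    have "{s \<in> T. s < Suc i} = (if i \<in> T then insert i {s \<in> T. s < i} else {s \<in> T. s < i})"
      by (auto simp: less_Suc_eq)
    then have card: "card {s \<in> T. s < Suc i} = (if i \<in> T then Suc (card {s \<in> T. s < i}) else card {s \<in> T. s < i})"
      by simp
    have half: "x div 2 ^ Suc k = x div 2 ^ k div 2" for x k :: nat
      by (metis div_mult2_eq power_Suc2)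
    have "ranked (fst (run ?body ?t)) (snd (run ?body ?t))" by (rule ranked_run[OF rk]) auto
    then show "P (Suc i) (run ?body ?t)"
      using P T unfolding P_def card by (auto simp: eval_odd less_Suc_eq half simp del: power_Suc)
  qed
  then have P: "P n (run init_com s)" using n unfolding init_com_def by simp
  then have E: "E v = (if v \<in> T then fst s rs div 2 ^ card {s \<in> T. s < v} mod 2 else 1)" if "v < n" for v
    using that unfolding P_def E_def by simp
  then show "matches E (fst s rs)" using T_subset unfolding matches_def by auto
  show "\<forall>v<n. E v \<le> 1" using E by (auto simp: One_nat_def less_Suc_eq_le[symmetric])
  show "\<forall>v\<in>rest. E v = 1" using E unfolding rest_def by auto
qed

text \<open>Sound, since \<open>rans\<close> is set only after the function itself has been checked.
  Complete, since a good \<open>F\<close> matches some \<open>i\<close>, and the search started from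
  that guess ends with no more ones than \<open>F\<close>.\<close>

lemma run_solve:
  assumes rk: "ranked (fst s) (snd s)" and sz: "sized (fst s)"
    and k: "k = (if fst s rneg \<noteq> 0 then - int (fst s rk) else int (fst s rk))"
  shows "fst (run solve_com s) rans \<noteq> 0 \<longleftrightarrow> (\<exists>f. signed_dominating G f \<and> weight G f \<le> k)"
proof -
  define good where "good F \<longleftrightarrow> (\<forall>v<n. F v \<le> 1) \<and> dominating F \<and> 2 * int (sum F {..<n}) \<le> int n + k" for F
  let ?check = "Branch (bad_exp aF) Nop (Branch excess_exp Nop (Assign rans (Num 1)))"
  let ?body = "init_com ;; search_com ;; ?check"
  let ?s = "((fst s)(rans := 0), snd s)"
  define P where "P i t \<longleftrightarrow> ranked (fst t) (snd t) \<and> sized (fst t) \<and> fst t rneg = fst s rneg \<and>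
    fst t rk = fst s rk \<and> (fst t rans \<noteq> 0 \<longrightarrow> (\<exists>F. good F)) \<and>
    (\<forall>F j. good F \<longrightarrow> j < i \<longrightarrow> matches F j \<longrightarrow> fst t rans \<noteq> 0)" for i and t :: store
  have "P (fst ?s rS) (run (For rs rS ?body) ?s)"
  proof (rule run_For_induct)
    show "P 0 ?s" unfolding P_def using ranked_cong[OF rk] sz by (simp add: sized_def)
    fix i t assume P: "P i t"
    define t0 where "t0 = ((fst t)(rs := i), snd t)"
    define t1 where "t1 = run init_com t0"
    define t2 where "t2 = run search_com t1"
    have t0: "ranked (fst t0) (snd t0)"
      using P ranked_cong unfolding P_def t0_def by fastforce
    have t1: "ranked (fst t1) (snd t1)" "sized (fst t1)"
      using P ranked_run[OF t0, of init_com] unfolding P_def t0_def t1_def sized_def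
      by (auto simp: run_frame)
    have t2: "ranked (fst t2) (snd t2)"
      using ranked_run[OF t1(1), of search_com] unfolding t2_def by simp
    have same: "fst t2 x = fst t x" if "x \<in> {rS, rS2, rL, rA, rneg, rk, rans}" for x
      using that unfolding t2_def t1_def t0_def by (auto simp: run_frame)
    note init = run_init[OF t0, folded t1_def]
    have ext: "extends (snd t1 aF) (snd t2 aF)"
      unfolding t2_def by (rule run_search_extends[OF t1(1)]) (use init(2) in \<open>simp add: extends_def\<close>)
    have gs: "graph_store G n (fst t2) (snd t2)" using t2 unfolding ranked_def by blast
    have excess: "eval excess_exp (fst t2) (snd t2) = 0 \<longleftrightarrow> 2 * int (sum (snd t2 aF) {..<n}) \<le> int n + k"
    proof -
      have "fst t2 rneg = fst s rneg" "fst t2 rk = fst s rk" using same P unfolding P_def by auto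
      then show ?thesis
        unfolding excess_exp_def eval.simps eval_total[OF gs] graph_store_n[OF gs] k
        by (cases "fst s rneg = 0") (auto simp del: of_nat_sum)
    qed
    have run: "run ?body ((fst t)(rs := i), snd t) = run ?check t2"
      unfolding t2_def t1_def t0_def by simp
    have check: "run ?check t2 = (if good (snd t2 aF) then ((fst t2)(rans := 1), snd t2) else t2)"
      using eval_bad[OF gs, of aF] excess ext unfolding good_def extends_def by auto
    have found: "good (snd t2 aF)" if F: "good F" "matches F i" for F
    proof -
      have FT: "\<forall>t\<in>T. F t = snd t1 aF t" using F(2) init(1) unfolding matches_def t0_def by simp
      \<comment> \<open>The start has the value 1 outside \<open>T\<close> and so lies above
        \<open>F\<close>; raising values preserves domination.\<close>
      have "F v \<le> snd t1 aF v" if "v < n" for v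
        using FT init(3) F(1) that unfolding good_def rest_def by (cases "v \<in> T") auto
      then have "sum F (N u) \<le> sum (snd t1 aF) (N u)" if "u < n" for u
        using N_subset[OF that] by (intro sum_mono) auto
      then have "dominating (snd t1 aF)"
        using F(1) unfolding good_def dominating_def ok_at_def
        by (metis (no_types, opaque_lifting) less_le_trans mult_le_mono2)
      then have "dominating (snd t2 aF) \<and> sum (snd t2 aF) {..<n} \<le> sum F {..<n}"
        unfolding t2_def
        by (intro run_search_optimal[OF t1, of "snd t1 aF"])
          (use init(2) F(1) FT in \<open>auto simp: extends_def good_def\<close>)
      then show ?thesis using F(1) ext unfolding good_def extends_def
        by (auto simp del: of_nat_sum)
    qed
    have "P (Suc i) (run ?check t2)"
    proof (cases "good (snd t2 aF)")
      case True
      then have "run ?check t2 = ((fst t2)(rans := 1), snd t2)" using check by simp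
      moreover have "ranked ((fst t2)(rans := 1)) (snd t2)" using ranked_cong[OF t2] by simp
      ultimately show ?thesis using True P same unfolding P_def sized_def by auto
    next
      case False
      then have "run ?check t2 = t2" using check by simp
      then show ?thesis using False P same found t2 unfolding P_def sized_def
        by (auto simp: less_Suc_eq)
    qed
    then show "P (Suc i) (run ?body ((fst t)(rs := i), snd t))" unfolding run .
  qed
  then have P: "P (2 ^ card T) (run solve_com s)" using sz unfolding solve_com_def sized_def by simp
  have "fst (run solve_com s) rans \<noteq> 0 \<longleftrightarrow> (\<exists>F. good F)"
    using P matches_exists unfolding P_def good_def by blast
  then show ?thesis unfolding signed_domination_iff good_def .
qed

end

section \<open>Decoding the input and finding a twin cover\<close>

text \<open>The length of the unary prefix, found by counting the positions with no zero bit up to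
  and including them. Register 0, the length of the word, is the only bound at hand at this
  point.\<close>

definition count_exp :: exp where
  "count_exp = SumUpto ru 0 (Cond (SumUpto rv 0 (Cond (Minus (Var rv) (Var ru)) (Num 0)
     (Cond (Arr 0 (Var rv)) (Num 0) (Num 1)))) (Num 0) (Num 1))"

text \<open>Horner's rule from the end of the word, as the least significant digit comes first. The
  loop passes over the whole word; the comparison with \<open>rq\<close>, the position of the sign
  bit, skips everything but the digits.\<close>

definition number_com :: com where
  "number_com =
     Assign rq (Plus (Plus (Var rn) (Num 1)) (SumUpto rz rn (Var rn))) ;;
     Assign rneg (Arr 0 (Var rq)) ;;
     Assign rk (Num 0) ;;
     For ri 0 (Assign rj (Minus (Minus (Var 0) (Num 1)) (Var ri)) ;;
       Branch (Minus (Var rj) (Var rq)) (Assign rk (Plus (Plus (Var rk) (Var rk)) (Arr 0 (Var rj)))) Nop)"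

definition differ_exp :: "nat \<Rightarrow> nat \<Rightarrow> exp" where
  "differ_exp u v = SumUpto rw rn (Cond (nbr_exp u rw)
     (Cond (nbr_exp v rw) (Num 0) (Num 1)) (Cond (nbr_exp v rw) (Num 1) (Num 0)))"

definition match_com :: com where
  "match_com = Branch (Cond (Arr aT (Var ru)) (Num 0) (Cond (Arr aT (Var rv)) (Num 0)
       (Cond (adj_exp ru rv) (differ_exp ru rv) (Num 0))))
     (Write aT (Var ru) (Num 1) ;; Write aT (Var rv) (Num 1)) Nop"

definition cover_com :: com where
  "cover_com = For rv rn (Write aT (Var rv) (Num 0)) ;; For ru rn (For rv rn match_com)"

text \<open>The marks of the cover are replaced by the powers of two from which the codes are
  summed; \<open>rS\<close> ends up as the number of possible codes.\<close>

definition rank_com :: com where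
  "rank_com = Assign rS (Num 1) ;;
     For rt rn (Branch (Arr aT (Var rt))
       (Write aT (Var rt) (Var rS) ;; Assign rS (Plus (Var rS) (Var rS))) Nop)"

definition double_com :: com where
  "double_com = Assign rS2 (Plus (Var rS) (Var rS)) ;; Assign rE (Plus (Var rS2) (Var rS2))"

definition pow_com :: "nat \<Rightarrow> nat \<Rightarrow> com" where
  "pow_com x y = Assign x (Num 1) ;; For rj y (Assign x (Plus (Var x) (Var x)))"

lemma run_pow:
  assumes "x \<noteq> y" "x \<noteq> rj" "y \<noteq> rj"
  shows "fst (run (pow_com x y) s) x = 2 ^ fst s y"
proof -
  let ?s = "((fst s)(x := 1), snd s)"
  have "fst (run (For rj y (Assign x (Plus (Var x) (Var x)))) ?s) x = 2 ^ fst ?s y"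
    by (rule run_For_induct[of "\<lambda>i t. fst t x = 2 ^ i"]) (use assms in auto)
  then show ?thesis using assms unfolding pow_com_def by simp
qed

text \<open>The other registers and arrays are left unconstrained: moving the input into array 0
  leaves stray bits and scratch values in them.\<close>

definition word_store :: "bool list \<Rightarrow> (nat \<Rightarrow> nat) \<Rightarrow> (nat \<Rightarrow> nat \<Rightarrow> nat) \<Rightarrow> bool" where
  "word_store w V A \<longleftrightarrow> V 0 = length w \<and> (\<forall>i<length w. A 0 i = (if w ! i then 1 else 0))"

lemma eval_count:
  assumes "word_store (replicate m True @ False # ws) V A"
  shows "eval count_exp V A = m"
proof -
  let ?w = "replicate m True @ False # ws"
  have len: "V 0 = m + 1 + length ws" using assms unfolding word_store_def by simp
  have bit: "A 0 i = (if ?w ! i then 1 else 0)" if "i < V 0" for i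
    using assms that unfolding word_store_def by simp
  have inner: "(\<Sum>j<V 0. if j - i \<noteq> 0 then 0 else if A 0 j \<noteq> 0 then 0 else 1) = (0 :: nat) \<longleftrightarrow> i < m"
    if "i < V 0" for i
  proof -
    have "(\<forall>j<V 0. j \<le> i \<longrightarrow> A 0 j \<noteq> 0) \<longleftrightarrow> i < m"
    proof
      assume "\<forall>j<V 0. j \<le> i \<longrightarrow> A 0 j \<noteq> 0"
      moreover have "A 0 m = 0" using bit[of m] len by (simp add: nth_append)
      ultimately show "i < m" using len by (metis not_le not_less_eq less_add_one add.assoc add_lessD1 linorder_not_less le_add1 order_less_le_trans)
    next
      assume "i < m"
      then show "\<forall>j<V 0. j \<le> i \<longrightarrow> A 0 j \<noteq> 0" using bit by (simp add: nth_append)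
    qed
    then show ?thesis by (auto simp: sum_eq_0_iff)
  qed
  have "eval count_exp V A =
      (\<Sum>i<V 0. if (\<Sum>j<V 0. if j - i \<noteq> 0 then 0 else if A 0 j \<noteq> 0 then 0 else 1) \<noteq> (0 :: nat) then 0 else 1)"
    unfolding count_exp_def eval.simps by (simp cong: if_cong)
  also have "\<dots> = (\<Sum>i<V 0. if i < m then 1 else 0)"
    using inner by (intro sum.cong) auto
  also have "\<dots> = m" using len by (simp add: sum.If_cases Int_absorb1 lessThan_def[symmetric] min_def)
  finally show ?thesis .
qed

lemma length_encode:
  assumes "pverts G = {..<n}"
  shows "length (encode (G, k)) = n + 1 + n * n + 1 + floorlog 2 (nat \<bar>k\<bar>)"
  using assms unfolding encode_def encode_graph_def encode_int_def Let_def by simp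

lemma encode_prefix:
  assumes "pverts G = {..<n}"
  shows "\<exists>ws. encode (G, k) = replicate n True @ False # ws"
  using assms unfolding encode_def encode_graph_def Let_def by simp

lemma encode_nth_arc:
  assumes "pverts G = {..<n}" "u < n" "v < n"
  shows "encode (G, k) ! (n + 1 + u * n + v) \<longleftrightarrow> (u, v) \<in> parcs G"
proof -
  have "u * n + v < Suc u * n" using assms by simp
  also have "Suc u * n \<le> n * n" using assms by (intro mult_le_mono1) simp
  finally have uv: "u * n + v < n * n" .
  have "List.product [0..<n] [0..<n] ! (u * n + v) = (u, v)"
    using assms uv by (simp add: product_nth)
  then show ?thesis
    using assms uv unfolding encode_def encode_graph_def Let_def by (simp add: nth_append add.assoc)
qed

lemma encode_nth_int:
  assumes "pverts G = {..<n}" "i \<le> floorlog 2 (nat \<bar>k\<bar>)"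
  shows "encode (G, k) ! (n + 1 + n * n + i) = encode_int k ! i"
  using assms unfolding encode_def encode_graph_def Let_def by (simp add: nth_append)

lemma run_number:
  assumes G: "pverts G = {..<n}" and w: "word_store (encode (G, k)) (fst s) (snd s)" and n: "fst s rn = n"
  defines "t \<equiv> run number_com s"
  shows "k = (if fst t rneg \<noteq> 0 then - int (fst t rk) else int (fst t rk))"
proof -
  define q where "q = n + 1 + n * n"
  define K where "K = nat \<bar>k\<bar>"
  define l where "l = floorlog 2 K"
  have len: "fst s 0 = q + 1 + l"
    using w length_encode[OF G] unfolding word_store_def q_def l_def K_def by simp
  have arr: "snd s 0 (q + i) = (if encode_int k ! i then 1 else 0)" if "i \<le> l" for i
    using w len encode_nth_int[OF G, of i k] that unfolding word_store_def q_def l_def K_def by simp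
  have digit: "snd s 0 (q + Suc i) = K div 2 ^ i mod 2" if "i < l" for i
  proof -
    have "encode_int k ! Suc i \<longleftrightarrow> bit \<bar>k\<bar> i"
      using that unfolding encode_int_def l_def K_def by simp
    also have "\<dots> \<longleftrightarrow> odd (K div 2 ^ i)"
      unfolding K_def by (metis abs_ge_zero bit_iff_odd bit_of_nat_iff_bit int_nat_eq nat_0_le of_nat_eq_iff)
    finally show ?thesis using arr[of "Suc i"] that by (simp add: odd_iff_mod_2_eq_one)
  qed
  let ?body = "Assign rj (Minus (Minus (Var 0) (Num 1)) (Var ri)) ;;
       Branch (Minus (Var rj) (Var rq)) (Assign rk (Plus (Plus (Var rk) (Var rk)) (Arr 0 (Var rj)))) Nop"
  define s1 where "s1 = ((fst s)(rq := q, rneg := snd s 0 q, rk := 0), snd s)"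
  \<comment> \<open>Horner's rule builds the leading parts of the binary number \<open>K\<close>.
    Truncation of \<open>l - i\<close> also covers the rounds after the last digit, which leave
    \<open>rk\<close> at \<open>K\<close>.\<close>
  define P where "P i t \<longleftrightarrow> snd t = snd s \<and> fst t 0 = fst s 0 \<and> fst t rq = q \<and>
    fst t rneg = snd s 0 q \<and> fst t rk = K div 2 ^ (l - i)" for i and t :: store
  have "P (fst s1 0) (run (For ri 0 ?body) s1)"
  proof (rule run_For_induct)
    have "K < 2 ^ l" unfolding l_def by (cases "K = 0") (auto simp: floorlog_bounds)
    then show "P 0 s1" unfolding P_def s1_def by simp
    fix i t assume i: "i < fst s1 0" and P: "P i t"
    have i': "i < q + 1 + l" using i len unfolding s1_def by simp
    show "P (Suc i) (run ?body ((fst t)(ri := i), snd t))"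
    proof (cases "i < l")
      case True
      define j where "j = l - Suc i"
      have idx: "fst s 0 - 1 - i = q + Suc j" and lj: "l - i = Suc j" and "j < l"
        using True len unfolding j_def by auto
      have "x = x div 2 + x div 2 + x mod 2" for x :: nat by presburger
      from this[of "K div 2 ^ j"] have "K div 2 ^ j = K div 2 ^ j div 2 + K div 2 ^ j div 2 + K div 2 ^ j mod 2" .
      moreover have "K div 2 ^ Suc j = K div 2 ^ j div 2" by (metis div_mult2_eq power_Suc2)
      ultimately have "K div 2 ^ j = K div 2 ^ Suc j + K div 2 ^ Suc j + snd s 0 (q + Suc j)"
        using digit[OF \<open>j < l\<close>] by argo
      then show ?thesis using P idx lj j_def unfolding P_def by simp
    next
      case False
      then have "fst s 0 - 1 - i \<le> q" using len by simp
      then show ?thesis using P False unfolding P_def by simp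
    qed
  qed
  moreover have "t = run (For ri 0 ?body) s1"
    unfolding t_def number_com_def s1_def q_def using n by simp
  ultimately have "fst t rneg = snd s 0 q" "fst t rk = K"
    using len unfolding P_def s1_def by simp_all
  moreover have "snd s 0 q = (if k < 0 then 1 else 0)"
    using arr[of 0] unfolding encode_int_def by simp
  ultimately show ?thesis unfolding K_def by simp
qed

section \<open>The twin cover obtained from a maximal matching\<close>

lemma eval_differ:
  assumes "pair_graph G" "pverts G = {..<n}" "graph_store G n V A" "V u < n" "V v < n"
    "u \<notin> {rz, rw}" "v \<notin> {rz, rw}"
  shows "eval (differ_exp u v) V A = 0 \<longleftrightarrow> closed_nbhd G (V u) = closed_nbhd G (V v)"
proof -
  have sub: "closed_nbhd G x \<subseteq> {..<n}" if "x < n" for x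
  proof -
    interpret pair_graph G by (rule assms(1))
    show ?thesis unfolding closed_nbhd_def using that wellformed(2) assms(2) by fastforce
  qed
  have nbr: "eval (nbr_exp x rw) (V(rw := i)) A \<noteq> 0 \<longleftrightarrow> i \<in> closed_nbhd G (V x)"
    if "i < n" "x \<in> {u, v}" for i x
  proof -
    have "x \<noteq> rz" "x \<noteq> rw" "V x < n" using assms(4-7) that(2) by auto
    then show ?thesis using eval_nbr[of G n "V(rw := i)" A x rw] assms(3) that(1) by simp
  qed
  have "eval (differ_exp u v) V A =
      (\<Sum>i<n. if i \<in> closed_nbhd G (V u) \<longleftrightarrow> i \<in> closed_nbhd G (V v) then 0 else 1)"
    unfolding differ_exp_def eval.simps graph_store_n[OF assms(3)]
  proof (rule sum.cong)
    fix i assume "i \<in> {..<n}"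
    then show "(if eval (nbr_exp u rw) (V(rw := i)) A \<noteq> 0
        then if eval (nbr_exp v rw) (V(rw := i)) A \<noteq> 0 then 0 else 1
        else if eval (nbr_exp v rw) (V(rw := i)) A \<noteq> 0 then 1 else 0) =
        (if i \<in> closed_nbhd G (V u) \<longleftrightarrow> i \<in> closed_nbhd G (V v) then 0 else 1 :: nat)"
      using nbr[of i u] nbr[of i v] by simp
  qed simp
  then have "eval (differ_exp u v) V A = 0 \<longleftrightarrow>
      (\<forall>i<n. i \<in> closed_nbhd G (V u) \<longleftrightarrow> i \<in> closed_nbhd G (V v))"
    by (auto simp: sum_eq_0_iff)
  then show ?thesis using sub[OF assms(4)] sub[OF assms(5)] by blast
qed

text \<open>
  The chosen vertices are the ends of a matching of edges that are not twin edges, and every twin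
  cover contains an end of each of them.
\<close>

definition half_covered :: "nat pair_pre_digraph \<Rightarrow> nat set \<Rightarrow> bool" where
  "half_covered G C \<longleftrightarrow> finite C \<and> (\<forall>T. twin_cover G T \<longrightarrow> card C \<le> 2 * card (C \<inter> T))"

lemma half_covered_insert:
  assumes "half_covered G C" "(u, v) \<in> parcs G" "u \<noteq> v" "u \<notin> C" "v \<notin> C"
    and "closed_nbhd G u \<noteq> closed_nbhd G v"
  shows "half_covered G (insert u (insert v C))"
  unfolding half_covered_def
proof (intro conjI allI impI)
  show "finite (insert u (insert v C))" using assms(1) unfolding half_covered_def by simp
  fix T assume T: "twin_cover G T"
  have fin: "finite C" and le: "card C \<le> 2 * card (C \<inter> T)"
    using assms(1) T unfolding half_covered_def by auto
  have "u \<in> T \<or> v \<in> T" using T assms(2,6) unfolding twin_cover_def twin_edge_def by blast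
  then obtain x where "x \<in> {u, v}" "x \<in> T" by blast
  then have "insert x (C \<inter> T) \<subseteq> insert u (insert v C) \<inter> T" "x \<notin> C" using assms(4,5) by auto
  then have "card (insert x (C \<inter> T)) \<le> card (insert u (insert v C) \<inter> T)"
    using fin by (intro card_mono) auto
  then have "Suc (card (C \<inter> T)) \<le> card (insert u (insert v C) \<inter> T)"
    using fin \<open>x \<notin> C\<close> by simp
  moreover have "card (insert u (insert v C)) = card C + 2" using fin assms(3-5) by simp
  ultimately show "card (insert u (insert v C)) \<le> 2 * card (insert u (insert v C) \<inter> T)"
    using le by simp
qed

lemma run_cover:
  assumes "pair_graph G" "pverts G = {..<n}" "graph_store G n (fst s) (snd s)"
  defines "A \<equiv> snd (run cover_com s) aT"
  defines "C \<equiv> {v. v < n \<and> A v \<noteq> 0}"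
  shows "twin_cover G C" "half_covered G C"
proof -
  interpret pair_graph G by (rule assms(1))
  define ch where "ch t = {v. v < n \<and> snd t aT v \<noteq> 0}" for t :: store
  \<comment> \<open>\<open>E\<close> is the set of pairs already visited. Their coverage is never
    lost, because \<open>ch\<close> only grows; once all pairs are visited, it says that the
    matching is maximal.\<close>
  define P where "P E t \<longleftrightarrow> graph_store G n (fst t) (snd t) \<and> half_covered G (ch t) \<and>
    (\<forall>(u, v)\<in>E. u \<in> ch t \<or> v \<in> ch t \<or> (u, v) \<notin> parcs G \<or> closed_nbhd G u = closed_nbhd G v)"
    for E and t :: store
  have P_upd: "P E ((fst t)(x := i), snd t)" if "P E t" "x \<noteq> rn" for E t x i
    using that unfolding P_def ch_def by simp
  have match: "P (insert (u, v) E) (run match_com t)"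
    if P: "P E t" and uv: "fst t ru = u" "fst t rv = v" "u < n" "v < n" for E t u v
  proof -
    have gs: "graph_store G n (fst t) (snd t)" using P unfolding P_def by blast
    let ?e = "Cond (Arr aT (Var ru)) (Num 0) (Cond (Arr aT (Var rv)) (Num 0)
       (Cond (adj_exp ru rv) (differ_exp ru rv) (Num 0)))"
    have e: "eval ?e (fst t) (snd t) \<noteq> 0 \<longleftrightarrow> u \<notin> ch t \<and> v \<notin> ch t \<and> (u, v) \<in> parcs G \<and>
        closed_nbhd G u \<noteq> closed_nbhd G v"
      using eval_adj[OF gs, of ru rv] eval_differ[OF assms(1,2) gs, of ru rv] uv
      unfolding ch_def by auto
    show ?thesis
    proof (cases "eval ?e (fst t) (snd t) \<noteq> 0")
      case True
      then have run: "run match_com t = (fst t, (snd t)(aT := (snd t aT)(u := 1, v := 1)))"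
        unfolding match_com_def using uv by simp
      have ch: "ch (run match_com t) = insert u (insert v (ch t))"
        using uv(3,4) unfolding run ch_def by auto
      have "u \<noteq> v" using True e no_loops[of "(u, u)"] by auto
      then have "half_covered G (ch (run match_com t))"
        unfolding ch using half_covered_insert P True e unfolding P_def by blast
      moreover have "graph_store G n (fst (run match_com t)) (snd (run match_com t))"
        using gs unfolding run graph_store_def by simp
      ultimately show ?thesis using P unfolding P_def ch by auto
    next
      case False
      then have "run match_com t = t" unfolding match_com_def by simp
      then show ?thesis using P e False unfolding P_def by auto
    qed
  qed
  have w: "writes match_com = {}" unfolding match_com_def by simp
  have inner: "P (E \<union> {u} \<times> {..<n}) (run (For rv rn match_com) t)"
    if P: "P E t" and u: "fst t ru = u" "u < n" for E t u
  proof -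
    have tn: "fst t rn = n" using P graph_store_n unfolding P_def by blast
    have "P (E \<union> {u} \<times> {..<fst t rn}) (run (For rv rn match_com) t) \<and> fst (run (For rv rn match_com) t) ru = u"
    proof (rule run_For_induct[of "\<lambda>i t. P (E \<union> {u} \<times> {..<i}) t \<and> fst t ru = u"])
      fix i t' assume i: "i < fst t rn" and P: "P (E \<union> {u} \<times> {..<i}) t' \<and> fst t' ru = u"
      let ?t = "((fst t')(rv := i), snd t')"
      have "P (insert (u, i) (E \<union> {u} \<times> {..<i})) (run match_com ?t)"
        by (rule match) (use P_upd[of _ t' rv] P i u tn in auto)
      moreover have "insert (u, i) (E \<union> {u} \<times> {..<i}) = E \<union> {u} \<times> {..<Suc i}"
        by (auto simp: less_Suc_eq)
      ultimately show "P (E \<union> {u} \<times> {..<Suc i}) (run match_com ?t) \<and> fst (run match_com ?t) ru = u"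
        using P w by (simp add: run_frame)
    qed (use P u in auto)
    then show ?thesis using tn by simp
  qed
  define s1 where "s1 = run (For rv rn (Write aT (Var rv) (Num 0))) s"
  have n: "fst s rn = n" using assms(3) graph_store_n by blast
  have s1n: "fst s1 rn = n" unfolding s1_def using n by (simp add: run_frame)
  have "\<forall>v<fst s rn. snd s1 aT v = 0"
    unfolding s1_def by (rule run_For_induct[of "\<lambda>i t. \<forall>v<i. snd t aT v = 0"]) (auto simp: less_Suc_eq)
  then have "ch s1 = {}" using n unfolding ch_def by auto
  moreover have "graph_store G n (fst s1) (snd s1)"
    using assms(3) s1n unfolding graph_store_def s1_def by (simp add: run_array_frame)
  ultimately have P0: "P {} s1" unfolding P_def half_covered_def by simp
  have "P ({..<fst s1 rn} \<times> {..<n}) (run (For ru rn (For rv rn match_com)) s1)"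
  proof (rule run_For_induct[of "\<lambda>i t. P ({..<i} \<times> {..<n}) t"])
    fix i t assume i: "i < fst s1 rn" and P: "P ({..<i} \<times> {..<n}) t"
    have "P ({..<i} \<times> {..<n} \<union> {i} \<times> {..<n}) (run (For rv rn match_com) ((fst t)(ru := i), snd t))"
      by (rule inner[OF P_upd[OF P]]) (use i s1n in auto)
    moreover have "{..<i} \<times> {..<n} \<union> {i} \<times> {..<n} = {..<Suc i} \<times> {..<n}" by (auto simp: less_Suc_eq)
    ultimately show "P ({..<Suc i} \<times> {..<n}) (run (For rv rn match_com) ((fst t)(ru := i), snd t))"
      by simp
  qed (use P0 in simp)
  then have P: "P ({..<n} \<times> {..<n}) (run cover_com s)"
    using s1n unfolding cover_com_def s1_def by simp
  have C: "C = ch (run cover_com s)" unfolding C_def A_def ch_def by simp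
  show "half_covered G C" using P unfolding C P_def by simp
  show "twin_cover G C"
    unfolding twin_cover_def
  proof (intro conjI)
    show "C \<subseteq> pverts G" unfolding C_def assms(2) by auto
    show "\<forall>(u, v)\<in>parcs G. twin_edge G u v \<or> u \<in> C \<or> v \<in> C"
    proof clarify
      fix u v assume uv: "(u, v) \<in> parcs G" "v \<notin> C" "\<not> twin_edge G u v"
      then have "u < n" "v < n" using wellformed[of "(u, v)"] assms(2) by auto
      then show "u \<in> C"
        using P uv unfolding C P_def twin_edge_def by fastforce
    qed
  qed
qed

lemma run_cover_le:
  assumes "graph_store G n (fst s) (snd s)" "v < n"
  shows "snd (run cover_com s) aT v \<le> 1"
proof -
  define P where "P t \<longleftrightarrow> (\<forall>v<n. snd t aT v \<le> 1)" for t :: store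
  define s1 where "s1 = run (For rv rn (Write aT (Var rv) (Num 0))) s"
  have "\<forall>v<fst s rn. snd s1 aT v = 0"
    unfolding s1_def by (rule run_For_induct[of "\<lambda>i t. \<forall>v<i. snd t aT v = 0"]) (auto simp: less_Suc_eq)
  then have "P s1" using graph_store_n[OF assms(1)] unfolding P_def by simp
  moreover have match: "P (run match_com t)" if "P t" for t
    using that unfolding P_def match_com_def by simp
  have inner: "P (run (For rv rn match_com) t)" if "P t" for t
    by (rule run_For_induct[of "\<lambda>_. P"]) (use that match in \<open>auto simp: P_def\<close>)
  have "P (run (For ru rn (For rv rn match_com)) s1)"
    by (rule run_For_induct[of "\<lambda>_. P"]) (use \<open>P s1\<close> inner in \<open>auto simp: P_def\<close>)
  then show ?thesis using assms(2) unfolding P_def cover_com_def s1_def by simp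
qed

lemma run_rank:
  assumes "twin_covered_graph G n T" "graph_store G n (fst s) (snd s)"
    and "\<And>v. v < n \<Longrightarrow> snd s aT v \<noteq> 0 \<longleftrightarrow> v \<in> T" "\<And>v. v < n \<Longrightarrow> snd s aT v \<le> 1"
  shows "twin_covered_graph.ranked G n T (fst (run rank_com s)) (snd (run rank_com s))"
    "fst (run rank_com s) rS = 2 ^ card T"
proof -
  interpret twin_covered_graph G n T by (rule assms(1))
  let ?body = "Branch (Arr aT (Var rt))
       (Write aT (Var rt) (Var rS) ;; Assign rS (Plus (Var rS) (Var rS))) Nop"
  let ?s = "((fst s)(rS := 1), snd s)"
  have n: "fst s rn = n" using assms(2) graph_store_n by blast
  define P where "P i t \<longleftrightarrow> graph_store G n (fst t) (snd t) \<and> fst t rS = 2 ^ card {s \<in> T. s < i} \<and>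
    (\<forall>v<n. snd t aT v = (if v < i then if v \<in> T then 2 ^ card {s \<in> T. s < v} else 0 else snd s aT v))"
    for i and t :: store
  have "P (fst ?s rn) (run (For rt rn ?body) ?s)"
  proof (rule run_For_induct)
    show "P 0 ?s" unfolding P_def using assms(2) by simp
    fix i t assume i: "i < fst ?s rn" and P: "P i t"
    have T: "snd t aT i \<noteq> 0 \<longleftrightarrow> i \<in> T" using P i n assms(3)[of i] unfolding P_def by simp
    have "{s \<in> T. s < Suc i} = (if i \<in> T then insert i {s \<in> T. s < i} else {s \<in> T. s < i})"
      by (auto simp: less_Suc_eq)
    then have card: "card {s \<in> T. s < Suc i} = (if i \<in> T then Suc (card {s \<in> T. s < i}) else card {s \<in> T. s < i})"
      by simp
    show "P (Suc i) (run ?body ((fst t)(rt := i), snd t))"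
      using P T assms(3)[of i] unfolding P_def card by (auto simp: graph_store_def less_Suc_eq)
  qed
  then have P: "P n (run rank_com s)" using n unfolding rank_com_def by simp
  moreover have "{s \<in> T. s < n} = T" using T_subset by auto
  ultimately show "ranked (fst (run rank_com s)) (snd (run rank_com s))"
    "fst (run rank_com s) rS = 2 ^ card T"
    unfolding ranked_def P_def by auto
qed

section \<open>Running time\<close>

text \<open>\<open>X\<close> is at least 1 so that powers with different exponents can be raised to
  a common one.\<close>

definition poly_bounded :: "(nat \<Rightarrow> nat) \<Rightarrow> bool" where
  "poly_bounded f \<longleftrightarrow> (\<exists>K D. \<forall>X\<ge>1. f X \<le> K * X ^ D)"

lemma poly_bounded_const: "poly_bounded (\<lambda>_. c)"
  unfolding poly_bounded_def by (intro exI[of _ c] exI[of _ 0]) simp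

lemma poly_bounded_add:
  assumes "poly_bounded f" "poly_bounded g"
  shows "poly_bounded (\<lambda>X. f X + g X)"
proof -
  obtain K D where f: "\<And>X. X \<ge> 1 \<Longrightarrow> f X \<le> K * X ^ D" using assms(1) unfolding poly_bounded_def by blast
  obtain L E where g: "\<And>X. X \<ge> 1 \<Longrightarrow> g X \<le> L * X ^ E" using assms(2) unfolding poly_bounded_def by blast
  have "f X + g X \<le> (K + L) * X ^ (D + E)" if "X \<ge> 1" for X
  proof -
    have "X ^ D \<le> X ^ (D + E)" "X ^ E \<le> X ^ (D + E)" using that by (simp_all add: power_increasing)
    then have "K * X ^ D + L * X ^ E \<le> K * X ^ (D + E) + L * X ^ (D + E)"
      by (intro add_mono mult_le_mono2)
    then show ?thesis using f[OF that] g[OF that] by (simp add: distrib_right)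
  qed
  then show ?thesis unfolding poly_bounded_def by blast
qed

lemma poly_bounded_times:
  assumes "poly_bounded f"
  shows "poly_bounded (\<lambda>X. X * f X)"
proof -
  obtain K D where f: "\<And>X. X \<ge> 1 \<Longrightarrow> f X \<le> K * X ^ D" using assms unfolding poly_bounded_def by blast
  have "X * f X \<le> K * X ^ Suc D" if "X \<ge> 1" for X
    using mult_le_mono2[OF f[OF that], of X] by (simp add: mult_ac)
  then show ?thesis unfolding poly_bounded_def by blast
qed

lemma poly_bounded_eval_time: "poly_bounded (eval_time e)"
proof (induction e)
  case (SumUpto x r e)
  then show ?case
    using poly_bounded_add[OF poly_bounded_times[OF poly_bounded_add[OF _ poly_bounded_const]]
        poly_bounded_const] by simp
qed (simp_all add: poly_bounded_add poly_bounded_const del: add_2_eq_Suc add_2_eq_Suc')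

lemma poly_bounded_run_time: "poly_bounded (run_time c)"
proof (induction c)
  case (For x r c)
  then show ?case
    using poly_bounded_add[OF poly_bounded_times[OF poly_bounded_add[OF _ poly_bounded_const]]
        poly_bounded_const] by simp
qed (simp_all add: poly_bounded_add poly_bounded_const poly_bounded_eval_time
  del: add_2_eq_Suc add_2_eq_Suc')

definition performs :: "nat \<Rightarrow> com \<Rightarrow> store \<Rightarrow> nat \<Rightarrow> bool" where
  "performs d c s T \<longleftrightarrow>
     (\<forall>\<sigma>. represents d \<sigma> s \<longrightarrow> (\<exists>\<sigma>'. runs (compile c d) \<sigma> T \<sigma>' \<and> represents d \<sigma>' (run c s)))"

text \<open>A command that computes bounds for its own later loops is not static. Such programs are
  cut into static pieces, and the time of each piece is bounded through the register values at its
  start.\<close>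

definition static :: "nat \<Rightarrow> com \<Rightarrow> bool" where
  "static d c \<longleftrightarrow> well_formed d c \<and> writes c \<inter> for_bounds c = {}"

lemma performs_static:
  assumes "static d c" "\<And>r. r \<in> for_bounds c \<Longrightarrow> fst s r \<le> X"
  shows "performs d c s (run_time c X)"
  using assms compile_correct unfolding performs_def static_def by blast

lemma performs_Comp:
  assumes "performs d c s T" "performs d c' (run c s) U"
  shows "performs d (c ;; c') s (T + U)"
  unfolding performs_def
proof (intro allI impI)
  fix \<sigma> assume "represents d \<sigma> s"
  then obtain \<tau> where \<tau>: "runs (compile c d) \<sigma> T \<tau>" "represents d \<tau> (run c s)"
    using assms(1) unfolding performs_def by blast
  then obtain \<upsilon> where "runs (compile c' d) \<tau> U \<upsilon>" "represents d \<upsilon> (run c' (run c s))"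
    using assms(2) unfolding performs_def by blast
  then have "runs (compile (c ;; c') d) \<sigma> (T + U) \<upsilon> \<and> represents d \<upsilon> (run (c ;; c') s)"
    using runs_Seq[OF \<tau>(1)] by simp
  then show "\<exists>\<sigma>'. runs (compile (c ;; c') d) \<sigma> (T + U) \<sigma>' \<and> represents d \<sigma>' (run (c ;; c') s)" by blast
qed

text \<open>For computability any time bound will do, and the sum of the registers below
  \<open>d\<close> is at least each loop bound.\<close>

lemma performs_static_ex: "static d c \<Longrightarrow> \<exists>T. performs d c s T"
proof -
  assume c: "static d c"
  have "fst s r \<le> (\<Sum>r<d. fst s r)" if "r \<in> for_bounds c" for r
    using for_bounds_less[OF _ that, of d] c unfolding static_def by (intro member_le_sum) auto
  then show ?thesis using performs_static[OF c] by blast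
qed

lemma performs_Comp_ex:
  "\<exists>T. performs d c s T \<Longrightarrow> \<exists>T. performs d c' (run c s) T \<Longrightarrow> \<exists>T. performs d (c ;; c') s T"
  using performs_Comp by blast

lemma represents_self: "represents d (R, M) (R, unpack M)"
  unfolding represents_def by simp

lemma computable_com:
  assumes "\<And>s. \<exists>T. performs d c s T" "0 < d"
    and "\<And>A n. fst (run c ((\<lambda>_. 0)(0 := n), A)) 0 = g n"
  shows "computable g"
  unfolding computable_def
proof (rule exI, rule allI)
  fix n :: nat
  let ?s = "((\<lambda>_. 0)(0 := n), unpack (\<lambda>_. 0))"
  obtain T where "performs d c ?s T" using assms(1) by blast
  moreover have "represents d (number_input n) ?s"
    unfolding number_input_def by (rule represents_self)
  ultimately obtain \<sigma> where \<sigma>: "runs (compile c d) (number_input n) T \<sigma>" "represents d \<sigma> (run c ?s)"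
    unfolding performs_def by blast
  then have "result \<sigma> = g n"
    using assms(2,3) unfolding result_def represents_def by auto
  with \<sigma>(1) show "\<exists>t s. exec (compile c d) (number_input n) t s \<and> result s = g n"
    unfolding runs_def by blast
qed

text \<open>The value of \<open>rA\<close> for a twin cover of \<open>2 * p\<close> vertices, the
  most that the matching can yield if the minimum is \<open>p\<close>.\<close>

definition advice_bound :: "nat \<Rightarrow> nat" where
  "advice_bound p = 2 ^ 2 ^ (4 * 2 ^ (2 * p))"

text \<open>The exponent does not depend on the input, so the \<open>D\<close> multiplications are
  unrolled, each of them being a sum of \<open>rA\<close> equal terms.\<close>

primrec power_com :: "nat \<Rightarrow> com" where
  "power_com 0 = Nop"
| "power_com (Suc D) = Assign rS (SumUpto rz rA (Var rS)) ;; power_com D"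

lemma run_power: "fst (run (power_com D) s) rS = fst s rS * fst s rA ^ D"
  by (induction D arbitrary: s) (simp_all add: mult_ac)

lemma static_power: "static 25 (power_com D)"
proof (induction D)
  case (Suc D)
  have "writes (power_com D) \<subseteq> {rS}" "for_bounds (power_com D) \<subseteq> {rA}" for D
    by (induction D) auto
  then show ?case using Suc unfolding static_def by fastforce
qed (simp add: static_def)

lemma computable_advice_bound: "computable (\<lambda>p. K * advice_bound p ^ D)"
proof (rule computable_com)
  \<comment> \<open>The composition is cut wherever a register just computed becomes a loop bound,
    so that each part is static.\<close>
  let ?c1 = "Assign rn (Plus (Var 0) (Var 0))" and ?c2 = "pow_com rS rn ;; double_com"
  let ?c3 = "pow_com rQ rE" and ?c4 = "pow_com rA rQ ;; Assign rS (Num K)"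
  let ?c5 = "Assign 0 (Var rS)"
  let ?c = "?c1 ;; ?c2 ;; ?c3 ;; ?c4 ;; power_com D ;; ?c5"
  show "\<exists>T. performs 25 ?c s T" for s
    by (intro performs_Comp_ex performs_static_ex static_power)
      (simp_all add: static_def pow_com_def double_com_def)
  show "fst (run ?c ((\<lambda>_. 0)(0 := n), A)) 0 = K * advice_bound n ^ D" for A n
  proof -
    have w: "writes (pow_com x y) = {x, rj}" for x y unfolding pow_com_def by auto
    have four: "x + x + (x + x) = 4 * x" for x :: nat by simp
    show ?thesis
      by (simp add: four run_power run_pow run_frame w double_com_def advice_bound_def mult_2)
  qed
qed simp

definition spread :: program where
  "spread = Seq (Seq (Const 1 0) (Add 1 0 1)) (Seq (Const 4 1)
     (Whilenz 1 (Seq (Sub 1 1 4) (Seq (Load 3 1) (Seq (Add 2 1 1) (Seq (Add 2 2 2) (Store 2 3)))))))"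

text \<open>
  The input is moved to array \<open>0\<close>, that is, to the cells \<open>0, 4, 8, \<dots>\<close>, starting from its end so
  that no cell is overwritten before it is read.
\<close>

lemma runs_spread:
  "\<exists>R M. runs spread (word_input w) (6 * length w + 4) (R, M) \<and> word_store w R (unpack M)"
proof -
  define b where "b i = (if i < length w \<and> w ! i then 1 else 0 :: nat)" for i
  let ?R0 = "(\<lambda>_. 0)(0 := length w) :: nat \<Rightarrow> nat"
  let ?R1 = "?R0(1 := length w)" let ?R2 = "?R1(4 := 1)"
  let ?body = "Seq (Sub 1 1 4) (Seq (Load 3 1) (Seq (Add 2 1 1) (Seq (Add 2 2 2) (Store 2 3))))"
  define Inv where "Inv i \<sigma> \<longleftrightarrow> fst \<sigma> 0 = length w \<and> fst \<sigma> 4 = 1 \<and>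
    (\<forall>j<length w. snd \<sigma> (if j < length w - i then j else 4 * j) = b j)" for i and \<sigma> :: state
  have "\<exists>\<sigma>. runs (Whilenz 1 ?body) (?R2, b) (length w * ((1 + (1 + (1 + (1 + 1)))) + 1) + 1) \<sigma> \<and>
    Inv (length w) \<sigma>"
  proof (rule runs_Whilenz)
    show "Inv 0 (?R2, b)" unfolding Inv_def by simp
    show "fst (?R2, b) 1 = length w" by simp
    fix i \<sigma> assume i: "i < length w" and inv: "Inv i \<sigma>" and ctr: "fst \<sigma> 1 = length w - i"
    obtain R M where \<sigma>: "\<sigma> = (R, M)" by force
    define c where "c = length w - Suc i"
    have c: "length w - i = Suc c" using i unfolding c_def by simp
    have R: "R 0 = length w" "R 4 = 1" "R 1 = Suc c"
      and M: "\<forall>j<length w. M (if j < Suc c then j else 4 * j) = b j"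
      using inv ctr unfolding Inv_def \<sigma> c by simp_all
    let ?S1 = "R(1 := R 1 - R 4)" let ?S2 = "?S1(3 := M (?S1 1))" let ?S3 = "?S2(2 := ?S2 1 + ?S2 1)"
    let ?S4 = "?S3(2 := ?S3 2 + ?S3 2)"
    have S4: "?S4 0 = length w" "?S4 4 = 1" "?S4 1 = c" "?S4 2 = 4 * c" "?S4 3 = M c"
      using R by simp_all
    have "runs ?body \<sigma> (1 + (1 + (1 + (1 + 1)))) (?S4, M(?S4 2 := ?S4 3))"
      unfolding \<sigma> by (intro runs_Seq[OF runs_basic(3)] runs_Seq[OF runs_basic(5)]
          runs_Seq[OF runs_basic(2)] runs_basic(6))
    moreover have "(M(4 * c := M c)) (if j < c then j else 4 * j) = b j" if "j < length w" for j
      using M[rule_format, OF that] by (cases j c rule: linorder_cases) auto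
    then have "Inv (Suc i) (?S4, M(?S4 2 := ?S4 3))"
      unfolding Inv_def fst_conv snd_conv S4 c_def[symmetric] by simp
    ultimately show "\<exists>\<sigma>'. runs ?body \<sigma> (1 + (1 + (1 + (1 + 1)))) \<sigma>' \<and>
      Inv (Suc i) \<sigma>' \<and> fst \<sigma>' 1 = length w - Suc i"
      using S4(3) unfolding c_def by (intro exI[of _ "(?S4, M(?S4 2 := ?S4 3))"]) simp
  qed
  then obtain R M where RM: "runs (Whilenz 1 ?body) (?R2, b)
    (length w * ((1 + (1 + (1 + (1 + 1)))) + 1) + 1) (R, M)" "Inv (length w) (R, M)" by auto
  have 1: "runs (Seq (Const 1 0) (Add 1 0 1)) (?R0, b) (1 + 1) (?R1, b)"
    using runs_Seq[OF runs_basic(1)[of 1 0 ?R0 b] runs_basic(2)[of 1 0 1]] by simp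
  have "word_input w = (?R0, b)" unfolding word_input_def b_def by simp
  then have "runs spread (word_input w)
     (1 + 1 + (1 + (length w * ((1 + (1 + (1 + (1 + 1)))) + 1) + 1))) (R, M)"
    unfolding spread_def by (simp only:) (intro runs_Seq[OF 1] runs_Seq[OF runs_basic(1)] RM(1))
  then have "runs spread (word_input w) (6 * length w + 4) (R, M)" by (rule runs_mono) simp
  moreover have "word_store w R (unpack M)"
    using RM(2) unfolding Inv_def word_store_def b_def unpack_def by simp
  ultimately show ?thesis by blast
qed

section \<open>The solver, cut into stages with fixed loop bounds\<close>

definition stage1 :: com where
  "stage1 = Assign rn count_exp"

definition stage2 :: com where
  "stage2 = number_com ;; cover_com ;; rank_com ;; double_com"

definition stage3 :: com where
  "stage3 = pow_com rL rS ;; pow_com rQ rE"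

definition stage4 :: com where
  "stage4 = pow_com rA rQ"

definition stage5 :: com where
  "stage5 = solve_com ;; Assign 0 (Var rans)"

lemmas stage_defs = stage1_def stage2_def stage3_def stage4_def stage5_def com_defs exp_defs
  count_exp_def number_com_def cover_com_def match_com_def differ_exp_def rank_com_def double_com_def
  pow_com_def

lemma static_stage:
  "static 25 stage1" "static 25 stage2" "static 25 stage3" "static 25 stage4" "static 25 stage5"
  unfolding static_def stage_defs by (simp_all del: One_nat_def)

lemma for_bounds_stage:
  "for_bounds stage1 \<subseteq> {0}" "for_bounds stage2 \<subseteq> {0, rn}" "for_bounds stage3 \<subseteq> {rS, rE}"
  "for_bounds stage4 \<subseteq> {rQ}" "for_bounds stage5 \<subseteq> {rn, rS, rS2, rL, rA}"
  unfolding stage_defs by simp_all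

definition solver :: com where
  "solver = stage1 ;; stage2 ;; stage3 ;; stage4 ;; stage5"

text \<open>Some loop bounds depend on the parameter and others on the input length; as both factors
  are at least 1, the product \<open>X\<close> bounds them all.\<close>

lemma solver_correct:
  assumes inst: "(G, k) \<in> instances" and w: "word_store (encode (G, k)) (fst s) (snd s)"
  defines "X \<equiv> advice_bound (twin_cover_number G) * length (encode (G, k))"
  shows "fst (run solver s) 0 \<noteq> 0 \<longleftrightarrow> (G, k) \<in> signed_domination"
    and "performs 25 solver s (run_time solver X)"
proof -
  obtain n where G: "pair_graph G" and n: "pverts G = {..<n}" using inst unfolding instances_def by blast
  define s1 where "s1 = run stage1 s"
  define a where "a = run number_com s1"
  define b where "b = run cover_com a"
  define c where "c = run rank_com b"
  define s2 where "s2 = run double_com c"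
  define s3 where "s3 = run stage3 s2"
  define s4 where "s4 = run stage4 s3"
  have s2_run: "s2 = run stage2 s1" unfolding s2_def c_def b_def a_def stage2_def by simp
  have "\<exists>ws. encode (G, k) = replicate n True @ False # ws" using encode_prefix[OF n] .
  then have s1: "fst s1 rn = n" "fst s1 0 = length (encode (G, k))" "snd s1 = snd s"
    using w eval_count[of n _ "fst s" "snd s"] unfolding s1_def stage1_def word_store_def by auto
  have w1: "word_store (encode (G, k)) (fst s1) (snd s1)" using w s1 unfolding word_store_def by simp
  note kval = run_number[OF n w1 s1(1), folded a_def]
  have gs1: "graph_store G n (fst s1) (snd s1)"
    unfolding graph_store_def
  proof (intro conjI allI impI)
    fix u v assume uv: "u < n" "v < n"
    have "u * n + v < Suc u * n" using uv by simp
    also have "Suc u * n \<le> n * n" using uv by (intro mult_le_mono1) simp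
    finally have "n + 1 + u * n + v < length (encode (G, k))" using length_encode[OF n] by simp
    then show "snd s1 0 (n + 1 + u * n + v) \<noteq> 0 \<longleftrightarrow> (u, v) \<in> parcs G"
      using w1 encode_nth_arc[OF n uv] unfolding word_store_def by simp
  qed (rule s1(1))
  have gsa: "graph_store G n (fst a) (snd a)"
    using gs1 unfolding graph_store_def a_def by (simp add: run_frame run_array_frame number_com_def)
  define T where "T = {v. v < n \<and> snd b aT v \<noteq> 0}"
  have T: "twin_cover G T" "half_covered G T"
    using run_cover[OF G n gsa] unfolding T_def b_def by simp_all
  interpret twin_covered_graph G n T using G n T(1) by (rule twin_covered_graph.intro)
  have le1: "snd b aT v \<le> 1" if "v < n" for v
    using run_cover_le[OF gsa that] unfolding b_def .
  have gsb: "graph_store G n (fst b) (snd b)"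
    using gsa unfolding graph_store_def b_def
    by (simp add: run_frame run_array_frame cover_com_def match_com_def)
  have rc: "ranked (fst c) (snd c)" "fst c rS = 2 ^ card T"
    using run_rank[OF twin_covered_graph_axioms gsb] le1 unfolding T_def c_def by auto
  have wr: "writes (pow_com x y) = {x, rj}" "array_writes (pow_com x y) = {}" for x y
    unfolding pow_com_def by auto
  have S: "fst s2 rS = 2 ^ card T" "fst s2 rS2 = 2 * 2 ^ card T" "fst s2 rE = 4 * 2 ^ card T"
    using rc(2) unfolding s2_def double_com_def by simp_all
  have L: "fst s3 rL = 2 ^ 2 ^ card T" "fst s3 rQ = 2 ^ (4 * 2 ^ card T)"
    using S unfolding s3_def stage3_def by (simp_all add: run_pow run_frame wr)
  have A: "fst s4 rA = 2 ^ 2 ^ (4 * 2 ^ card T)"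
    using L unfolding s4_def stage4_def by (simp add: run_pow)
  have frame4: "fst s4 x = fst s2 x" if "x \<notin> {rL, rQ, rA, rj}" for x
    using that unfolding s4_def s3_def stage3_def stage4_def by (simp add: run_frame wr)
  have L4: "fst s4 rL = 2 ^ 2 ^ card T"
    using L unfolding s4_def stage4_def by (simp add: run_frame wr)
  have sz: "sized (fst s4)" unfolding sized_def using S A L4 frame4[of rS] frame4[of rS2] by simp
  have rk2: "ranked (fst s2) (snd s2)"
    unfolding s2_def by (rule ranked_run[OF rc(1)]) (simp_all add: double_com_def)
  have rk4: "ranked (fst s4) (snd s4)"
    unfolding s4_def s3_def stage3_def stage4_def
    by (intro ranked_run rk2) (simp_all add: wr)
  have "fst s4 x = fst a x" if "x \<in> {rneg, rk}" for x
    using that frame4[of x] unfolding s2_def c_def b_def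
    by (auto simp: run_frame double_com_def rank_com_def cover_com_def match_com_def)
  then have "k = (if fst s4 rneg \<noteq> 0 then - int (fst s4 rk) else int (fst s4 rk))"
    using kval by simp
  from run_solve[OF rk4 sz this]
  have solve: "fst (run solve_com s4) rans \<noteq> 0 \<longleftrightarrow> (G, k) \<in> signed_domination"
    using inst unfolding signed_domination_def by blast
  have solver: "run solver s = run stage5 s4"
    unfolding solver_def s4_def s3_def s2_run s1_def by simp
  show "fst (run solver s) 0 \<noteq> 0 \<longleftrightarrow> (G, k) \<in> signed_domination"
    unfolding solver stage5_def using solve by simp
  let ?len = "length (encode (G, k))"
  let ?B = "advice_bound (twin_cover_number G)"
  obtain T0 where T0: "twin_cover G T0" "card T0 = twin_cover_number G"
    using twin_cover_number_attained[OF G] .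
  have "finite T0" using T0(1) n finite_subset[of T0 "{..<n}"] unfolding twin_cover_def by simp
  then have "card (T \<inter> T0) \<le> card T0" by (intro card_mono) auto
  moreover have "card T \<le> 2 * card (T \<inter> T0)" using T(2) T0(1) unfolding half_covered_def by blast
  \<comment> \<open>\<open>T\<close> is compared with a minimum cover \<open>T0\<close>, which
    contains an end of each of the disjoint edges whose ends make up \<open>T\<close>.\<close>
  ultimately have m: "card T \<le> 2 * twin_cover_number G" using T0(2) by simp
  define S where "S = (2 :: nat) ^ card T"
  have "4 * S \<le> 4 * 2 ^ (2 * twin_cover_number G)"
    unfolding S_def using m by (intro mult_le_mono2 power_increasing) auto
  then have AB: "2 ^ 2 ^ (4 * S) \<le> ?B"
    unfolding advice_bound_def by (intro power_increasing) auto
  \<comment> \<open>Applied repeatedly, this puts the other bounds that depend on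
    \<open>card T\<close> below the number of advice values.\<close>
  have grow: "x \<le> 2 ^ x" for x :: nat by (simp add: less_imp_le)
  have QB: "2 ^ (4 * S) \<le> ?B" using grow[of "2 ^ (4 * S)"] AB by linarith
  have SB: "4 * S \<le> ?B" using grow[of "4 * S"] QB by linarith
  have "(2 :: nat) ^ S \<le> 2 ^ (4 * S)" by (intro power_increasing) auto
  then have LB: "2 ^ S \<le> ?B" using QB by linarith
  have len: "n + 1 \<le> ?len" using length_encode[OF n, of k] by simp
  have lenX: "?len \<le> X" unfolding X_def advice_bound_def by simp
  have BX: "?B \<le> X" unfolding X_def using len by (cases ?len) auto
  have fs2: "fst s2 rn = n" "fst s2 0 = ?len"
    using s1 unfolding s2_def c_def b_def a_def
    by (simp_all add: run_frame double_com_def rank_com_def cover_com_def match_com_def number_com_def)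
  have fs4: "fst s4 rn = n" using fs2(1) frame4[of rn] by simp
  have "performs 25 stage1 s (run_time stage1 X)"
    by (rule performs_static[OF static_stage(1)])
      (use for_bounds_stage(1) w lenX in \<open>auto simp: word_store_def\<close>)
  moreover have "performs 25 stage2 s1 (run_time stage2 X)"
    by (rule performs_static[OF static_stage(2)])
      (use for_bounds_stage(2) s1 len lenX in auto)
  moreover have "performs 25 stage3 s2 (run_time stage3 X)"
    by (rule performs_static[OF static_stage(3)])
      (use for_bounds_stage(3) S SB BX in \<open>auto simp: S_def\<close>)
  moreover have "performs 25 stage4 s3 (run_time stage4 X)"
    by (rule performs_static[OF static_stage(4)])
      (use for_bounds_stage(4) L QB BX in \<open>auto simp: S_def\<close>)
  moreover have "performs 25 stage5 s4 (run_time stage5 X)"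
  proof (rule performs_static[OF static_stage(5)])
    fix r assume "r \<in> for_bounds stage5"
    then consider "r = rn" | "r = rS" | "r = rS2" | "r = rL" | "r = rA"
      using for_bounds_stage(5) by blast
    then show "fst s4 r \<le> X"
      using sz fs4 AB SB LB len lenX BX unfolding sized_def S_def by cases auto
  qed
  ultimately have "performs 25 solver s (run_time stage1 X + (run_time stage2 X +
      (run_time stage3 X + (run_time stage4 X + run_time stage5 X))))"
    unfolding solver_def s4_def s3_def s2_run s1_def by (intro performs_Comp)
  then show "performs 25 solver s (run_time solver X)"
    unfolding solver_def by simp
qed

theorem theorem9:
  shows "fpt instances encode signed_domination (\<lambda>(G, k). twin_cover_number G)"
proof -
  let ?P = "Seq spread (compile solver 25)"
  have "poly_bounded (\<lambda>X. (X * 6 + 4) + run_time solver X)"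
    by (intro poly_bounded_add poly_bounded_times poly_bounded_const poly_bounded_run_time)
  then obtain K D where KD: "\<And>X. X \<ge> 1 \<Longrightarrow> X * 6 + 4 + run_time solver X \<le> K * X ^ D"
    unfolding poly_bounded_def by blast
  let ?g = "\<lambda>p. K * advice_bound p ^ D"
  have "\<exists>t s. exec ?P (word_input (encode (G, k))) t s \<and>
      t \<le> ?g (twin_cover_number G) * length (encode (G, k)) ^ D \<and>
      (result s \<noteq> 0 \<longleftrightarrow> (G, k) \<in> signed_domination)"
    if inst: "(G, k) \<in> instances" for G k
  proof -
    let ?w = "encode (G, k)"
    define X where "X = advice_bound (twin_cover_number G) * length ?w"
    obtain n where "pverts G = {..<n}" using inst unfolding instances_def by blast
    then have len: "length ?w \<ge> 1" using length_encode[of G n k] by simp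
    obtain R M where RM: "runs spread (word_input ?w) (6 * length ?w + 4) (R, M)"
      "word_store ?w R (unpack M)"
      using runs_spread by blast
    note correct = solver_correct[OF inst, of "(R, unpack M)", folded X_def]
    obtain \<sigma> where \<sigma>: "runs (compile solver 25) (R, M) (run_time solver X) \<sigma>"
      "represents 25 \<sigma> (run solver (R, unpack M))"
      using correct(2) RM(2) represents_self unfolding performs_def by fastforce
    obtain t where t: "exec ?P (word_input ?w) t \<sigma>" "t \<le> 6 * length ?w + 4 + run_time solver X"
      using runs_Seq[OF RM(1) \<sigma>(1)] unfolding runs_def by blast
    have "length ?w \<le> X" unfolding X_def advice_bound_def by simp
    then have "t \<le> X * 6 + 4 + run_time solver X" using t(2) by simp
    also have "\<dots> \<le> K * X ^ D" using KD len \<open>length ?w \<le> X\<close> by simp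
    \<comment> \<open>The power of the product separates into a computable function of the parameter
      and a power of the input length.\<close>
    also have "\<dots> = ?g (twin_cover_number G) * length ?w ^ D"
      unfolding X_def by (simp add: power_mult_distrib)
    finally have "t \<le> ?g (twin_cover_number G) * length ?w ^ D" .
    moreover have "result \<sigma> \<noteq> 0 \<longleftrightarrow> (G, k) \<in> signed_domination"
      using correct(1) RM(2) \<sigma>(2) unfolding result_def represents_def by simp
    ultimately show ?thesis using t(1) by blast
  qed
  then show ?thesis
    unfolding fpt_def
    by (intro exI[of _ ?P] exI[of _ ?g] exI[of _ D] conjI computable_advice_bound) auto
qed

end
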